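(* Let $O$ be a lopsp-operation and let $P$ and $Q$ be two cut-paths in $O$. Let $G$ be an embedded graph. Then $O_P(G)\cong O_Q(G)$ (isomorphism of labelled embedded graphs).
   Context: **Embedded graphs.** Graphs are finite and may have loops and multiple edges. Every edge with endpoints $v,w$ yields two mutually inverse oriented edges $e,e^{-1}$, one starting at $v$, the other at $w$ (for a loop both start at $v$). An embedded graph $G$ is a connected graph with at least one edge together with, for every vertex $v$, a cyclic order (the rotational order, drawn clockwise) of the oriented edges starting at $v$; $\sigma_G(e)$ is the successor of $e$. Oriented edges $e$ and $\sigma_G(e^{-1})$ form an angle; a face is a cyclic sequence of oriented edges in which any two consecutive ones form an angle (an orbit of $e\mapsto\sigma_G(e^{-1})$); its facial walk is the corresponding closed walk. The genus is $(2-|V_G|+|E_G|-|F_G|)/2$; plane means genus 0. An isomorphism of labelled embedded graphs is a graph isomorphism preserving the rotational orders and the types of vertices. **Barycentric subdivision and double chambers.** $B_G$ is the embedded graph with one vertex of type 0, 1, 2 for every vertex, edge, face of $G$, respectively. Edges of $B_G$ join incident vertices and edges, vertices and faces, edges and faces of $G$, with multiplicity (one 0–1 edge per oriented edge, one 0–2 edge per angle, one 1–2 edge per occurrence of an edge in a facial walk). The rotational order at a type-0 vertex follows the alternating sequence of edges and angles around it in $G$, similarly at type-1 vertices (which have degree 4); at a type-2 vertex it is the inverse of the order of vertices and edges along the facial walk. An edge is of type $i$ (an $i$-edge) if it is not incident with a vertex of type $i$ (an $i$-vertex). The double chamber system $D_G$ is the embedded subgraph of $B_G$ containing only the edges of types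 1 and 2; its faces, the double chambers, have facial walks of length four through one 2-vertex, a 0-vertex, one 1-vertex and a 0-vertex (the two 0-vertices may coincide). **lopsp-operations.** A lopsp-operation is a 2-connected plane embedded graph $O$ with a labelling $t:V_O\to\{0,1,2\}$ (types) and three distinct special vertices $v_0,v_1,v_2$ such that: every face (chamber) is a triangle; no edge joins vertices of the same type; every vertex of type 1 different from $v_0,v_1,v_2$ has degree 4; $t(v_0),t(v_2)\ne1$; if $t(v_1)=1$ then $\deg(v_1)=2$. A cut-path is a path $P$ in $O$ from $v_1$ to $v_2$ through $v_0$; $P_{a,b}$ denotes the subpath between $a$ and $b$. As an embedded subgraph $P$ has a single face; cutting $O$ open along $P$ (each vertex of $P$ other than $v_1,v_2$ and each edge of $P$ is split into two copies, one per side) gives the double chamber patch $O_P$, a plane graph whose outer boundary consists of two copies of $P$ sharing $v_1$ and $v_2$, passing through $v_2,v_{0,L},v_1,v_{0,R}$ in cyclic order, where $v_{0,L},v_{0,R}$ are the copies of $v_0$. **Application.** $D_{G,P}$ is obtained from $D_G$ by replacing every 2-edge by a copy of $P_{v_0,v_1}$ and every 1-edge by a copy of $P_{v_0,v_2}$, copies of $v_i$ being identified with $i$-vertices. Gluing a copy of $O_P$, preserving orientation, into every face of $D_{G,P}$, identifying corresponding boundary vertices and edges, gives the labelled embedded graph $O_P(G)$, whose vertices inherit their types from $O$. *)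

theory Defs
  imports
    Complex_Main
    "HOL-Combinatorics.Orbits"
    "Graph_Theory.Graph_Theory"
begin

section \<open>Embedded graphs\<close>

text \<open>
  The arcs of the underlying digraph are the oriented edges, \<open>opp\<close> sends an oriented
  edge to its inverse, and \<open>rot\<close> sends it to its clockwise successor in the rotational
  order around its starting vertex.  Since \<open>opp\<close> has no fixed points on arcs, a loop
  consists of two arcs, both starting at the same vertex.  The values of \<open>opp\<close>, \<open>rot\<close>,
  etc. outside the arcs and vertices are irrelevant.
\<close>

record ('v, 'd) emb =
  gr :: "('v, 'd) pre_digraph"
  opp :: "'d \<Rightarrow> 'd"
  rot :: "'d \<Rightarrow> 'd"

definition embedded_graph :: "('v, 'd, 'z) emb_scheme \<Rightarrow> bool" where
  "embedded_graph G \<longleftrightarrow>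
     fin_digraph (gr G) \<and> connected (gr G) \<and> arcs (gr G) \<noteq> {} \<and>
     (\<forall>a \<in> arcs (gr G). opp G a \<in> arcs (gr G) \<and> opp G a \<noteq> a \<and> opp G (opp G a) = a \<and>
        tail (gr G) (opp G a) = head (gr G) a) \<and>
     (\<forall>v \<in> verts (gr G). cyclic_on (rot G) (out_arcs (gr G) v))"

definition edges :: "('v, 'd, 'z) emb_scheme \<Rightarrow> 'd set set" where
  "edges G = (\<lambda>a. {a, opp G a}) ` arcs (gr G)"

definition face_of :: "('v, 'd, 'z) emb_scheme \<Rightarrow> 'd \<Rightarrow> 'd set" where
  "face_of G a = orbit (\<lambda>b. rot G (opp G b)) a"

definition faces :: "('v, 'd, 'z) emb_scheme \<Rightarrow> 'd set set" where
  "faces G = face_of G ` arcs (gr G)"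

definition degree :: "('v, 'd, 'z) emb_scheme \<Rightarrow> 'v \<Rightarrow> nat" where
  "degree G v = card (out_arcs (gr G) v)"

definition genus :: "('v, 'd, 'z) emb_scheme \<Rightarrow> real" where
  "genus G =
     (2 - real (card (verts (gr G))) + real (card (edges G)) - real (card (faces G))) / 2"

definition plane :: "('v, 'd, 'z) emb_scheme \<Rightarrow> bool" where
  "plane G \<longleftrightarrow> embedded_graph G \<and> genus G = 0"

definition two_connected :: "('v, 'd) pre_digraph \<Rightarrow> bool" where
  "two_connected g \<longleftrightarrow> card (verts g) \<ge> 3 \<and> connected g \<and>
     (\<forall>v \<in> verts g. connected (pre_digraph.del_vert g v))"

text \<open>The first element of \<open>S\<close> met after \<open>a\<close> when iterating \<open>r\<close>; \<open>a\<close> itself need not be in \<open>S\<close>.\<close>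

definition next_in :: "('d \<Rightarrow> 'd) \<Rightarrow> 'd set \<Rightarrow> 'd \<Rightarrow> 'd" where
  "next_in r S a = (r ^^ (LEAST n. 0 < n \<and> (r ^^ n) a \<in> S)) a"

definition sub_emb :: "('v, 'd, 'z) emb_scheme \<Rightarrow> 'd set \<Rightarrow> ('v, 'd, 'z) emb_scheme" where
  "sub_emb G S = G\<lparr>gr := (gr G)\<lparr>arcs := S\<rparr>, rot := next_in (rot G) S\<rparr>"

section \<open>Labelled embedded graphs\<close>

record ('v, 'd) lemb = "('v, 'd) emb" +
  vtype :: "'v \<Rightarrow> nat"

definition lemb_iso :: "('v, 'd, 'y) lemb_scheme \<Rightarrow> ('u, 'h, 'z) lemb_scheme \<Rightarrow> bool" where
  "lemb_iso G H \<longleftrightarrow> (\<exists>f g.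
     bij_betw f (verts (gr G)) (verts (gr H)) \<and>
     bij_betw g (arcs (gr G)) (arcs (gr H)) \<and>
     (\<forall>a \<in> arcs (gr G).
        tail (gr H) (g a) = f (tail (gr G) a) \<and> head (gr H) (g a) = f (head (gr G) a) \<and>
        opp H (g a) = g (opp G a) \<and> rot H (g a) = g (rot G a)) \<and>
     (\<forall>v \<in> verts (gr G). vtype H (f v) = vtype G v))"

definition has_edge_type :: "('v, 'd, 'z) lemb_scheme \<Rightarrow> nat \<Rightarrow> 'd \<Rightarrow> bool" where
  "has_edge_type G i a \<longleftrightarrow> vtype G (tail (gr G) a) \<noteq> i \<and> vtype G (head (gr G) a) \<noteq> i"

section \<open>Barycentric subdivision and double chambers\<close>

text \<open>
  \<open>VE a\<close> goes from the start of \<open>a\<close> to the edge of \<open>a\<close>.  \<open>VF a\<close> goes from the start of \<open>a\<close>,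
  through the angle between \<open>a\<close> and \<open>rot G a\<close>, to the face containing that angle, i.e.
  the face of \<open>rot G a\<close>.  \<open>EF a\<close> goes from the edge of \<open>a\<close> to the face of \<open>a\<close>.  The
  constructors \<open>EV\<close>, \<open>FV\<close>, \<open>FE\<close> are the respective inverses.

  With clockwise rotations the face of \<open>a\<close> lies to the left of \<open>a\<close>.  Its facial walk reads
  \<open>a\<close>, the angle of \<open>opp G a\<close>, then \<open>rot G (opp G a)\<close>, and so on; the rotation at the
  2-vertex runs through these in the opposite direction.
\<close>

datatype ('v, 'd) bvert = BV 'v | BE "'d set" | BF "'d set"

datatype 'd bdart = VE 'd | EV 'd | VF 'd | FV 'd | EF 'd | FE 'd

fun bary_typ :: "('v, 'd) bvert \<Rightarrow> nat" where
  "bary_typ (BV v) = 0"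
| "bary_typ (BE e) = 1"
| "bary_typ (BF f) = 2"

fun bary_opp :: "'d bdart \<Rightarrow> 'd bdart" where
  "bary_opp (VE a) = EV a"
| "bary_opp (EV a) = VE a"
| "bary_opp (VF a) = FV a"
| "bary_opp (FV a) = VF a"
| "bary_opp (EF a) = FE a"
| "bary_opp (FE a) = EF a"

fun bary_tail :: "('v, 'd, 'z) emb_scheme \<Rightarrow> 'd bdart \<Rightarrow> ('v, 'd) bvert" where
  "bary_tail G (VE a) = BV (tail (gr G) a)"
| "bary_tail G (VF a) = BV (tail (gr G) a)"
| "bary_tail G (EV a) = BE {a, opp G a}"
| "bary_tail G (EF a) = BE {a, opp G a}"
| "bary_tail G (FV a) = BF (face_of G (rot G a))"
| "bary_tail G (FE a) = BF (face_of G a)"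

fun bary_rot :: "('v, 'd, 'z) emb_scheme \<Rightarrow> 'd bdart \<Rightarrow> 'd bdart" where
  "bary_rot G (VE a) = VF a"
| "bary_rot G (VF a) = VE (rot G a)"
| "bary_rot G (EV a) = EF a"
| "bary_rot G (EF a) = EV (opp G a)"
| "bary_rot G (FV a) = FE (opp G a)"
| "bary_rot G (FE a) = FV (inv_into (arcs (gr G)) (rot G) a)"

definition bary :: "('v, 'd, 'z) emb_scheme \<Rightarrow> (('v, 'd) bvert, 'd bdart) lemb" where
  "bary G =
     \<lparr>gr = \<lparr>verts = BV ` verts (gr G) \<union> BE ` edges G \<union> BF ` faces G,
            arcs = (\<Union>a \<in> arcs (gr G). {VE a, EV a, VF a, FV a, EF a, FE a}),
            tail = bary_tail G,
            head = (\<lambda>x. bary_tail G (bary_opp x))\<rparr>,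
      opp = bary_opp,
      rot = bary_rot G,
      vtype = bary_typ\<rparr>"

definition double_chamber_system ::
    "('v, 'd, 'z) emb_scheme \<Rightarrow> (('v, 'd) bvert, 'd bdart) lemb" where
  "double_chamber_system G =
     sub_emb (bary G)
       {x \<in> arcs (gr (bary G)). has_edge_type (bary G) 1 x \<or> has_edge_type (bary G) 2 x}"

section \<open>Lopsp-operations and cut-paths\<close>

text \<open>\<open>special Op i\<close> is the special vertex $v_i$ for \<open>i \<in> {0, 1, 2}\<close>.\<close>

record ('w, 'c) lopsp = "('w, 'c) lemb" +
  special :: "nat \<Rightarrow> 'w"

definition lopsp_operation :: "('w, 'c, 'z) lopsp_scheme \<Rightarrow> bool" where
  "lopsp_operation Op \<longleftrightarrow>
     plane Op \<and> two_connected (gr Op) \<and>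
     (\<forall>v \<in> verts (gr Op). vtype Op v \<in> {0, 1, 2}) \<and>
     special Op ` {0, 1, 2} \<subseteq> verts (gr Op) \<and> inj_on (special Op) {0, 1, 2} \<and>
     (\<forall>f \<in> faces Op. card f = 3) \<and>
     (\<forall>a \<in> arcs (gr Op). vtype Op (tail (gr Op) a) \<noteq> vtype Op (head (gr Op) a)) \<and>
     (\<forall>v \<in> verts (gr Op) - special Op ` {0, 1, 2}. vtype Op v = 1 \<longrightarrow> degree Op v = 4) \<and>
     vtype Op (special Op 0) \<noteq> 1 \<and> vtype Op (special Op 2) \<noteq> 1 \<and>
     (vtype Op (special Op 1) = 1 \<longrightarrow> degree Op (special Op 1) = 2)"

definition cut_path :: "('w, 'c, 'z) lopsp_scheme \<Rightarrow> 'c list \<Rightarrow> bool" where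
  "cut_path Op P \<longleftrightarrow>
     pre_digraph.apath (gr Op) (special Op 1) P (special Op 2) \<and>
     special Op 0 \<in> set (pre_digraph.awalk_verts (gr Op) (special Op 1) P)"

definition both_dirs :: "('w, 'c, 'z) emb_scheme \<Rightarrow> 'c list \<Rightarrow> 'c set" where
  "both_dirs G p = set p \<union> opp G ` set p"

text \<open>
  The oriented edges (in both directions) of $P_{v_0,v_1}$ and $P_{v_0,v_2}$.  The list \<open>P\<close>
  runs from $v_1$ to $v_2$, so it splits at its unique arc starting at $v_0$.
\<close>

definition path01 :: "('w, 'c, 'z) lopsp_scheme \<Rightarrow> 'c list \<Rightarrow> 'c set" where
  "path01 Op P = both_dirs Op (takeWhile (\<lambda>a. tail (gr Op) a \<noteq> special Op 0) P)"

definition path02 :: "('w, 'c, 'z) lopsp_scheme \<Rightarrow> 'c list \<Rightarrow> 'c set" where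
  "path02 Op P = both_dirs Op (dropWhile (\<lambda>a. tail (gr Op) a \<noteq> special Op 0) P)"

section \<open>The double chamber patch\<close>

text \<open>
  As an embedded subgraph, the path has oriented edges \<open>S = both_dirs Op P\<close> and successor
  \<open>next_in (rot Op) S\<close>.  The copies of a vertex \<open>w\<close> of the path are its angles in this
  subgraph, \<open>Corner c\<close> being the angle that ends (clockwise) at \<open>c \<in> S\<close>; so $v_1$ and $v_2$
  have one copy and all other path vertices have two.

  A path edge \<open>{c, opp c}\<close> has the two copies \<open>{Inner c, Outer (opp c)}\<close> and
  \<open>{Inner (opp c), Outer c}\<close>.  \<open>Inner c\<close> is the copy of \<open>c\<close> with the patch on its left,
  \<open>Outer c\<close> the copy of \<open>c\<close> with the outer face on its left.  Clockwise around \<open>Corner c\<close> one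
  meets \<open>Outer b\<close> for the \<open>b \<in> S\<close> with successor \<open>c\<close>, then the oriented edges of \<open>Op\<close> strictly
  between \<open>b\<close> and \<open>c\<close>, and finally \<open>Inner c\<close>.
\<close>

datatype ('w, 'c) patch_vert = Interior 'w | Corner 'c

datatype 'c patch_dart = Uncut 'c | Inner 'c | Outer 'c

fun patch_tail :: "('w, 'c, 'z) emb_scheme \<Rightarrow> 'c set \<Rightarrow> 'c patch_dart \<Rightarrow> ('w, 'c) patch_vert" where
  "patch_tail K S (Uncut a) =
     (if tail (gr K) a \<in> tail (gr K) ` S then Corner (next_in (rot K) S a)
      else Interior (tail (gr K) a))"
| "patch_tail K S (Inner c) = Corner c"
| "patch_tail K S (Outer b) = Corner (next_in (rot K) S b)"

fun patch_opp :: "('w, 'c, 'z) emb_scheme \<Rightarrow> 'c patch_dart \<Rightarrow> 'c patch_dart" where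
  "patch_opp K (Uncut a) = Uncut (opp K a)"
| "patch_opp K (Inner c) = Outer (opp K c)"
| "patch_opp K (Outer c) = Inner (opp K c)"

fun patch_rot :: "('w, 'c, 'z) emb_scheme \<Rightarrow> 'c set \<Rightarrow> 'c patch_dart \<Rightarrow> 'c patch_dart" where
  "patch_rot K S (Uncut a) = (if rot K a \<in> S then Inner (rot K a) else Uncut (rot K a))"
| "patch_rot K S (Outer b) = (if rot K b \<in> S then Inner (rot K b) else Uncut (rot K b))"
| "patch_rot K S (Inner c) = Outer (THE b. b \<in> S \<and> next_in (rot K) S b = c)"

fun patch_typ :: "('w, 'c, 'z) lemb_scheme \<Rightarrow> ('w, 'c) patch_vert \<Rightarrow> nat" where
  "patch_typ K (Interior w) = vtype K w"
| "patch_typ K (Corner c) = vtype K (tail (gr K) c)"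

definition patch ::
    "('w, 'c, 'z) lopsp_scheme \<Rightarrow> 'c list \<Rightarrow> (('w, 'c) patch_vert, 'c patch_dart) lemb" where
  "patch Op P = (let S = both_dirs Op P in
     \<lparr>gr = \<lparr>verts = Interior ` (verts (gr Op) - tail (gr Op) ` S) \<union> Corner ` S,
            arcs = Uncut ` (arcs (gr Op) - S) \<union> Inner ` S \<union> Outer ` S,
            tail = patch_tail Op S,
            head = (\<lambda>x. patch_tail Op S (patch_opp Op x))\<rparr>,
      opp = patch_opp Op,
      rot = patch_rot Op S,
      vtype = patch_typ Op\<rparr>)"

section \<open>Replacing the edges of the double chamber system by paths\<close>

text \<open>
  An edge of \<open>D = double_chamber_system G\<close> is represented by its oriented edge \<open>h\<close> starting at
  the 0-vertex; \<open>h\<close> is replaced by the copy \<open>{(h, p) | p \<in> segment h}\<close> of a subpath of \<open>P\<close>.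
  \<open>Old u\<close> is a vertex \<open>u\<close> of \<open>D\<close>, identified with the copies of $v_i$ where \<open>i\<close> is the type of
  \<open>u\<close>; it therefore inherits the type of $v_i$ in \<open>Op\<close>.  \<open>Mid h x\<close> is the copy in \<open>h\<close> of an inner
  vertex \<open>x\<close> of the subpath.
\<close>

datatype ('u, 'h, 'w) path_vert = Old 'u | Mid 'h 'w

definition segment :: "('w, 'c, 'z) lopsp_scheme \<Rightarrow> 'c list \<Rightarrow> ('u, 'h, 'y) lemb_scheme \<Rightarrow> 'h \<Rightarrow> 'c set" where
  "segment Op P D h = (if has_edge_type D 2 h then path01 Op P else path02 Op P)"

definition path_pos ::
    "('w, 'c, 'z) lopsp_scheme \<Rightarrow> ('u, 'h, 'y) lemb_scheme \<Rightarrow> 'h \<Rightarrow> 'w \<Rightarrow> ('u, 'h, 'w) path_vert" where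
  "path_pos Op D h x =
     (if x = special Op 0 then Old (tail (gr D) h)
      else if x \<in> special Op ` {1, 2} then Old (head (gr D) h)
      else Mid h x)"

definition path_rot ::
    "('w, 'c, 'z) lopsp_scheme \<Rightarrow> 'c list \<Rightarrow> ('u, 'h, 'y) lemb_scheme \<Rightarrow> 'h \<times> 'c \<Rightarrow> 'h \<times> 'c" where
  "path_rot Op P D = (\<lambda>(h, p).
     if tail (gr Op) p \<in> special Op ` {0, 1, 2} then
       let h' = (if tail (gr Op) p = special Op 0 then rot D h else opp D (rot D (opp D h)))
       in (h', THE q. q \<in> segment Op P D h' \<and> tail (gr Op) q = tail (gr Op) p)
     else (h, THE q. q \<in> segment Op P D h \<and> tail (gr Op) q = tail (gr Op) p \<and> q \<noteq> p))"

fun path_typ ::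
    "('w, 'c, 'z) lopsp_scheme \<Rightarrow> ('u, 'h, 'y) lemb_scheme \<Rightarrow> ('u, 'h, 'w) path_vert \<Rightarrow> nat" where
  "path_typ Op D (Old u) = vtype Op (special Op (vtype D u))"
| "path_typ Op D (Mid h x) = vtype Op x"

definition path_system ::
    "('w, 'c, 'z) lopsp_scheme \<Rightarrow> 'c list \<Rightarrow> ('v, 'd, 'y) emb_scheme \<Rightarrow>
       ((('v, 'd) bvert, 'd bdart, 'w) path_vert, 'd bdart \<times> 'c) lemb" where
  "path_system Op P G = (let
       D = double_chamber_system G;
       H = {h \<in> arcs (gr D). vtype D (tail (gr D) h) = 0}
     in
     \<lparr>gr = \<lparr>verts = Old ` verts (gr D) \<union>
              {Mid h x | h x. h \<in> H \<and> x \<in> tail (gr Op) ` segment Op P D h - special Op ` {0, 1, 2}},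
            arcs = (SIGMA h:H. segment Op P D h),
            tail = (\<lambda>(h, p). path_pos Op D h (tail (gr Op) p)),
            head = (\<lambda>(h, p). path_pos Op D h (head (gr Op) p))\<rparr>,
      opp = (\<lambda>(h, p). (h, opp Op p)),
      rot = path_rot Op P D,
      vtype = path_typ Op D\<rparr>)"

section \<open>Gluing\<close>

text \<open>
  Let \<open>K = path_system Op P G\<close>.  Every face of \<open>K\<close> lies to the left of its oriented edges and
  contains, for every \<open>c \<in> both_dirs Op P\<close>, exactly one copy \<open>(h, c)\<close> of \<open>c\<close>; the copy of the patch
  glued into that face has its \<open>Inner c\<close> identified with \<open>(h, c)\<close>.  The functions \<open>put_vert\<close> and
  \<open>put_dart\<close> map the copy of the patch for the face \<open>f\<close> into the glued graph: the boundary is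
  mapped to \<open>K\<close> and the rest is kept separate for each \<open>f\<close>.
\<close>

datatype ('k, 'f, 'w) glue_vert = OnBoundary 'k | InFace 'f 'w

datatype ('x, 'f, 'c) glue_dart = BoundaryDart 'x | FaceDart 'f 'c

definition boundary_dart :: "('h \<times> 'c) set \<Rightarrow> 'c \<Rightarrow> 'h \<times> 'c" where
  "boundary_dart f c = (THE x. x \<in> f \<and> snd x = c)"

fun put_vert ::
    "('k, 'h \<times> 'c, 'z) emb_scheme \<Rightarrow> ('h \<times> 'c) set \<Rightarrow> ('w, 'c) patch_vert \<Rightarrow>
       ('k, ('h \<times> 'c) set, 'w) glue_vert" where
  "put_vert K f (Interior w) = InFace f w"
| "put_vert K f (Corner c) = OnBoundary (tail (gr K) (boundary_dart f c))"

fun put_dart ::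
    "('w, 'c, 'y) emb_scheme \<Rightarrow> ('k, 'h \<times> 'c, 'z) emb_scheme \<Rightarrow> ('h \<times> 'c) set \<Rightarrow> 'c patch_dart \<Rightarrow>
       ('h \<times> 'c, ('h \<times> 'c) set, 'c) glue_dart" where
  "put_dart Op K f (Uncut a) = FaceDart f a"
| "put_dart Op K f (Inner c) = BoundaryDart (boundary_dart f c)"
| "put_dart Op K f (Outer c) = BoundaryDart (opp K (boundary_dart f (opp Op c)))"

fun glue_tail ::
    "('w, 'c, 'z) lopsp_scheme \<Rightarrow> 'c list \<Rightarrow> ('k, 'h \<times> 'c, 'y) emb_scheme \<Rightarrow>
       ('h \<times> 'c, ('h \<times> 'c) set, 'c) glue_dart \<Rightarrow> ('k, ('h \<times> 'c) set, 'w) glue_vert" where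
  "glue_tail Op P K (BoundaryDart x) = OnBoundary (tail (gr K) x)"
| "glue_tail Op P K (FaceDart f a) = put_vert K f (tail (gr (patch Op P)) (Uncut a))"

fun glue_opp ::
    "('w, 'c, 'z) lopsp_scheme \<Rightarrow> ('k, 'h \<times> 'c, 'y) emb_scheme \<Rightarrow>
       ('h \<times> 'c, ('h \<times> 'c) set, 'c) glue_dart \<Rightarrow> ('h \<times> 'c, ('h \<times> 'c) set, 'c) glue_dart" where
  "glue_opp Op K (BoundaryDart x) = BoundaryDart (opp K x)"
| "glue_opp Op K (FaceDart f a) = FaceDart f (opp Op a)"

text \<open>
  Clockwise after a boundary dart \<open>x\<close>, i.e. to its right, lies the face of \<open>opp K x\<close>, in whose
  patch \<open>x\<close> is the copy of \<open>Outer (snd x)\<close>.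
\<close>

fun glue_rot ::
    "('w, 'c, 'z) lopsp_scheme \<Rightarrow> 'c list \<Rightarrow> ('k, 'h \<times> 'c, 'y) emb_scheme \<Rightarrow>
       ('h \<times> 'c, ('h \<times> 'c) set, 'c) glue_dart \<Rightarrow> ('h \<times> 'c, ('h \<times> 'c) set, 'c) glue_dart" where
  "glue_rot Op P K (BoundaryDart x) =
     put_dart Op K (face_of K (opp K x)) (rot (patch Op P) (Outer (snd x)))"
| "glue_rot Op P K (FaceDart f a) = put_dart Op K f (rot (patch Op P) (Uncut a))"

fun glue_typ ::
    "('w, 'c, 'z) lopsp_scheme \<Rightarrow> 'c list \<Rightarrow> ('k, 'x, 'y) lemb_scheme \<Rightarrow>
       ('k, 'f, 'w) glue_vert \<Rightarrow> nat" where
  "glue_typ Op P K (OnBoundary k) = vtype K k"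
| "glue_typ Op P K (InFace f w) = vtype (patch Op P) (Interior w)"

definition apply_lopsp ::
    "('w, 'c, 'z) lopsp_scheme \<Rightarrow> 'c list \<Rightarrow> ('v, 'd, 'y) emb_scheme \<Rightarrow>
       (((('v, 'd) bvert, 'd bdart, 'w) path_vert, ('d bdart \<times> 'c) set, 'w) glue_vert,
        ('d bdart \<times> 'c, ('d bdart \<times> 'c) set, 'c) glue_dart) lemb" where
  "apply_lopsp Op P G = (let K = path_system Op P G in
     \<lparr>gr = \<lparr>verts = (\<Union>f \<in> faces K. put_vert K f ` verts (gr (patch Op P))),
            arcs = (\<Union>f \<in> faces K. put_dart Op K f ` arcs (gr (patch Op P))),
            tail = glue_tail Op P K,
            head = (\<lambda>x. glue_tail Op P K (glue_opp Op K x))\<rparr>,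
      opp = glue_opp Op K,
      rot = glue_rot Op P K,
      vtype = glue_typ Op P K\<rparr>)"

end

theory Submission
  imports Defs
begin

text \<open>
  The double chambers of \<open>G\<close> correspond to its oriented edges \<open>d\<close>, so the oriented edges of
  $O_P(G)$ are pairs \<open>(d, c)\<close> with \<open>c\<close> an oriented edge of $O$; the left side of \<open>(d, c)\<close> lies in
  the double chamber \<open>d\<close>.  Crossing \<open>c\<close> moves \<open>d\<close> by a permutation: by \<open>\<alpha> = opp\<close> if \<open>c\<close> lies on
  $P_{v_0,v_1}$, by \<open>\<beta> = opp \<circ> rot\<close> or its inverse if \<open>c\<close> lies on $P_{v_0,v_2}$, and by the
  identity otherwise.  Hence $O_P(G)$ is determined by a 1-cochain $\nu_P$ on the dual of $O$, which
  can be read in the free group on \<open>\<alpha>\<close> and \<open>\<beta>\<close>, and cochains that differ by a gauge transformation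
  (a function on the faces of $O$) give isomorphic graphs.

  The cochain $\nu_Q$ is flat at all vertices other than $v_0, v_1, v_2$.  Since $O$ is plane, a
  gauge transformation makes it vanish outside a spanning tree containing \<open>P\<close>; by flatness it then
  vanishes outside \<open>P\<close> and is constant on $P_{v_0,v_1}$ and on $P_{v_0,v_2}$.  The two constants
  are conjugate to \<open>\<alpha>\<close> and to \<open>\<beta>\<close>, and their quotient is conjugate to that of \<open>\<beta>\<close> and \<open>\<alpha>\<close>, because
  holonomies around $v_1$, $v_2$, $v_0$ are invariant up to conjugation.  In a free group this forces
  a simultaneous conjugation, so that $\nu_Q$ and $\nu_P$ differ by a gauge transformation.
\<close>

section \<open>Free groups\<close>

text \<open>Conjugacy of each of \<open>\<alpha>\<close>, \<open>\<beta>\<close> and their quotient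
  separately need not come from one common conjugator in the permutation group of a given
  \<open>G\<close>. Therefore the comparison takes place in the free group, and only the resulting
  gauge transformation is made to act on the double chambers of \<open>G\<close>. Genus 0 enters at
  one point: an edge that closes a cycle has different faces on its two sides
  (\<open>cycle_separates\<close>), so that its label can be shifted away from one side alone.
  Naming an arc of the glued graph by the double chamber on its left gives a unique name also to
  boundary arcs, which belong to two patches, and lets reversal and rotation depend on the cut-path
  through the crossing permutations only. The vertices carry names that do depend on the path. They
  are recovered as classes of arcs under rotation, a description that a gauge transformation carries
  along; proving that rotation identifies enough arcs is the longest part of the work on the glued
  graph.\<close>

definition linv :: "'a \<times> bool \<Rightarrow> 'a \<times> bool" where
  "linv x = (fst x, \<not> snd x)"

lemma linv_linv [simp]: "linv (linv x) = x"
  by (simp add: linv_def)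

lemma linv_eq_iff [simp]: "linv x = linv y \<longleftrightarrow> x = y"
  by (auto simp: linv_def prod_eq_iff)

lemma linv_neq [simp]: "linv x \<noteq> x" "x \<noteq> linv x"
  by (auto simp: linv_def prod_eq_iff)

abbreviation reduced :: "('a \<times> bool) list \<Rightarrow> bool" where
  "reduced \<equiv> successively (\<lambda>x y. y \<noteq> linv x)"

text \<open>With multiplication as \<open>foldr push\<close>, a letter cancels at most once when it
  is added, and associativity becomes a statement about words acting on reduced words.\<close>

fun push :: "'a \<times> bool \<Rightarrow> ('a \<times> bool) list \<Rightarrow> ('a \<times> bool) list" where
  "push x [] = [x]"
| "push x (y # ys) = (if y = linv x then ys else x # y # ys)"

lemma reduced_push: "reduced w \<Longrightarrow> reduced (push x w)"
  by (cases w) (auto simp: successively_Cons)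

lemma push_linv: "reduced w \<Longrightarrow> push x (push (linv x) w) = w"
  by (cases w; cases "tl w") auto

lemma reduced_foldr_push: "reduced w \<Longrightarrow> reduced (foldr push u w)"
  by (induction u) (auto simp: reduced_push)

lemma foldr_push_append: "reduced (u @ w) \<Longrightarrow> foldr push u w = u @ w"
proof (induction u)
  case (Cons x u)
  then show ?case by (cases "u @ w") (auto simp: successively_Cons)
qed simp

text \<open>If \<open>x\<close> cancels against the head of \<open>t\<close>, the two letters act as
  mutually inverse maps (\<open>push_linv\<close>), so normalising before acting changes
  nothing.\<close>

lemma foldr_push_push: "reduced w \<Longrightarrow> foldr push (push x t) w = push x (foldr push t w)"
  by (cases t) (auto simp: push_linv reduced_foldr_push)

lemma foldr_push_assoc:
  "reduced w \<Longrightarrow> foldr push (foldr push u v) w = foldr push u (foldr push v w)"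
  by (induction u) (auto simp: foldr_push_push)

lemma reduced_rev_linv: "reduced w \<Longrightarrow> reduced (rev (map linv w))"
  by (simp add: successively_rev successively_map)
     (erule successively_mono, auto dest: arg_cong[where f = linv])

lemma foldr_push_rev_linv: "foldr push (rev (map linv u)) u = []"
  by (induction u) auto

typedef 'a free_group = "{w :: ('a \<times> bool) list. reduced w}"
  morphisms word Abs_free_group
  by (rule exI[of _ "[]"]) simp

setup_lifting type_definition_free_group

lemma reduced_word [simp]: "reduced (word u)"
  using word by blast

text \<open>The group is written additively, because \<open>group_add\<close> is the class of noncommutative groups.\<close>

instantiation free_group :: (type) group_add
begin

lift_definition zero_free_group :: "'a free_group" is "[]" by simp

lift_definition plus_free_group :: "'a free_group \<Rightarrow> 'a free_group \<Rightarrow> 'a free_group"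
  is "foldr push" by (rule reduced_foldr_push)

lift_definition uminus_free_group :: "'a free_group \<Rightarrow> 'a free_group"
  is "\<lambda>w. rev (map linv w)" by (rule reduced_rev_linv)

definition minus_free_group :: "'a free_group \<Rightarrow> 'a free_group \<Rightarrow> 'a free_group" where
  "minus_free_group u v = u + - v"

instance
proof
  fix a b c :: "'a free_group"
  show "a + b + c = a + (b + c)"
    by transfer (rule foldr_push_assoc)
  show "0 + a = a"
    by transfer simp
  show "a + 0 = a"
    by transfer (simp add: foldr_push_append)
  show "- a + a = 0"
    by transfer (rule foldr_push_rev_linv)
  show "a + - b = a - b"
    by (simp add: minus_free_group_def)
qed

end

definition gen :: "'a \<Rightarrow> 'a free_group" where
  "gen a = Abs_free_group [(a, True)]"

lemma word_gen [simp]: "word (gen a) = [(a, True)]"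
  by (simp add: gen_def Abs_free_group_inverse)

lemma word_zero [simp]: "word 0 = []"
  by (rule zero_free_group.rep_eq)

lemma word_plus: "word (u + v) = foldr push (word u) (word v)"
  by (rule plus_free_group.rep_eq)

lemma word_uminus: "word (- u) = rev (map linv (word u))"
  by (rule uminus_free_group.rep_eq)

lemma word_plus_reduced: "reduced (word u @ word v) \<Longrightarrow> word (u + v) = word u @ word v"
  by (simp add: word_plus foldr_push_append)

lemma word_minus_reduced: "reduced (word u @ word (- v)) \<Longrightarrow> word (u - v) = word u @ word (- v)"
  using word_plus_reduced[of u "- v"] by simp

lemma word_appendE:
  assumes "word g = u @ v"
  obtains g1 g2 where "g = g1 + g2" "word g1 = u" "word g2 = v"
proof
  have r: "reduced u" "reduced v"
    using reduced_word[of g] assms by (auto simp: successively_append_iff)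
  then show w: "word (Abs_free_group u) = u" "word (Abs_free_group v) = v"
    by (auto simp: Abs_free_group_inverse)
  have "word (Abs_free_group u + Abs_free_group v) = word g"
    using w assms reduced_word[of g] by (simp add: word_plus_reduced)
  then show "g = Abs_free_group u + Abs_free_group v"
    by (simp add: word_inject)
qed

lemma word_singleton: "word g = [(a, s)] \<Longrightarrow> g = (if s then gen a else - gen a)"
  by (auto simp: word_inject[symmetric] word_uminus linv_def)

lemma length_push: "length (push x w) \<le> Suc (length w)"
  by (cases w) auto

lemma length_word_plus: "length (word (u + v)) \<le> length (word u) + length (word v)"
proof -
  have "length (foldr push u v) \<le> length u + length v" for u v :: "('a \<times> bool) list"
  proof (induction u)
    case (Cons x u)
    then show ?case using length_push[of x "foldr push u v"] by simp
  qed simp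
  then show ?thesis by (simp add: word_plus)
qed

lemma length_word_uminus [simp]: "length (word (- u)) = length (word u)"
  by (simp add: word_uminus)

definition nsum :: "nat \<Rightarrow> 'g::group_add \<Rightarrow> 'g" where
  "nsum n x = ((+) x ^^ n) 0"

lemma nsum_0 [simp]: "nsum 0 x = 0"
  and nsum_Suc: "nsum (Suc n) x = x + nsum n x"
  by (simp_all add: nsum_def)

lemma nsum_conj: "nsum n (k + x - k) = k + nsum n x - (k :: 'g::group_add)"
  by (induction n)
     (simp_all add: nsum_Suc add.assoc diff_conv_add_uminus del: add_uminus_conv_diff)

lemma length_word_nsum_le: "length (word (nsum n x)) \<le> n * length (word x)"
proof (induction n)
  case (Suc n)
  then show ?case using length_word_plus[of x "nsum n x"] by (simp add: nsum_Suc)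
qed simp

text \<open>The hypothesis makes \<open>x\<close> cyclically reduced: no seam between consecutive
  copies cancels.\<close>

lemma length_word_nsum:
  assumes "reduced (word x @ word x)"
  shows "length (word (nsum n x)) = n * length (word x)"
proof (cases "word x = []")
  case True
  then show ?thesis using length_word_nsum_le[of n x] by simp
next
  case False
  \<comment> \<open>The prefix \<open>word x\<close> is part of the claim because the next seam is
    then one between two copies of \<open>word x\<close>.\<close>
  have "\<exists>t. word (nsum (Suc n) x) = word x @ t \<and> length t = n * length (word x)" for n
  proof (induction n)
    case 0
    then show ?case by (simp add: nsum_Suc)
  next
    case (Suc n)
    then obtain t where t: "word (nsum (Suc n) x) = word x @ t" "length t = n * length (word x)"
      by blast
    have "reduced (word x @ t)" using reduced_word[of "nsum (Suc n) x"] t by simp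
    then have "reduced (word x @ word x @ t)"
      using assms False by (auto simp: successively_append_iff)
    then have "word (x + nsum (Suc n) x) = word x @ word x @ t"
      using t by (subst word_plus_reduced) auto
    then show ?case using t by (intro exI[of _ "word x @ t"]) (simp add: nsum_Suc)
  qed
  then show ?thesis
    by (cases n) (simp, metis length_append mult_Suc)
qed

text \<open>
  Take the conjugator \<open>g\<close> relating the two conjugations of minimal length.  If it is not trivial,
  then \<open>g + gen b - g - gen a\<close> is cyclically reduced of length \<open>2 * length g + 2\<close>, so the lengths of its
  multiples grow faster than those of the conjugate element \<open>gen b - gen a\<close>.
\<close>

theorem free_group_simultaneous_conj:
  fixes a b :: 'a
  assumes "a \<noteq> b"
    and a': "a' = p + gen a - p" and b': "b' = q + gen b - q"
    and c: "b' - a' = r + (gen b - gen a) - r"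
  shows "\<exists>h. a' = h + gen a - h \<and> b' = h + gen b - h"
proof -
  define K where "K n \<longleftrightarrow> (\<exists>h g. length (word g) = n \<and> a' = h + gen a - h \<and>
    b' = (h + g) + gen b - (h + g))" for n
  \<comment> \<open>Witnesses: \<open>h = p\<close> and \<open>h + g = q\<close>.\<close>
  have "K (length (word (- p + q)))"
    unfolding K_def by (intro exI[of _ p] exI[of _ "- p + q"]) (simp add: a' b' add.assoc[symmetric])
  then have "K (LEAST n. K n)"
    by (rule LeastI)
  then obtain h g where hg: "length (word g) = (LEAST n. K n)" "a' = h + gen a - h"
    "b' = (h + g) + gen b - (h + g)"
    unfolding K_def by blast
  have least: "length (word g) \<le> length (word g2)"
    if "a' = h2 + gen a - h2" "b' = (h2 + g2) + gen b - (h2 + g2)" for h2 g2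
    unfolding hg(1) by (rule Least_le) (use that in \<open>auto simp: K_def\<close>)
  show ?thesis
  proof (cases "word g = []")
    case True
    then have "g = 0" by (simp add: word_inject[symmetric])
    then show ?thesis using hg by auto
  next
    case False
    \<comment> \<open>A last letter \<open>b\<close> of either sign commutes with
      \<open>gen b\<close> and could be dropped from \<open>g\<close>.\<close>
    have last: "fst (last (word g)) \<noteq> b"
    proof
      assume "fst (last (word g)) = b"
      then obtain u s where "word g = u @ [(b, s)]"
        using False by (metis append_butlast_last_id prod.collapse)
      then obtain g1 g2 where g: "g = g1 + g2" "word g1 = u" "word g2 = [(b, s)]"
        by (rule word_appendE)
      have comm: "g2 + gen b - g2 = gen b"
        using word_singleton[OF g(3)] by (simp split: if_splits)
      have "b' = (h + g1) + (g2 + gen b - g2) - (h + g1)"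
        using hg(3) g(1) by (simp add: add.assoc diff_conv_add_uminus minus_add del: add_uminus_conv_diff)
      then have "length (word g) \<le> length (word g1)"
        using comm hg(2) by (intro least) auto
      then show False using g \<open>word g = u @ [(b, s)]\<close> by simp
    qed
    \<comment> \<open>A first letter \<open>a\<close> of either sign commutes with
      \<open>gen a\<close> and could be moved from \<open>g\<close> into \<open>h\<close>.\<close>
    have hd: "fst (hd (word g)) \<noteq> a"
    proof
      assume "fst (hd (word g)) = a"
      then obtain u s where "word g = [(a, s)] @ u"
        using False by (metis append_Cons append_Nil list.collapse prod.collapse)
      then obtain g1 g2 where g: "g = g1 + g2" "word g1 = [(a, s)]" "word g2 = u"
        by (rule word_appendE)
      have comm: "g1 + gen a - g1 = gen a"
        using word_singleton[OF g(2)] by (simp split: if_splits)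
      have "a' = h + (g1 + gen a - g1) - h" using comm hg(2) by simp
      also have "\<dots> = (h + g1) + gen a - (h + g1)"
        by (simp add: add.assoc diff_conv_add_uminus minus_add del: add_uminus_conv_diff)
      finally have "length (word g) \<le> length (word g2)"
        using hg(3) g(1) by (intro least[of "h + g1"]) (auto simp: add.assoc)
      then show False using g \<open>word g = [(a, s)] @ u\<close> by simp
    qed
    \<comment> \<open>This is \<open>b' - a'\<close> conjugated by \<open>- h\<close>. The two facts
      above exclude cancellation inside it and between two copies of it.\<close>
    let ?X = "g + gen b - g - gen a"
    let ?w = "word g"
    let ?i = "rev (map linv ?w)"
    have ri: "reduced ?i" using reduced_word by (rule reduced_rev_linv)
    have li: "last ?i = linv (hd ?w)" "hd ?i = linv (last ?w)" "?i \<noteq> []"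
      using False by (auto simp: last_rev hd_rev hd_map last_map)
    have l1: "(b, s) \<noteq> linv (last ?w)" "last ?w \<noteq> (b, s)" for s
      using last by (auto simp: linv_def)
    have l2: "(a, s) \<noteq> hd ?w" "hd ?w \<noteq> linv (a, s)" for s
      using hd by (metis fst_conv, metis fst_conv linv_def)
    have w1: "word (g + gen b) = ?w @ [(b, True)]"
      using l1 False by (subst word_plus_reduced) (auto simp: successively_append_iff)
    have w2: "word (g + gen b - g) = (?w @ [(b, True)]) @ ?i"
      using l1 ri False li reduced_word[of "g + gen b"] w1
      by (subst word_minus_reduced) (auto simp: word_uminus successively_append_iff successively_Cons simp del: successively_rev)
    have wa: "word (- gen a) = [(a, False)]"
      by (simp add: word_uminus linv_def)
    have w3: "word ?X = ((?w @ [(b, True)]) @ ?i) @ [(a, False)]"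
      using reduced_word[of "g + gen b - g"] li l2 False unfolding w2
      by (subst word_minus_reduced)
         (auto simp: w2 wa successively_append_iff successively_Cons simp del: successively_rev)
    have cyc: "reduced (word ?X @ word ?X)"
      using reduced_word[of ?X] l2 False unfolding w3 successively_append_iff
      by simp
    define k where "k = - h + r"
    have "?X = - h + (b' - a') + h"
      unfolding hg(2,3) by (simp add: add.assoc diff_conv_add_uminus minus_add del: add_uminus_conv_diff)
    also have "\<dots> = k + (gen b - gen a) - k"
      unfolding c k_def by (simp add: add.assoc diff_conv_add_uminus minus_add del: add_uminus_conv_diff)
    finally have X: "?X = k + (gen b - gen a) - k" .
    \<comment> \<open>Conjugation by \<open>k\<close> adds at most
      \<open>2 * length (word k)\<close> letters, while each summand \<open>?X\<close> has
      \<open>2 * length ?w\<close> letters more than \<open>gen b - gen a\<close> can have; this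
      \<open>n\<close> makes the second effect larger.\<close>
    define n where "n = Suc (length (word k))"
    have "length (word (gen b - gen a)) \<le> 2"
      using length_word_plus[of "gen b" "- gen a"] by simp
    then have *: "length (word (nsum n (gen b - gen a))) \<le> n * 2"
      using length_word_nsum_le[of n "gen b - gen a"] by (meson le_trans mult_le_mono2)
    have "n * (2 * length ?w + 2) = length (word (nsum n ?X))"
      using length_word_nsum[OF cyc, of n] w3 by simp
    also have "\<dots> = length (word (k + nsum n (gen b - gen a) - k))"
      by (simp add: X nsum_conj)
    also have "\<dots> \<le> length (word k) + n * 2 + length (word k)"
      using length_word_plus[of "k + nsum n (gen b - gen a)" "- k"]
        length_word_plus[of k "nsum n (gen b - gen a)"] * by simp
    finally have "n * length ?w \<le> length (word k)" by (simp add: algebra_simps)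
    moreover have "n * 1 \<le> n * length ?w"
      using False by (intro mult_le_mono2) (simp add: Suc_le_eq)
    ultimately have False by (simp add: n_def)
    then show ?thesis ..
  qed
qed

section \<open>Actions of the free group\<close>

definition act :: "('a \<times> bool \<Rightarrow> 'x \<Rightarrow> 'x) \<Rightarrow> 'a free_group \<Rightarrow> 'x \<Rightarrow> 'x" where
  "act \<rho> u = foldr \<rho> (word u)"

text \<open>Letters have to cancel on \<open>X\<close> only, since the maps of an embedded graph are
  meaningful on its arcs only.\<close>

locale letter_action =
  fixes \<rho> :: "'a \<times> bool \<Rightarrow> 'x \<Rightarrow> 'x" and X :: "'x set"
  assumes closed: "d \<in> X \<Longrightarrow> \<rho> x d \<in> X"
    and cancel: "d \<in> X \<Longrightarrow> \<rho> x (\<rho> (linv x) d) = d"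
begin

lemma act_closed: "d \<in> X \<Longrightarrow> act \<rho> u d \<in> X"
proof -
  assume "d \<in> X"
  then have "foldr \<rho> w d \<in> X" for w by (induction w) (auto simp: closed)
  then show ?thesis by (simp add: act_def)
qed

lemma act_zero [simp]: "act \<rho> 0 d = d"
  by (simp add: act_def)

lemma act_plus:
  assumes "d \<in> X"
  shows "act \<rho> (u + v) d = act \<rho> u (act \<rho> v d)"
proof -
  have cl: "foldr \<rho> w d \<in> X" for w using assms by (induction w) (auto simp: closed)
  have push: "foldr \<rho> (push x w) d = \<rho> x (foldr \<rho> w d)" for x w
    by (cases w) (auto simp: cancel cl)
  have "foldr \<rho> (foldr push u v) d = foldr \<rho> u (foldr \<rho> v d)" for u v
    by (induction u) (auto simp: push)
  then show ?thesis by (simp add: act_def word_plus)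
qed

lemma act_uminus: "d \<in> X \<Longrightarrow> act \<rho> (- u) (act \<rho> u d) = d"
  by (metis act_plus act_zero left_minus)

lemma act_uminus': "d \<in> X \<Longrightarrow> act \<rho> u (act \<rho> (- u) d) = d"
  by (metis act_plus act_zero right_minus)

lemma act_gen: "act \<rho> (gen a) d = \<rho> (a, True) d"
  by (simp add: act_def)

lemma act_uminus_gen: "act \<rho> (- gen a) d = \<rho> (a, False) d"
  by (simp add: act_def word_uminus linv_def)

end

section \<open>Counting classes of generated equivalences\<close>

definition cc :: "('a \<times> 'a) set \<Rightarrow> ('a \<times> 'a) set" where
  "cc R = (R \<union> R\<inverse>)\<^sup>*"

lemma cc_refl [simp]: "(x, x) \<in> cc R"
  by (simp add: cc_def)

lemma cc_sym: "(x, y) \<in> cc R \<Longrightarrow> (y, x) \<in> cc R"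
  by (metis Un_commute cc_def converse_Un converse_converse rtrancl_converseI)

lemma cc_trans: "(x, y) \<in> cc R \<Longrightarrow> (y, z) \<in> cc R \<Longrightarrow> (x, z) \<in> cc R"
  by (auto simp: cc_def)

lemma cc_base: "(x, y) \<in> R \<Longrightarrow> (x, y) \<in> cc R"
  by (auto simp: cc_def)

lemma cc_base': "(x, y) \<in> R \<Longrightarrow> (y, x) \<in> cc R"
  by (auto simp: cc_def)

lemma equiv_cc: "equiv UNIV (cc R)"
  by (rule equivI) (auto simp: refl_on_def sym_def trans_def intro: cc_sym cc_trans)

lemma cc_induct [consumes 1, case_names refl step]:
  assumes "(x, y) \<in> cc R" and "P x"
    and "\<And>y z. (x, y) \<in> cc R \<Longrightarrow> P y \<Longrightarrow> (y, z) \<in> R \<or> (z, y) \<in> R \<Longrightarrow> P z"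
  shows "P y"
  using assms(1) unfolding cc_def
  by (induction rule: rtrancl_induct) (use assms(2,3) in \<open>auto simp: cc_def\<close>)

lemma cc_subsetI: "R \<subseteq> cc R' \<Longrightarrow> cc R \<subseteq> cc R'"
proof (intro subrelI)
  fix x y assume "R \<subseteq> cc R'" "(x, y) \<in> cc R"
  from this(2) show "(x, y) \<in> cc R'"
    by (induction rule: cc_induct) (use \<open>R \<subseteq> cc R'\<close> in \<open>auto intro: cc_trans cc_sym\<close>)
qed

lemma cc_mono: "R \<subseteq> R' \<Longrightarrow> cc R \<subseteq> cc R'"
  by (rule cc_subsetI) (auto intro: cc_base)

lemma cc_eqI: "R \<subseteq> cc R' \<Longrightarrow> R' \<subseteq> cc R \<Longrightarrow> cc R = cc R'"
  by (intro equalityI cc_subsetI)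

text \<open>A walk through the new pair can be shortened so as to use it at most once, in one of the
  two directions.\<close>

lemma cc_insert:
  assumes "(a, b) \<in> cc (insert (x, y) R)"
  shows "(a, b) \<in> cc R \<or> (a, x) \<in> cc R \<and> (y, b) \<in> cc R \<or> (a, y) \<in> cc R \<and> (x, b) \<in> cc R"
  using assms
proof (induction rule: cc_induct)
  case (step b c)
  then consider "(b, c) \<in> cc R" | "b = x" "c = y" | "b = y" "c = x"
    by (auto intro: cc_base cc_base')
  then show ?case
  proof cases
    case 1
    show ?thesis
      using step.IH cc_trans[OF _ 1, of a] cc_trans[OF _ 1, of x] cc_trans[OF _ 1, of y] by argo
  qed (use step.IH in auto)
qed auto

lemma cc_class_eq_iff: "cc R `` {x} = cc R `` {y} \<longleftrightarrow> (x, y) \<in> cc R"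
  by (rule eq_equiv_class_iff[OF equiv_cc]) auto

lemma card_quotient_cc_le_1:
  assumes "\<And>x y. x \<in> X \<Longrightarrow> y \<in> X \<Longrightarrow> (x, y) \<in> cc R"
  shows "card (X // cc R) \<le> 1"
proof (cases "X = {}")
  case False
  then obtain y where y: "y \<in> X" by blast
  have "X // cc R \<subseteq> {cc R `` {y}}"
  proof
    fix C assume "C \<in> X // cc R"
    then obtain x where "x \<in> X" "C = cc R `` {x}" by (rule quotientE)
    then show "C \<in> {cc R `` {y}}"
      using assms[OF _ y, of x] by (simp only: singleton_iff cc_class_eq_iff)
  qed
  then show ?thesis using card_mono[of "{cc R `` {y}}" "X // cc R"] by simp
qed simp

text \<open>Only the classes of \<open>x\<close> and \<open>y\<close> are merged, so passing to the
  larger classes is injective once the class of \<open>y\<close> is left out.\<close>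

lemma card_quotient_cc_insert_le:
  assumes "finite X"
  shows "card (X // cc R) \<le> card (X // cc (insert (x, y) R)) + 1"
proof -
  let ?R' = "insert (x, y) R" and ?Y = "cc R `` {y}"
  let ?F = "\<lambda>C. cc ?R' `` C"
  have sub: "cc R \<subseteq> cc ?R'" by (rule cc_mono) auto
  have F: "?F (cc R `` {z}) = cc ?R' `` {z}" for z
  proof (intro equalityI subsetI)
    fix w assume "w \<in> ?F (cc R `` {z})"
    then obtain u where "(z, u) \<in> cc R" "(u, w) \<in> cc ?R'" by blast
    then show "w \<in> cc ?R' `` {z}" using sub cc_trans[of z u ?R' w] by blast
  next
    fix w assume "w \<in> cc ?R' `` {z}"
    then show "w \<in> ?F (cc R `` {z})" using cc_refl[of z R] by blast
  qed
  have inj: "inj_on ?F (X // cc R - {?Y})"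
  proof (rule inj_onI)
    fix C D
    assume C': "C \<in> X // cc R - {?Y}" and D': "D \<in> X // cc R - {?Y}" and eq: "?F C = ?F D"
    obtain a where C: "C = cc R `` {a}" using C' by (auto elim: quotientE)
    obtain b where D: "D = cc R `` {b}" using D' by (auto elim: quotientE)
    have "(a, y) \<notin> cc R" "(b, y) \<notin> cc R"
      using C' D' unfolding C D Diff_iff singleton_iff cc_class_eq_iff by simp_all
    moreover have "(a, b) \<in> cc ?R'"
      using eq by (simp only: C D F cc_class_eq_iff)
    ultimately have "(a, b) \<in> cc R"
      using cc_insert[of a b x y R] cc_sym[of y b R] by blast
    then show "C = D" by (simp add: C D cc_class_eq_iff)
  qed
  have img: "?F ` (X // cc R - {?Y}) \<subseteq> X // cc ?R'"
  proof (rule image_subsetI)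
    fix C assume "C \<in> X // cc R - {?Y}"
    then have "C \<in> X // cc R" by simp
    then show "?F C \<in> X // cc ?R'"
      by (elim quotientE) (simp add: F quotientI)
  qed
  have fin: "finite (X // cc S)" for S
    using assms by (simp add: quotient_def)
  have "card (X // cc R - {?Y}) \<le> card (X // cc ?R')"
    by (rule card_inj_on_le[OF inj img fin])
  then show ?thesis
    using card_Diff1_le[of "X // cc R" ?Y] by (cases "?Y \<in> X // cc R") (auto simp: fin)
qed

lemma cc_insert_eq: "(x, y) \<in> cc R \<Longrightarrow> cc (insert (x, y) R) = cc R"
  by (rule cc_eqI) (auto intro: cc_base)

section \<open>Bridges and faces\<close>

locale emb_map =
  fixes G :: "('v, 'd, 'z) emb_scheme"
  assumes emb: "embedded_graph G"
begin

abbreviation "A \<equiv> arcs (gr G)"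
abbreviation "V \<equiv> verts (gr G)"
abbreviation "ta \<equiv> tail (gr G)"
abbreviation "he \<equiv> head (gr G)"
abbreviation "e \<equiv> opp G"
abbreviation "r \<equiv> rot G"

definition phi :: "'d \<Rightarrow> 'd" where
  "phi c = r (e c)"

sublocale fin_digraph "gr G"
  using emb unfolding embedded_graph_def by blast

lemma opp_in [simp]: "c \<in> A \<Longrightarrow> e c \<in> A"
  and opp_neq [simp]: "c \<in> A \<Longrightarrow> e c \<noteq> c"
  and opp_opp [simp]: "c \<in> A \<Longrightarrow> e (e c) = c"
  and tail_opp [simp]: "c \<in> A \<Longrightarrow> ta (e c) = he c"
  using emb by (auto simp: embedded_graph_def)

lemma opp_neq' [simp]: "c \<in> A \<Longrightarrow> c \<noteq> e c"
  using opp_neq by metis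

lemma head_opp [simp]: "c \<in> A \<Longrightarrow> he (e c) = ta c"
  using tail_opp[of "e c"] by simp

lemma opp_eq_iff: "c \<in> A \<Longrightarrow> d \<in> A \<Longrightarrow> e c = e d \<longleftrightarrow> c = d"
  by (metis opp_opp)

lemma cyclic_out: "v \<in> V \<Longrightarrow> cyclic_on r (out_arcs (gr G) v)"
  using emb by (auto simp: embedded_graph_def)

lemma out_arcs_eq_orbit: "c \<in> A \<Longrightarrow> out_arcs (gr G) (ta c) = orbit r c"
  using cyclic_out[of "ta c"] by (auto simp: cyclic_on_alldef)

lemma self_in_orbit: "c \<in> A \<Longrightarrow> c \<in> orbit r c"
  using out_arcs_eq_orbit by fastforce

lemma rot_in [simp]: "c \<in> A \<Longrightarrow> r c \<in> A"
  and tail_rot [simp]: "c \<in> A \<Longrightarrow> ta (r c) = ta c"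
proof -
  assume "c \<in> A"
  then have "r c \<in> out_arcs (gr G) (ta c)"
    using out_arcs_eq_orbit orbit.base by fast
  then show "r c \<in> A" "ta (r c) = ta c" by auto
qed

lemma inj_on_rot: "inj_on r A"
proof (rule inj_onI)
  fix c d assume cd: "c \<in> A" "d \<in> A" "r c = r d"
  have t: "ta c = ta d" using cd tail_rot by metis
  let ?O = "out_arcs (gr G) (ta c)"
  have fin: "finite ?O" by (rule finite_subset[OF _ finite_arcs]) auto
  have "r ` ?O \<subseteq> ?O" by auto
  moreover have "?O \<subseteq> r ` ?O"
  proof
    fix x assume "x \<in> ?O"
    then have "x \<in> orbit r c" using out_arcs_eq_orbit cd by simp
    then have "x \<in> r ` orbit r c"
      by (cases rule: orbit.cases) (use self_in_orbit[OF cd(1)] in auto)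
    then show "x \<in> r ` ?O" using out_arcs_eq_orbit cd by simp
  qed
  ultimately have "r ` ?O = ?O" by blast
  then have "inj_on r ?O" using fin by (simp add: eq_card_imp_inj_on)
  from inj_onD[OF this cd(3)] show "c = d" using cd t by simp
qed

lemma phi_in [simp]: "c \<in> A \<Longrightarrow> phi c \<in> A"
  and tail_phi [simp]: "c \<in> A \<Longrightarrow> ta (phi c) = he c"
  by (auto simp: phi_def)

lemma phi_opp [simp]: "c \<in> A \<Longrightarrow> phi (e c) = r c"
  by (simp add: phi_def)

lemma inj_on_phi: "inj_on phi A"
proof (rule inj_onI)
  fix c d assume "c \<in> A" "d \<in> A" "phi c = phi d"
  then show "c = d"
    using inj_onD[OF inj_on_rot, of "e c" "e d"] by (auto simp: phi_def opp_eq_iff)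
qed

lemma phi_self_in_orbit: "c \<in> A \<Longrightarrow> c \<in> orbit phi c"
proof -
  assume c: "c \<in> A"
  have A: "(phi ^^ n) c \<in> A" for n by (induction n) (use c in auto)
  have inj: "inj_on (phi ^^ n) A" for n
  proof (induction n)
    case (Suc n)
    have "(phi ^^ n) ` A \<subseteq> A"
      by (induction n) auto
    then show ?case
      using Suc inj_on_subset[OF inj_on_phi] by (simp only: funpow.simps comp_inj_on)
  qed auto
  have "finite (range (\<lambda>n. (phi ^^ n) c))"
    using A by (intro finite_subset[OF _ finite_arcs]) auto
  then have "\<not> inj (\<lambda>n. (phi ^^ n) c)"
    by (metis finite_imageD infinite_UNIV_nat)
  then obtain m' n' where mn': "m' \<noteq> n'" "(phi ^^ m') c = (phi ^^ n') c"
    by (auto simp: inj_def)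
  define m n where "m = min m' n'" and "n = max m' n'"
  have mn: "m < n" "(phi ^^ m) c = (phi ^^ n) c"
    using mn' by (auto simp: m_def n_def min_def max_def)
  have "(phi ^^ m) ((phi ^^ (n - m)) c) = (phi ^^ (m + (n - m))) c"
    by (simp only: funpow_add o_apply)
  then have "(phi ^^ m) ((phi ^^ (n - m)) c) = (phi ^^ m) c"
    using mn by simp
  then have "(phi ^^ (n - m)) c = c"
    by (rule inj_onD[OF inj[of m]]) (use A c in auto)
  then show ?thesis
    unfolding orbit_altdef using mn(1) by (intro CollectI exI[of _ "n - m"]) auto
qed

lemma face_of_eq: "face_of G c = orbit phi c"
  by (simp add: face_of_def phi_def[abs_def])

text \<open>
  For a set \<open>S\<close> of edges, the classes of \<open>vrel S\<close> are the components of \<open>S\<close>, and the classes of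
  \<open>frel S\<close> are the faces of \<open>S\<close>: faces of the whole graph merged across the edges outside \<open>S\<close>.
  Removing an edge from \<open>S\<close> increases the difference \<open>excess S\<close> by at most one; in genus 0 Euler's
  formula forces equality in each such step.
\<close>

definition vrel :: "'d set \<Rightarrow> ('v \<times> 'v) set" where
  "vrel S = (\<lambda>c. (ta c, he c)) ` S"

definition frel :: "'d set \<Rightarrow> ('d \<times> 'd) set" where
  "frel S = (\<lambda>c. (c, phi c)) ` A \<union> (\<lambda>c. (c, e c)) ` (A - S)"

definition arc_sym :: "'d set \<Rightarrow> bool" where
  "arc_sym S \<longleftrightarrow> S \<subseteq> A \<and> e ` S \<subseteq> S"

definition excess :: "'d set \<Rightarrow> int" where
  "excess S = int (card (V // cc (vrel S))) - int (card (A // cc (frel S)))"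

lemma arc_symD: "arc_sym S \<Longrightarrow> c \<in> S \<Longrightarrow> c \<in> A" "arc_sym S \<Longrightarrow> c \<in> S \<Longrightarrow> e c \<in> S"
  by (auto simp: arc_sym_def)

lemma arc_sym_opp_iff: "arc_sym S \<Longrightarrow> c \<in> A \<Longrightarrow> e c \<in> S \<longleftrightarrow> c \<in> S"
  by (metis arc_symD(2) opp_opp)

lemma arc_sym_diff: "arc_sym S \<Longrightarrow> c \<in> A \<Longrightarrow> arc_sym (S - {c, e c})"
  unfolding arc_sym_def by (auto simp: opp_eq_iff image_subset_iff subset_iff)

lemma vrel_in: "c \<in> S \<Longrightarrow> (ta c, he c) \<in> vrel S"
  by (auto simp: vrel_def)

lemma cc_vrel_remove:
  assumes "arc_sym S" "c \<in> S"
  shows "cc (vrel S) = cc (insert (ta c, he c) (vrel (S - {c, e c})))" (is "_ = cc (insert _ (vrel ?S'))")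
proof (rule cc_eqI)
  have cA: "c \<in> A" using assms by (auto dest: arc_symD)
  show "vrel S \<subseteq> cc (insert (ta c, he c) (vrel ?S'))"
  proof
    fix x assume "x \<in> vrel S"
    then obtain d where d: "d \<in> S" "x = (ta d, he d)" by (auto simp: vrel_def)
    consider "d = c" | "d = e c" | "d \<in> ?S'" using d by blast
    then show "x \<in> cc (insert (ta c, he c) (vrel ?S'))"
    proof cases
      case 1
      then show ?thesis by (simp add: d cc_base)
    next
      case 2
      then show ?thesis using cA by (simp add: d cc_base')
    next
      case 3
      then have "x \<in> vrel ?S'" by (simp add: d vrel_in)
      then show ?thesis by (simp add: d cc_base)
    qed
  qed
  show "insert (ta c, he c) (vrel ?S') \<subseteq> cc (vrel S)"
  proof clarify
    fix a b assume "(a, b) \<in> insert (ta c, he c) (vrel ?S')"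
    then have "(a, b) \<in> vrel S" using assms by (auto simp: vrel_def)
    then show "(a, b) \<in> cc (vrel S)" by (rule cc_base)
  qed
qed

lemma cc_frel_remove:
  assumes "arc_sym S" "c \<in> S"
  shows "cc (frel (S - {c, e c})) = cc (insert (c, e c) (frel S))" (is "cc (frel ?S') = _")
proof (rule cc_eqI)
  have cA: "c \<in> A" "e c \<in> A" using assms by (auto dest: arc_symD)
  show "frel ?S' \<subseteq> cc (insert (c, e c) (frel S))"
  proof
    fix x assume "x \<in> frel ?S'"
    then consider "x \<in> frel S" | "x = (c, e c)" | "x = (e c, c)"
      using cA by (auto simp: frel_def)
    then show "x \<in> cc (insert (c, e c) (frel S))"
      by cases (cases x, simp_all add: cc_base cc_base')
  qed
  show "insert (c, e c) (frel S) \<subseteq> cc (frel ?S')"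
  proof clarify
    fix a b assume "(a, b) \<in> insert (c, e c) (frel S)"
    then have "(a, b) \<in> frel ?S'" using cA by (auto simp: frel_def)
    then show "(a, b) \<in> cc (frel ?S')" by (rule cc_base)
  qed
qed

lemma cc_frel_in:
  assumes "(c, d) \<in> cc (frel S)" "c \<in> A"
  shows "d \<in> A"
  using assms by (induction rule: cc_induct) (auto simp: frel_def)

text \<open>
  In a union of faces, as many arcs leave a vertex set \<open>W\<close> as enter it.  Take for \<open>W\<close> one side of
  the bridge \<open>c\<close>: apart from \<open>c\<close>, all arcs leaving \<open>W\<close> lie outside \<open>S\<close>, so that their two sides
  are in the same class.
\<close>

lemma bridge_same_face:
  assumes S: "arc_sym S" "c \<in> S" and bridge: "(ta c, he c) \<notin> cc (vrel (S - {c, e c}))"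
  shows "(c, e c) \<in> cc (frel S)"
proof (rule ccontr)
  assume neg: "(c, e c) \<notin> cc (frel S)"
  define W where "W = cc (vrel (S - {c, e c})) `` {ta c}"
  define C where "C = cc (frel S) `` {c}"
  have cA: "c \<in> A" using S by (auto dest: arc_symD)
  have CA: "C \<subseteq> A" using cc_frel_in cA by (auto simp: C_def)
  then have finC: "finite C" using finite_arcs finite_subset by blast
  have ecC: "e c \<notin> C" using neg by (simp add: C_def)
  have opp_C: "e b \<in> C" if "b \<in> C" "b \<notin> S" for b
  proof -
    have "(b, e b) \<in> cc (frel S)" using that CA by (intro cc_base) (auto simp: frel_def)
    then show ?thesis using that by (auto simp: C_def intro: cc_trans)
  qed
  have phiC: "phi ` C \<subseteq> C"
  proof clarify
    fix b assume b: "b \<in> C"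
    then have "(b, phi b) \<in> cc (frel S)" using CA by (intro cc_base) (auto simp: frel_def)
    then show "phi b \<in> C" using b by (auto simp: C_def intro: cc_trans)
  qed
  have inj: "inj_on phi C" using inj_on_subset[OF inj_on_phi CA] .
  then have surj: "phi ` C = C" using endo_inj_surj[OF finC phiC] by simp
  have W_S: "ta b \<in> W \<longleftrightarrow> he b \<in> W" if "b \<in> S" "b \<noteq> c" "b \<noteq> e c" for b
  proof -
    have "(ta b, he b) \<in> cc (vrel (S - {c, e c}))" using that by (intro cc_base vrel_in) auto
    then show ?thesis by (auto simp: W_def intro: cc_trans cc_sym)
  qed
  have cW: "ta c \<in> W" "he c \<notin> W" using bridge by (auto simp: W_def)
  let ?X1 = "{b \<in> C. ta b \<in> W \<and> he b \<notin> W}" and ?X2 = "{b \<in> C. ta b \<notin> W \<and> he b \<in> W}"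
    and ?X = "{b \<in> C. ta b \<in> W \<and> he b \<in> W}"
  have "phi ` {b \<in> C. he b \<in> W} = {b \<in> C. ta b \<in> W}"
  proof
    show "phi ` {b \<in> C. he b \<in> W} \<subseteq> {b \<in> C. ta b \<in> W}"
      using phiC CA by auto
    show "{b \<in> C. ta b \<in> W} \<subseteq> phi ` {b \<in> C. he b \<in> W}"
    proof
      fix b assume "b \<in> {b \<in> C. ta b \<in> W}"
      then obtain d where "d \<in> C" "b = phi d" "ta b \<in> W" using surj by blast
      then show "b \<in> phi ` {b \<in> C. he b \<in> W}" using CA by auto
    qed
  qed
  then have "card {b \<in> C. he b \<in> W} = card {b \<in> C. ta b \<in> W}"
    by (metis (no_types, lifting) card_image inj inj_on_subset mem_Collect_eq subsetI)
  moreover have "{b \<in> C. he b \<in> W} = ?X2 \<union> ?X" "{b \<in> C. ta b \<in> W} = ?X1 \<union> ?X" by auto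
  moreover have "card (?X2 \<union> ?X) = card ?X2 + card ?X" "card (?X1 \<union> ?X) = card ?X1 + card ?X"
    by (intro card_Un_disjoint; use finC in auto)+
  ultimately have eq: "card ?X1 = card ?X2" by simp
  \<comment> \<open>Reversal matches the entering arcs with the leaving arcs other than
    \<open>c\<close>, against the balance just established.\<close>
  have "e ` (?X1 - {c}) = ?X2"
  proof
    show "e ` (?X1 - {c}) \<subseteq> ?X2"
    proof clarify
      fix b assume b: "b \<in> C" "ta b \<in> W" "he b \<notin> W" "b \<noteq> c"
      then have "b \<notin> S" using W_S ecC by blast
      then show "e b \<in> C \<and> ta (e b) \<notin> W \<and> he (e b) \<in> W"
        using b CA opp_C by auto
    qed
    show "?X2 \<subseteq> e ` (?X1 - {c})"
    proof
      fix b assume "b \<in> ?X2"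
      then have b: "b \<in> C" "ta b \<notin> W" "he b \<in> W" by auto
      then have "b \<notin> S" using W_S ecC cW by blast
      then have "e b \<in> ?X1" using b CA opp_C by auto
      moreover have "e b \<noteq> c" using ecC b CA by auto
      moreover have "b = e (e b)" using b CA by auto
      ultimately show "b \<in> e ` (?X1 - {c})" by blast
    qed
  qed
  moreover have "inj_on e (?X1 - {c})"
    using CA opp_eq_iff by (intro inj_onI) blast
  ultimately have "card (?X1 - {c}) = card ?X2"
    by (metis (no_types, lifting) card_image)
  moreover have "c \<in> ?X1" using cW by (simp add: C_def)
  moreover have "finite ?X1" using finC by simp
  ultimately show False using eq by (metis (no_types, lifting) card_Diff1_less less_irrefl)
qed

text \<open>Deleting a bridge adds a component but leaves the faces alone, by
  \<open>bridge_same_face\<close>; deleting any other edge keeps the components and merges at most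
  two faces.\<close>

lemma excess_remove:
  assumes "arc_sym S" "c \<in> S"
  shows "excess (S - {c, e c}) \<le> excess S + 1"
proof -
  let ?S' = "S - {c, e c}"
  have "card (V // cc (vrel ?S')) \<le> card (V // cc (vrel S)) + 1"
    unfolding cc_vrel_remove[OF assms] by (rule card_quotient_cc_insert_le) simp
  moreover have "card (A // cc (frel S)) \<le> card (A // cc (frel ?S')) + 1"
    unfolding cc_frel_remove[OF assms] by (rule card_quotient_cc_insert_le) simp
  moreover have "card (V // cc (vrel ?S')) = card (V // cc (vrel S)) \<or>
    card (A // cc (frel S)) = card (A // cc (frel ?S'))"
  proof (cases "(ta c, he c) \<in> cc (vrel ?S')")
    case True
    then show ?thesis unfolding cc_vrel_remove[OF assms] by (simp add: cc_insert_eq)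
  next
    case False
    then have "(c, e c) \<in> cc (frel S)" by (rule bridge_same_face[OF assms])
    then show ?thesis unfolding cc_frel_remove[OF assms] by (simp add: cc_insert_eq)
  qed
  ultimately show ?thesis by (auto simp: excess_def)
qed

lemma card_remove:
  assumes "arc_sym S" "c \<in> S"
  shows "card S = card (S - {c, e c}) + 2"
proof -
  have "finite S" "{c, e c} \<subseteq> S" "c \<noteq> e c"
    using assms finite_arcs by (auto simp: arc_sym_def dest: finite_subset)
  then show ?thesis
    using card_Diff_subset[of "{c, e c}" S] card_mono[of S "{c, e c}"] by simp
qed

text \<open>One unit per deleted edge; the factor 2 appears because \<open>card\<close> counts both
  arcs of an edge.\<close>

lemma excess_le:
  assumes "arc_sym S" "arc_sym T" "T \<subseteq> S"
  shows "2 * (excess T - excess S) \<le> int (card S) - int (card T)"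
  using assms
proof (induction "card S" arbitrary: S rule: less_induct)
  case less
  show ?case
  proof (cases "S = T")
    case False
    then obtain c where c: "c \<in> S" "c \<notin> T" using less by blast
    let ?S' = "S - {c, e c}"
    have cA: "c \<in> A" using c less by (auto dest: arc_symD)
    then have "T \<subseteq> ?S'" using c less arc_sym_opp_iff[of T c] by blast
    then have "2 * (excess T - excess ?S') \<le> int (card ?S') - int (card T)"
      using card_remove[OF less.prems(1) c(1)] less cA by (intro less.hyps) (auto intro: arc_sym_diff)
    then show ?thesis
      using card_remove[OF less.prems(1) c(1)] excess_remove[OF less.prems(1) c(1)] by simp
  qed simp
qed

lemma connected_cc:
  assumes "u \<in> V" "v \<in> V"
  shows "(u, v) \<in> cc (vrel A)"
proof -
  have "(u, v) \<in> rtrancl_on V (parcs (mk_symmetric (gr G)))"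
    using emb assms by (auto simp: embedded_graph_def connected_def strongly_connected_def reachable_def)
  then show ?thesis
    by (induction rule: rtrancl_on_induct)
       (auto simp: mk_symmetric_def vrel_def intro: cc_trans cc_base cc_base')
qed

lemma ex_out_arc: "v \<in> V \<Longrightarrow> \<exists>c\<in>A. ta c = v"
  using cyclic_out[of v] unfolding cyclic_on_def by (metis in_out_arcs_conv)

lemma card_arcs: "card A = 2 * card (edges G)"
proof -
  have "2 * card (edges G) = card (\<Union>(edges G))"
  proof (rule card_partition)
    show "finite (\<Union>(edges G))" by (auto simp: edges_def)
    show "x \<inter> y = {}" if "x \<in> edges G" "y \<in> edges G" "x \<noteq> y" for x y
      using that by (auto simp: edges_def opp_eq_iff)
  qed (auto simp: edges_def)
  moreover have "\<Union>(edges G) = A" by (auto simp: edges_def)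
  ultimately show ?thesis by simp
qed

lemma cc_frel_arcs_class: "c \<in> A \<Longrightarrow> cc (frel A) `` {c} = orbit phi c"
proof
  assume c: "c \<in> A"
  show "cc (frel A) `` {c} \<subseteq> orbit phi c"
  proof clarify
    fix d assume "(c, d) \<in> cc (frel A)"
    then show "d \<in> orbit phi c"
    proof (induction rule: cc_induct)
      case (step x y)
      then consider "y = phi x" | "x = phi y" "y \<in> A" by (auto simp: frel_def)
      then show ?case
      proof cases
        case 2
        then show ?thesis using step phi_self_in_orbit[of y]
          by (metis orbit_trans orbit_swap orbit.base)
      qed (use step in \<open>auto intro: orbit.step\<close>)
    qed (use c phi_self_in_orbit in auto)
  qed
  have phi: "(d, phi d) \<in> cc (frel A)" if "d \<in> A" for d
    using that by (intro cc_base) (auto simp: frel_def)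
  show "orbit phi c \<subseteq> cc (frel A) `` {c}"
  proof
    fix d assume "d \<in> orbit phi c"
    then have "(c, d) \<in> cc (frel A) \<and> d \<in> A"
      by induction (use c phi in \<open>auto intro: cc_trans\<close>)
    then show "d \<in> cc (frel A) `` {c}" by simp
  qed
qed

lemma faces_eq: "faces G = A // cc (frel A)"
  by (auto simp: faces_def quotient_def face_of_eq cc_frel_arcs_class)

lemma vrel_arc: "(x, y) \<in> vrel A \<or> (y, x) \<in> vrel A \<Longrightarrow> \<exists>a\<in>A. ta a = x \<and> he a = y"
proof (elim disjE)
  assume "(x, y) \<in> vrel A"
  then show ?thesis by (auto simp: vrel_def)
next
  assume "(y, x) \<in> vrel A"
  then obtain b where "b \<in> A" "ta b = y" "he b = x" by (auto simp: vrel_def)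
  then show ?thesis by (intro bexI[of _ "e b"]) auto
qed

text \<open>Crossing an edge and then moving on along the face is a rotation step, so all arcs at
  one vertex lie in one class; crossings and connectedness spread this class over the whole
  graph.\<close>

lemma cc_frel_empty:
  assumes "c \<in> A" "d \<in> A"
  shows "(c, d) \<in> cc (frel {})"
proof -
  have e: "(a, e a) \<in> cc (frel {})" if "a \<in> A" for a
    using that by (intro cc_base) (auto simp: frel_def)
  have phi: "(a, phi a) \<in> cc (frel {})" if "a \<in> A" for a
    using that by (intro cc_base) (auto simp: frel_def)
  have r: "(a, r a) \<in> cc (frel {})" if "a \<in> A" for a
    using cc_trans[OF e phi[of "e a"]] that by simp
  have out: "(a, b) \<in> cc (frel {})" if "a \<in> A" "b \<in> A" "ta a = ta b" for a b
  proof -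
    have "b \<in> out_arcs (gr G) (ta a)" using that by simp
    then have "b \<in> orbit r a" by (simp only: out_arcs_eq_orbit[OF that(1)])
    then have "b \<in> A \<and> (a, b) \<in> cc (frel {})"
    proof induction
      case base
      then show ?case using that(1) r by simp
    next
      case (step x)
      then show ?case using cc_trans[OF _ r[of x], of a] by simp
    qed
    then show ?thesis ..
  qed
  have star: "\<forall>b\<in>A. ta b = v \<longrightarrow> (c, b) \<in> cc (frel {})" if "(ta c, v) \<in> cc (vrel A)" for v
    using that
  proof (induction rule: cc_induct)
    case (step x y)
    obtain a where a: "a \<in> A" "ta a = x" "he a = y"
      using vrel_arc step.hyps(2) by blast
    have "(c, a) \<in> cc (frel {})" using a step by simp
    then have "(c, e a) \<in> cc (frel {})" using cc_trans[OF _ e[OF a(1)]] by simp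
    moreover have "(e a, b) \<in> cc (frel {})" if "b \<in> A" "ta b = y" for b
      using out[of "e a" b] that a by simp
    ultimately show ?case using cc_trans[of c "e a"] by blast
  next
    case refl
    show ?case using out[of c] assms(1) by metis
  qed
  show ?thesis using star[OF connected_cc[of "ta c" "ta d"]] assms by simp
qed

end

section \<open>Genus 0: Euler's formula and separating cycles\<close>

locale plane_map = emb_map G for G :: "('v, 'd, 'z) emb_scheme" +
  assumes genus_0: "genus G = 0"
begin

lemma euler: "int (card V) + int (card (faces G)) = 2 + int (card (edges G))"
  using genus_0 by (simp add: genus_def)

text \<open>Without arcs there are \<open>card V\<close> components and at most one face; with all
  arcs there are at most one component and \<open>card (faces G)\<close> faces. Euler's formula
  makes the difference as large as \<open>excess_le\<close> permits, so no deletion may fail to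
  raise the excess.\<close>

lemma excess_empty_ge: "excess {} - excess A \<ge> int (card (edges G))"
proof -
  have "card (V // cc (vrel {})) = card V"
  proof -
    have "cc (vrel {}) = Id" by (simp add: vrel_def cc_def)
    then have "V // cc (vrel {}) = (\<lambda>x. {x}) ` V" by (auto simp: quotient_def)
    then show ?thesis by (simp add: card_image)
  qed
  moreover have "card (V // cc (vrel A)) \<le> 1"
    using connected_cc by (rule card_quotient_cc_le_1)
  moreover have "card (A // cc (frel {})) \<le> 1"
    using cc_frel_empty by (rule card_quotient_cc_le_1)
  ultimately show ?thesis
    using euler by (simp add: excess_def faces_eq[symmetric])
qed

text \<open>A combinatorial Jordan curve theorem.\<close>

lemma cycle_separates:
  assumes S: "arc_sym S" "c \<in> S" and cyc: "(ta c, he c) \<in> cc (vrel (S - {c, e c}))"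
  shows "(c, e c) \<notin> cc (frel S)"
proof
  assume "(c, e c) \<in> cc (frel S)"
  let ?S' = "S - {c, e c}"
  have "c \<in> A" using S by (auto dest: arc_symD)
  then have sym: "arc_sym ?S'" "arc_sym {}" "arc_sym A" "?S' \<subseteq> A" "S \<subseteq> A"
    using S by (auto intro: arc_sym_diff) (auto simp: arc_sym_def)
  have "cc (vrel S) = cc (vrel ?S')" "cc (frel S) = cc (frel ?S')"
    using cc_vrel_remove[OF S] cc_frel_remove[OF S] cyc \<open>(c, e c) \<in> cc (frel S)\<close>
    by (simp_all add: cc_insert_eq)
  \<comment> \<open>Deleting \<open>c\<close> would gain nothing, so the deletions from
    \<open>A\<close> to \<open>S\<close> and from \<open>?S'\<close> to the empty set fall one short
    of the total in \<open>excess_empty_ge\<close>.\<close>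
  then have "excess ?S' = excess S" by (simp add: excess_def)
  moreover have "2 * (excess S - excess A) \<le> int (card A) - int (card S)"
    using S sym by (intro excess_le)
  moreover have "2 * (excess {} - excess ?S') \<le> int (card ?S') - int (card ({} :: 'd set))"
    using sym by (intro excess_le) auto
  ultimately show False
    using excess_empty_ge card_arcs card_remove[OF S] by simp
qed

end

section \<open>Cochains and gauge transformations\<close>

definition conjugate :: "'g::group_add \<Rightarrow> 'g \<Rightarrow> bool" where
  "conjugate x y \<longleftrightarrow> (\<exists>h. y = h + x - h)"

lemma conjugateI: "y = h + x - h \<Longrightarrow> conjugate x y"
  by (auto simp: conjugate_def)

lemma conjugate_refl: "conjugate x x"
  by (rule conjugateI[of _ 0]) simp

lemma conjugate_trans: "conjugate x y \<Longrightarrow> conjugate y z \<Longrightarrow> conjugate x z"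
proof -
  assume "conjugate x y" "conjugate y z"
  then obtain h k where "y = h + x - h" "z = k + y - k" by (auto simp: conjugate_def)
  then have "z = (k + h) + x - (k + h)"
    by (simp add: diff_conv_add_uminus add.assoc minus_add del: add_uminus_conv_diff)
  then show ?thesis by (rule conjugateI)
qed

lemma conjugate_0_iff: "conjugate 0 x \<longleftrightarrow> x = 0"
  by (auto simp: conjugate_def)

lemma conjugate_uminus: "conjugate (- x) (- y) \<Longrightarrow> conjugate x y"
proof -
  assume "conjugate (- x) (- y)"
  then obtain h where "- y = h + - x - h" by (auto simp: conjugate_def)
  then have "y = - (h + - x - h)" by (metis minus_minus)
  then have "y = h + x - h"
    by (simp add: diff_conv_add_uminus add.assoc minus_add del: add_uminus_conv_diff)
  then show ?thesis by (rule conjugateI)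
qed

context emb_map
begin

definition cochain :: "('d \<Rightarrow> 'g::group_add) \<Rightarrow> bool" where
  "cochain \<nu> \<longleftrightarrow> (\<forall>c\<in>A. \<nu> (e c) = - \<nu> c)"

text \<open>A function on the faces, encoded on arcs: \<open>s c\<close> is its value on the left of
  \<open>c\<close>, hence \<open>s (e c)\<close> its value on the right.\<close>

definition face_inv :: "('d \<Rightarrow> 'g) \<Rightarrow> bool" where
  "face_inv s \<longleftrightarrow> (\<forall>c\<in>A. s (phi c) = s c)"

text \<open>Suppose the double chambers over each face are renamed by \<open>s\<close>. Read from
  right to left, the new crossing undoes the renaming on the left of \<open>c\<close>, crosses, and
  renames on the right.\<close>

definition gauge :: "('d \<Rightarrow> 'g::group_add) \<Rightarrow> ('d \<Rightarrow> 'g) \<Rightarrow> 'd \<Rightarrow> 'g" where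
  "gauge s \<nu> c = s (e c) + \<nu> c - s c"

text \<open>Later crossings are added on the left, in accordance with the left action
  \<open>act\<close>.\<close>

primrec partial_hol :: "('d \<Rightarrow> 'g::group_add) \<Rightarrow> 'd \<Rightarrow> nat \<Rightarrow> 'g" where
  "partial_hol \<nu> c 0 = 0"
| "partial_hol \<nu> c (Suc n) = \<nu> ((r ^^ n) c) + partial_hol \<nu> c n"

definition hol :: "('d \<Rightarrow> 'g::group_add) \<Rightarrow> 'd \<Rightarrow> 'g" where
  "hol \<nu> c = partial_hol \<nu> c (card (orbit r c))"

lemma face_inv_opp: "face_inv s \<Longrightarrow> c \<in> A \<Longrightarrow> s (e c) = s (r c)"
  unfolding face_inv_def using phi_opp[of c] opp_in[of c] by fastforce

lemma cochain_gauge: "cochain \<nu> \<Longrightarrow> cochain (gauge s \<nu>)"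
  by (simp add: cochain_def gauge_def diff_conv_add_uminus add.assoc minus_add del: add_uminus_conv_diff)

lemma gauge_gauge: "gauge t (gauge s \<nu>) c = gauge (\<lambda>b. t b + s b) \<nu> c"
  by (simp add: gauge_def diff_conv_add_uminus add.assoc minus_add del: add_uminus_conv_diff)

lemma rot_funpow_in [simp]: "c \<in> A \<Longrightarrow> (r ^^ n) c \<in> A"
  and tail_rot_funpow [simp]: "c \<in> A \<Longrightarrow> ta ((r ^^ n) c) = ta c"
  by (induction n) auto

lemma card_orbit_rot: "c \<in> A \<Longrightarrow> card (orbit r c) = funpow_dist1 r c c"
  using self_in_orbit by (subst orbit_conv_funpow_dist1) (auto simp: card_image inj_on_funpow_dist1)

lemma rot_period: "c \<in> A \<Longrightarrow> (r ^^ card (orbit r c)) c = c"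
  by (simp only: card_orbit_rot funpow_dist1_prop self_in_orbit)

lemma card_orbit_pos: "c \<in> A \<Longrightarrow> 0 < card (orbit r c)"
  by (simp add: card_orbit_rot)

lemma rot_inj:
  assumes "c \<in> A" "i < card (orbit r c)" "j < card (orbit r c)" "(r ^^ i) c = (r ^^ j) c"
  shows "i = j"
  using inj_onD[OF inj_on_funpow_dist1[OF self_in_orbit[OF assms(1)]] assms(4)] assms(2,3)
  by (simp add: card_orbit_rot[OF assms(1)])

lemma ex_rot_funpow:
  assumes "c \<in> A" "d \<in> A" "ta d = ta c"
  obtains m where "m < card (orbit r c)" "d = (r ^^ m) c"
proof -
  have "d \<in> out_arcs (gr G) (ta c)" using assms by simp
  then have "d \<in> orbit r c" by (simp only: out_arcs_eq_orbit[OF assms(1)])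
  then show ?thesis
    using that orbit_conv_funpow_dist1[OF self_in_orbit[OF assms(1)]]
    unfolding card_orbit_rot[OF assms(1)] by auto
qed

text \<open>The sum telescopes: the face on the right of an arc is the face on the left of its
  successor (\<open>face_inv_opp\<close>).\<close>

lemma partial_hol_gauge:
  assumes "face_inv s" "c \<in> A"
  shows "partial_hol (gauge s \<nu>) c n = s ((r ^^ n) c) + partial_hol \<nu> c n - s c"
proof (induction n)
  case (Suc n)
  then show ?case
    using face_inv_opp[OF assms(1), of "(r ^^ n) c"] assms(2)
    by (simp add: gauge_def diff_conv_add_uminus add.assoc minus_add del: add_uminus_conv_diff)
qed simp

lemma hol_gauge: "face_inv s \<Longrightarrow> c \<in> A \<Longrightarrow> hol (gauge s \<nu>) c = s c + hol \<nu> c - s c"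
  by (simp add: hol_def partial_hol_gauge rot_period)

lemma partial_hol_rot: "partial_hol \<nu> c (Suc n) = partial_hol \<nu> (r c) n + \<nu> c"
proof (induction n)
  case (Suc n)
  have "partial_hol \<nu> c (Suc (Suc n)) = \<nu> ((r ^^ Suc n) c) + partial_hol \<nu> c (Suc n)" by simp
  also have "\<dots> = \<nu> ((r ^^ n) (r c)) + partial_hol \<nu> (r c) n + \<nu> c"
    unfolding Suc funpow_Suc_right by (simp add: add.assoc)
  finally show ?case by simp
qed simp

text \<open>Starting the turn one arc later conjugates the holonomy by the label of the arc that was
  passed.\<close>

lemma hol_conjugate:
  assumes "c \<in> A" "d \<in> A" "ta c = ta d"
  shows "conjugate (hol \<nu> c) (hol \<nu> d)"
proof -
  have step: "conjugate (hol \<nu> b) (hol \<nu> (r b))" if "b \<in> A" for b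
  proof -
    let ?n = "card (orbit r b)"
    have "orbit r (r b) = orbit r b"
      using out_arcs_eq_orbit[OF that] out_arcs_eq_orbit[OF rot_in[OF that]] that by simp
    then have "hol \<nu> (r b) + \<nu> b = partial_hol \<nu> b (Suc ?n)"
      unfolding partial_hol_rot by (simp add: hol_def)
    also have "\<dots> = \<nu> b + hol \<nu> b"
      using that by (simp add: hol_def rot_period)
    finally have "hol \<nu> (r b) = \<nu> b + hol \<nu> b - \<nu> b"
      by (simp add: eq_diff_eq)
    then show ?thesis by (rule conjugateI)
  qed
  obtain m where "d = (r ^^ m) c"
    using ex_rot_funpow[of c d] assms by metis
  moreover have "conjugate (hol \<nu> c) (hol \<nu> ((r ^^ n) c))" for n
  proof (induction n)
    case (Suc n)
    then show ?case using conjugate_trans[OF _ step[of "(r ^^ n) c"]] assms(1) by simp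
  qed (simp add: conjugate_refl)
  ultimately show ?thesis by simp
qed

lemma hol_single:
  assumes "c \<in> A" and z: "\<And>d. d \<in> A \<Longrightarrow> ta d = ta c \<Longrightarrow> d \<noteq> c \<Longrightarrow> \<nu> d = 0"
  shows "hol \<nu> c = \<nu> c"
proof -
  have "n < card (orbit r c) \<Longrightarrow> partial_hol \<nu> c (Suc n) = \<nu> c" for n
  proof (induction n)
    case (Suc n)
    have "(r ^^ Suc n) c \<noteq> c"
      using rot_inj[OF assms(1), of "Suc n" 0] Suc card_orbit_pos[OF assms(1)] by auto
    then have "\<nu> ((r ^^ Suc n) c) = 0"
      using assms(1) by (intro z) (auto simp del: funpow.simps)
    then show ?case using Suc by simp
  qed simp
  from this[of "card (orbit r c) - 1"] show ?thesis
    using card_orbit_pos[OF assms(1)] by (simp add: hol_def)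
qed

text \<open>The turn starts with \<open>c\<close>, so \<open>\<nu> c'\<close> stands on the left
  wherever \<open>c'\<close> is met in the rotation.\<close>

lemma hol_two:
  assumes c: "c \<in> A" "c' \<in> A" "ta c' = ta c" "c' \<noteq> c"
    and z: "\<And>d. d \<in> A \<Longrightarrow> ta d = ta c \<Longrightarrow> d \<noteq> c \<Longrightarrow> d \<noteq> c' \<Longrightarrow> \<nu> d = 0"
  shows "hol \<nu> c = \<nu> c' + \<nu> c"
proof -
  obtain m where m: "m < card (orbit r c)" "c' = (r ^^ m) c"
    using ex_rot_funpow[of c c'] c by metis
  then have "0 < m" using c by (cases m) auto
  have "n < card (orbit r c) \<Longrightarrow>
      partial_hol \<nu> c (Suc n) = (if m \<le> n then \<nu> c' + \<nu> c else \<nu> c)" for n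
  proof (induction n)
    case (Suc n)
    show ?case
    proof (cases "Suc n = m")
      case True
      then show ?thesis using Suc m by (auto simp del: funpow.simps)
    next
      case False
      have "(r ^^ Suc n) c \<noteq> c" "(r ^^ Suc n) c \<noteq> c'"
        using rot_inj[OF c(1), of "Suc n" 0] rot_inj[OF c(1), of "Suc n" m] Suc.prems m False
          card_orbit_pos[OF c(1)] by auto
      then have "\<nu> ((r ^^ Suc n) c) = 0"
        using c(1) by (intro z) (auto simp del: funpow.simps)
      then show ?thesis using Suc False by auto
    qed
  qed (use \<open>0 < m\<close> in simp)
  moreover have "m \<le> card (orbit r c) - 1" using m by simp
  ultimately show ?thesis
    using card_orbit_pos[OF c(1)] by (metis hol_def Suc_diff_1 diff_less zero_less_one)
qed

lemma hol_zero:
  assumes "c \<in> A" "\<And>d. d \<in> A \<Longrightarrow> ta d = ta c \<Longrightarrow> \<nu> d = 0"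
  shows "hol \<nu> c = 0"
  using hol_single[of c \<nu>] assms by simp

definition flat_at :: "('d \<Rightarrow> 'g::group_add) \<Rightarrow> 'v \<Rightarrow> bool" where
  "flat_at \<nu> v \<longleftrightarrow> (\<forall>c\<in>A. ta c = v \<longrightarrow> hol \<nu> c = 0)"

lemma flat_at_gauge: "face_inv s \<Longrightarrow> flat_at \<nu> v \<Longrightarrow> flat_at (gauge s \<nu>) v"
  by (simp add: flat_at_def hol_gauge)

end

section \<open>Concentrating a flat cochain on a connected set of edges\<close>

context plane_map
begin

definition spanning :: "'d set \<Rightarrow> bool" where
  "spanning S \<longleftrightarrow> (\<forall>u\<in>V. \<forall>v\<in>V. (u, v) \<in> cc (vrel S))"

text \<open>
  An edge with two different classes of faces on its sides can be made trivial by a gauge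
  transformation that is constant on each class.
\<close>

lemma ex_tree_support:
  fixes \<nu> :: "'d \<Rightarrow> 'g::group_add"
  assumes \<nu>: "cochain \<nu>" and P: "arc_sym P"
  obtains S s where "arc_sym S" "P \<subseteq> S" "spanning S" "face_inv s"
    "\<And>c. c \<in> A - S \<Longrightarrow> gauge s \<nu> c = 0"
    "\<And>c. c \<in> S - P \<Longrightarrow> (ta c, he c) \<notin> cc (vrel (S - {c, e c}))"
proof -
  \<comment> \<open>Candidates for the support, up to gauge. In a smallest one, no edge outside
    \<open>P\<close> lies on a cycle.\<close>
  define K where "K S \<longleftrightarrow> arc_sym S \<and> P \<subseteq> S \<and> spanning S \<and>
    (\<exists>s. face_inv s \<and> (\<forall>c\<in>A - S. gauge s \<nu> c = 0))" for S
  have "K A"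
    using P connected_cc by (auto simp: K_def arc_sym_def spanning_def face_inv_def)
  then obtain S where S: "K S" and least: "\<And>S'. K S' \<Longrightarrow> card S \<le> card S'"
    using ex_has_least_nat[of K A card] by blast
  obtain s where s: "face_inv s" "\<And>c. c \<in> A - S \<Longrightarrow> gauge s \<nu> c = 0"
    using S unfolding K_def by blast
  have symS: "arc_sym S" using S by (simp add: K_def)
  show thesis
  proof (rule that)
    fix c assume c: "c \<in> S - P"
    show "(ta c, he c) \<notin> cc (vrel (S - {c, e c}))"
    proof
      assume cyc: "(ta c, he c) \<in> cc (vrel (S - {c, e c}))"
      let ?S' = "S - {c, e c}"
      have cS: "c \<in> S" and cA: "c \<in> A" using c symS by (auto dest: arc_symD)
      have sep: "(c, e c) \<notin> cc (frel S)"
        by (rule cycle_separates[OF symS cS cyc])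
      define \<mu> where "\<mu> = gauge s \<nu>"
      have \<mu>: "cochain \<mu>" "\<And>b. b \<in> A - S \<Longrightarrow> \<mu> b = 0"
        using cochain_gauge[OF \<nu>] s by (simp_all add: \<mu>_def)
      \<comment> \<open>Constant on each face of \<open>S\<close> and nonzero at most on the face
        left of \<open>c\<close>. As \<open>e c\<close> lies on another face, this gauge cancels
        exactly the label of \<open>c\<close>.\<close>
      define t where "t b = (if (c, b) \<in> cc (frel S) then \<mu> c else 0)" for b
      have tc: "t c = \<mu> c" "t (e c) = 0" using sep by (simp_all add: t_def)
      have t_eq: "t a = t b" if "(a, b) \<in> frel S" for a b
        using cc_trans[OF _ cc_base[OF that], of c] cc_trans[OF _ cc_base'[OF that], of c]
        by (auto simp: t_def)
      have "face_inv t"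
        unfolding face_inv_def
      proof
        fix b assume "b \<in> A"
        then have "t b = t (phi b)" by (intro t_eq) (simp add: frel_def)
        then show "t (phi b) = t b" ..
      qed
      then have "face_inv (\<lambda>b. t b + s b)"
        using s(1) by (simp add: face_inv_def)
      moreover have "gauge (\<lambda>b. t b + s b) \<nu> b = 0" if b: "b \<in> A - ?S'" for b
      proof -
        have *: "gauge (\<lambda>b. t b + s b) \<nu> b = t (e b) + \<mu> b - t b"
          using gauge_gauge[of t s \<nu> b] by (simp only: \<mu>_def gauge_def[of t])
        consider "b = c" | "b = e c" | "b \<in> A - S" using b by blast
        then show ?thesis
        proof cases
          case 1
          then show ?thesis using * tc by simp
        next
          case 2
          then show ?thesis using * tc \<mu>(1) cA by (simp add: cochain_def)
        next
          case 3
          then have "t b = t (e b)" by (intro t_eq) (auto simp: frel_def)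
          then show ?thesis using 3 \<mu> by (simp add: *)
        qed
      qed
      moreover have "spanning ?S'"
        using S cc_vrel_remove[OF symS cS] cyc by (simp add: K_def spanning_def cc_insert_eq)
      moreover have "P \<subseteq> ?S'"
        using S c P arc_sym_opp_iff[OF P cA] by (auto simp: K_def)
      ultimately have "K ?S'"
        unfolding K_def using arc_sym_diff[OF symS cA] by blast
      then show False
        using least[of ?S'] card_remove[OF symS cS] by simp
    qed
  qed (use S s in \<open>auto simp: K_def\<close>)
qed

text \<open>This is the measure for moving outward along the tree. Returning over \<open>c\<close>
  would give a detour around the bridge \<open>c\<close>, and reaching \<open>he c\<close>, the tail
  of \<open>c'\<close>, would give one around \<open>c'\<close>.\<close>

lemma beyond_bridge_subset:
  assumes S: "arc_sym S" and c: "c \<in> S" "c' \<in> S" "c' \<noteq> c" "c' \<noteq> e c" "ta c' = he c"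
    and bridge: "(ta c, he c) \<notin> cc (vrel (S - {c, e c}))" "(ta c', he c') \<notin> cc (vrel (S - {c', e c'}))"
  shows "cc (vrel (S - {c', e c'})) `` {he c'} \<subset> cc (vrel (S - {c, e c})) `` {he c}" (is "?B' \<subset> ?B")
proof -
  have A: "c \<in> A" "c' \<in> A" using S c by (auto dest: arc_symD)
  let ?T = "S - {c', e c'} - {c, e c}"
  have sym': "arc_sym (S - {c', e c'})" using S A by (simp add: arc_sym_diff)
  have "c \<in> S - {c', e c'}" using c A by auto
  then have cc': "cc (vrel (S - {c', e c'})) = cc (insert (ta c, he c) (vrel ?T))"
    by (rule cc_vrel_remove[OF sym'])
  have T: "cc (vrel ?T) \<subseteq> cc (vrel (S - {c, e c}))" "cc (vrel ?T) \<subseteq> cc (vrel (S - {c', e c'}))"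
    by (intro cc_mono; auto simp: vrel_def)+
  have "c' \<in> S - {c, e c}" using c by auto
  then have w: "(he c, he c') \<in> cc (vrel (S - {c, e c}))"
    using vrel_in[of c' "S - {c, e c}"] c(5) by (simp add: cc_base)
  have "?B' \<subseteq> ?B"
  proof
    fix y assume "y \<in> ?B'"
    then have "(he c', y) \<in> cc (insert (ta c, he c) (vrel ?T))"
      unfolding cc' by simp
    then consider "(he c', y) \<in> cc (vrel ?T)" | "(he c', ta c) \<in> cc (vrel ?T)"
      | "(he c', he c) \<in> cc (vrel ?T)"
      using cc_insert[of "he c'" y "ta c" "he c"] by blast
    then show "y \<in> ?B"
    proof cases
      case 1
      then show ?thesis using T(1) cc_trans[OF w, of y] by auto
    next
      case 2
      then have "(he c, ta c) \<in> cc (vrel (S - {c, e c}))"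
        using T(1) by (intro cc_trans[OF w]) blast
      then show ?thesis using bridge(1) cc_sym[of "he c" "ta c"] by blast
    next
      case 3
      then show ?thesis using T(2) bridge(2) cc_sym[of "he c'" "ta c'"] c(5) by auto
    qed
  qed
  moreover have "he c \<in> ?B" by simp
  moreover have "he c \<notin> ?B'"
    using bridge(2) c(5) cc_sym[of "he c'" "ta c'"] by auto
  ultimately show ?thesis by blast
qed

lemma finite_beyond_bridge:
  assumes "S \<subseteq> A" and c: "c \<in> A"
  shows "finite (cc (vrel (S - {c, e c})) `` {he c})"
proof -
  have "cc (vrel (S - {c, e c})) `` {he c} \<subseteq> V"
  proof clarify
    fix y assume "(he c, y) \<in> cc (vrel (S - {c, e c}))"
    then show "y \<in> V"
      by (induction rule: cc_induct) (use c assms(1) in \<open>auto simp: vrel_def\<close>)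
  qed
  then show ?thesis using finite_verts finite_subset by blast
qed

text \<open>
  A leaf of the tree supports a single arc there, so flatness makes it trivial; now continue
  towards \<open>P\<close>.
\<close>

lemma tree_support_flat:
  fixes \<nu> :: "'d \<Rightarrow> 'g::group_add"
  assumes \<nu>: "cochain \<nu>" and P: "arc_sym P" and S: "arc_sym S" "P \<subseteq> S"
    and supp: "\<And>c. c \<in> A - S \<Longrightarrow> \<nu> c = 0"
    and bridge: "\<And>c. c \<in> S - P \<Longrightarrow> (ta c, he c) \<notin> cc (vrel (S - {c, e c}))"
    and conn: "\<And>p q. p \<in> P \<Longrightarrow> q \<in> P \<Longrightarrow> (ta p, ta q) \<in> cc (vrel P)"
    and flat: "\<And>v. v \<in> V \<Longrightarrow> v \<notin> ta ` P \<Longrightarrow> flat_at \<nu> v"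
    and c: "c \<in> A - P"
  shows "\<nu> c = 0"
proof -
  define B where "B c = cc (vrel (S - {c, e c})) `` {he c}" for c
  have SA: "S \<subseteq> A" using S by (simp add: arc_sym_def)
  \<comment> \<open>These are the arcs that point away from \<open>P\<close>; the induction starts
    at the leaves.\<close>
  have main: "\<nu> c = 0" if "c \<in> S - P" "B c \<inter> ta ` P = {}" for c
    using that
  proof (induction "card (B c)" arbitrary: c rule: less_induct)
    case (less c)
    have cA: "c \<in> A" using less.prems SA by blast
    have "he c \<in> B c" by (simp add: B_def)
    then have w: "he c \<notin> ta ` P" using less.prems by blast
    \<comment> \<open>Any further tree arc at the head of \<open>c\<close> points away from
      \<open>P\<close> as well and cuts off a smaller part.\<close>
    have z: "\<nu> c' = 0" if c': "c' \<in> A" "ta c' = ta (e c)" "c' \<noteq> e c" for c'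
    proof (cases "c' \<in> S")
      case True
      have tc': "ta c' = he c" using c' cA by simp
      then have "c' \<notin> P" using w by (metis imageI)
      then have c'P: "c' \<in> S - P" using True by simp
      have ne: "c' \<noteq> c"
      proof
        assume "c' = c"
        then show False using bridge[OF less.prems(1)] tc' by simp
      qed
      have cS: "c \<in> S" using less.prems(1) by simp
      have sub: "B c' \<subset> B c"
        unfolding B_def
        by (rule beyond_bridge_subset[OF S(1) cS True ne c'(3) tc'
              bridge[OF less.prems(1)] bridge[OF c'P]])
      then have "card (B c') < card (B c)"
        unfolding B_def by (intro psubset_card_mono finite_beyond_bridge[OF SA cA])
      then show ?thesis
        using less.hyps[of c'] c'P sub less.prems(2) by blast
    qed (use supp c' in auto)
    have "hol \<nu> (e c) = \<nu> (e c)"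
      using cA z by (intro hol_single) auto
    moreover have "hol \<nu> (e c) = 0"
      using flat[OF _ w] cA by (auto simp: flat_at_def)
    ultimately show ?case using \<nu> cA by (simp add: cochain_def)
  qed
  show ?thesis
  proof (cases "c \<in> S")
    case True
    then have c: "c \<in> S - P" "e c \<in> S - P" "c \<in> A"
      using c P S by (auto simp: arc_sym_opp_iff)
    \<comment> \<open>\<open>P\<close> stays connected without \<open>c\<close>, so it cannot meet
      both sides of the bridge; one of the two directions of \<open>c\<close> therefore points away
      from \<open>P\<close>.\<close>
    have "B c \<inter> ta ` P = {} \<or> B (e c) \<inter> ta ` P = {}"
    proof (rule ccontr)
      assume "\<not> ?thesis"
      then obtain p q where pq: "p \<in> P" "q \<in> P" "ta p \<in> B c" "ta q \<in> B (e c)" by blast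
      have "P \<subseteq> S - {c, e c}" using S c by auto
      then have "cc (vrel P) \<subseteq> cc (vrel (S - {c, e c}))"
        by (intro cc_mono) (auto simp: vrel_def)
      then have 1: "(ta p, ta q) \<in> cc (vrel (S - {c, e c}))" using conn pq by blast
      have 2: "(he c, ta p) \<in> cc (vrel (S - {c, e c}))" using pq by (simp add: B_def)
      have 3: "(ta c, ta q) \<in> cc (vrel (S - {c, e c}))"
        using pq c by (simp add: B_def insert_commute)
      show False
        using cc_trans[OF 3 cc_sym[OF cc_trans[OF 2 1]]] bridge[OF c(1)] by simp
    qed
    then show ?thesis
      using main[OF c(1)] main[OF c(2)] \<nu> c(3) by (auto simp: cochain_def)
  qed (use supp c in auto)
qed

theorem ex_gauge_supported:
  fixes \<nu> :: "'d \<Rightarrow> 'g::group_add"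
  assumes \<nu>: "cochain \<nu>" and P: "arc_sym P"
    and conn: "\<And>p q. p \<in> P \<Longrightarrow> q \<in> P \<Longrightarrow> (ta p, ta q) \<in> cc (vrel P)"
    and flat: "\<And>v. v \<in> V \<Longrightarrow> v \<notin> ta ` P \<Longrightarrow> flat_at \<nu> v"
  obtains s where "face_inv s" "\<And>c. c \<in> A - P \<Longrightarrow> gauge s \<nu> c = 0"
proof -
  obtain S s where S: "arc_sym S" "P \<subseteq> S" "spanning S" "face_inv s"
    "\<And>c. c \<in> A - S \<Longrightarrow> gauge s \<nu> c = 0"
    "\<And>c. c \<in> S - P \<Longrightarrow> (ta c, he c) \<notin> cc (vrel (S - {c, e c}))"
    using ex_tree_support[OF \<nu> P] by blast
  have "gauge s \<nu> c = 0" if "c \<in> A - P" for c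
    by (rule tree_support_flat[OF cochain_gauge[OF \<nu>] P S(1,2,5,6) conn flat_at_gauge[OF S(4) flat] that])
  then show thesis using that S(4) by blast
qed

end

section \<open>Cut-paths\<close>

locale cut_map = emb_map Op for Op :: "('w, 'c, 'z) lopsp_scheme" +
  fixes P :: "'c list"
  assumes cut: "cut_path Op P"
    and special_inj: "inj_on (special Op) {0, 1, 2}"
begin

abbreviation "v0 \<equiv> special Op 0"
abbreviation "v1 \<equiv> special Op 1"
abbreviation "v2 \<equiv> special Op 2"
abbreviation "n \<equiv> length P"

text \<open>The position of \<open>v0\<close> on the path (\<open>w_k\<close>): the arcs with index
  below \<open>k\<close> lead from \<open>v1\<close> to \<open>v0\<close>, the others from
  \<open>v0\<close> to \<open>v2\<close>.\<close>

definition k :: nat where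
  "k = length (takeWhile (\<lambda>a. ta a \<noteq> v0) P)"

definition w :: "nat \<Rightarrow> 'w" where
  "w i = awalk_verts v1 P ! i"

definition S :: "'c set" where
  "S = both_dirs Op P"

lemma special_neq [simp]:
  "v0 \<noteq> v1" "v0 \<noteq> v2" "v1 \<noteq> v2" "v1 \<noteq> v0" "v2 \<noteq> v0" "v2 \<noteq> v1"
  "special Op (Suc 0) \<noteq> v0" "special Op (Suc 0) \<noteq> v2" "v0 \<noteq> special Op (Suc 0)" "v2 \<noteq> special Op (Suc 0)"
  using special_inj by (auto simp: inj_on_def)

lemma path: "cas v1 P v2" "set P \<subseteq> A" "distinct (awalk_verts v1 P)" "v0 \<in> set (awalk_verts v1 P)"
  using cut by (auto simp: cut_path_def apath_def awalk_def)

lemma P_nonempty: "P \<noteq> []" "0 < n"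
  using path(1) special_neq(3) by (cases P; simp)+

lemma P_in [simp]: "i < n \<Longrightarrow> P ! i \<in> A"
  using path(2) by auto

lemma tail_P [simp]: "i < n \<Longrightarrow> ta (P ! i) = w i"
  using P_nonempty by (simp add: w_def awalk_verts_conv nth_append)

lemma head_P [simp]: "i < n \<Longrightarrow> he (P ! i) = w (Suc i)"
  unfolding w_def awalk_verts_conv'[OF path(1)] using P_nonempty by simp

lemma w_inj: "i \<le> n \<Longrightarrow> j \<le> n \<Longrightarrow> w i = w j \<longleftrightarrow> i = j"
  using path(3) by (simp add: w_def nth_eq_iff_index_eq length_awalk_verts)

lemma w_0: "w 0 = v1"
  unfolding w_def using path(1) P_nonempty by (cases P) auto

lemma w_n: "w n = v2"
  using awlast_if_cas[OF path(1)] by (simp add: w_def last_conv_nth length_awalk_verts)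

lemma k_less: "k < n" and w_k: "w k = v0"
proof -
  obtain j where j: "j \<le> n" "w j = v0"
    using path(4) by (auto simp: in_set_conv_nth length_awalk_verts w_def less_Suc_eq_le)
  then have "j < n" using w_n special_neq by (metis le_neq_implies_less)
  then have "\<exists>a\<in>set P. ta a = v0" using j by (intro bexI[of _ "P ! j"]) auto
  then have "takeWhile (\<lambda>a. ta a \<noteq> v0) P \<noteq> P" by (auto simp: takeWhile_eq_all_conv)
  then show k: "k < n"
    unfolding k_def by (metis length_takeWhile_le le_neq_implies_less takeWhile_eq_take take_all order_refl)
  then show "w k = v0"
    using nth_length_takeWhile[of "\<lambda>a. ta a \<noteq> v0" P] by (simp add: k_def[symmetric])
qed

lemma k_pos: "0 < k"
  using w_k w_0 special_neq by (metis gr0I)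

lemma w_eq_v0: "i \<le> n \<Longrightarrow> w i = v0 \<longleftrightarrow> i = k"
  using w_inj[of i k] w_k k_less by simp

lemma w_eq_v1: "i \<le> n \<Longrightarrow> w i = v1 \<longleftrightarrow> i = 0"
  using w_inj[of i 0] w_0 by simp

lemma w_eq_v2: "i \<le> n \<Longrightarrow> w i = v2 \<longleftrightarrow> i = n"
  using w_inj[of i n] w_n by simp

lemma P_inj: "i < n \<Longrightarrow> j < n \<Longrightarrow> P ! i = P ! j \<longleftrightarrow> i = j"
  using w_inj[of i j] tail_P by (metis less_imp_le_nat)

lemma P_neq_opp: "i < n \<Longrightarrow> j < n \<Longrightarrow> P ! i \<noteq> e (P ! j)"
proof
  assume ij: "i < n" "j < n" "P ! i = e (P ! j)"
  have "w i = w (Suc j)" using ij tail_P[of i] by simp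
  moreover have "w (Suc i) = w j" using ij head_P[of i] by simp
  ultimately show False using ij w_inj[of i "Suc j"] w_inj[of "Suc i" j] by simp
qed

lemma oppP_inj: "i < n \<Longrightarrow> j < n \<Longrightarrow> e (P ! i) = e (P ! j) \<longleftrightarrow> i = j"
  by (simp add: opp_eq_iff P_inj)

lemma in_S_iff: "c \<in> S \<longleftrightarrow> (\<exists>i<n. c = P ! i \<or> c = e (P ! i))"
proof
  assume "c \<in> S"
  then have "c \<in> set P \<or> c \<in> e ` set P" by (simp add: S_def both_dirs_def)
  then show "\<exists>i<n. c = P ! i \<or> c = e (P ! i)" by (metis imageE in_set_conv_nth)
qed (auto simp: S_def both_dirs_def)

lemma S_cases:
  assumes "c \<in> S"
  obtains i where "i < n" "c = P ! i" | i where "i < n" "c = e (P ! i)"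
  using assms in_S_iff by blast

lemma P_in_S [simp]: "i < n \<Longrightarrow> P ! i \<in> S" "i < n \<Longrightarrow> e (P ! i) \<in> S"
  using in_S_iff by blast+

lemma arc_sym_S: "arc_sym S"
  unfolding arc_sym_def by (auto elim!: S_cases)

lemma tail_S: "ta ` S = w ` {..n}"
proof (intro equalityI subsetI)
  fix v assume "v \<in> ta ` S"
  then obtain c where c: "c \<in> S" "v = ta c" by blast
  from c(1) show "v \<in> w ` {..n}"
  proof (cases rule: S_cases)
    case (1 i)
    then show ?thesis unfolding c(2) by simp
  next
    case (2 i)
    then show ?thesis unfolding c(2) by simp
  qed
next
  fix v assume "v \<in> w ` {..n}"
  then obtain i where i: "i \<le> n" "v = w i" by blast
  show "v \<in> ta ` S"
  proof (cases "i = n")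
    case True
    then have "v = ta (e (P ! (n - 1)))" using P_nonempty i by simp
    then show ?thesis using P_nonempty by (metis P_in_S(2) diff_less imageI zero_less_one)
  next
    case False
    then have "v = ta (P ! i)" "i < n" using i by simp_all
    then show ?thesis by (metis P_in_S(1) imageI)
  qed
qed

lemma S_at:
  assumes "c \<in> S" "ta c = w i" "i \<le> n"
  shows "(i < n \<and> c = P ! i) \<or> (0 < i \<and> c = e (P ! (i - 1)))"
  using assms(1)
proof (cases rule: S_cases)
  case (1 j)
  then have "w j = w i" using assms(2) by simp
  then have "j = i" using w_inj[of j i] 1(1) assms(3) by simp
  then show ?thesis using 1 by simp
next
  case (2 j)
  then have "w (Suc j) = w i" using assms(2) by simp
  then have "Suc j = i" using w_inj[of "Suc j" i] 2(1) assms(3) by simp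
  then show ?thesis using 2 by auto
qed

lemma connected_S:
  assumes "p \<in> S" "q \<in> S"
  shows "(ta p, ta q) \<in> cc (vrel S)"
proof -
  have w: "i \<le> n \<Longrightarrow> (w 0, w i) \<in> cc (vrel S)" for i
  proof (induction i)
    case (Suc i)
    have "(w i, w (Suc i)) \<in> vrel S" using vrel_in[of "P ! i" S] Suc.prems by simp
    then have *: "(w i, w (Suc i)) \<in> cc (vrel S)" by (rule cc_base)
    have "(w 0, w i) \<in> cc (vrel S)" using Suc by simp
    then show ?case by (rule cc_trans[OF _ *])
  qed simp
  obtain i where "i \<le> n" "ta p = w i"
    using imageI[OF assms(1), of ta] unfolding tail_S by auto
  moreover obtain j where "j \<le> n" "ta q = w j"
    using imageI[OF assms(2), of ta] unfolding tail_S by auto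
  ultimately show ?thesis using cc_trans[OF cc_sym[OF w[of i]] w[of j]] by simp
qed

text \<open>The cochain of the cut-path, with arbitrary values for the two generators: a gauge
  transform of the cochain of another path first takes this form with unknown \<open>x\<close> and
  \<open>y\<close>.\<close>

definition nu :: "'g::group_add \<Rightarrow> 'g \<Rightarrow> 'c \<Rightarrow> 'g" where
  "nu x y c =
     (if c \<in> set (take k P) then x else if c \<in> e ` set (take k P) then - x
      else if c \<in> set (drop k P) then y else if c \<in> e ` set (drop k P) then - y else 0)"

lemma nu_conj: "nu (h + x - h) (h + y - h) c = h + nu x y c - h"
proof -
  have "- (h + z - h) = h + - z - h" for z
    by (simp add: diff_conv_add_uminus add.assoc minus_add del: add_uminus_conv_diff)
  then show ?thesis by (simp only: nu_def split: if_split) simp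
qed

lemma set_take_k: "set (take k P) = (\<lambda>i. P ! i) ` {..<k}"
  using nth_image[of k P] k_less by (simp add: lessThan_atLeast0)

lemma set_drop_k: "set (drop k P) = (\<lambda>i. P ! i) ` {k..<n}"
proof (intro equalityI subsetI)
  fix c assume "c \<in> set (drop k P)"
  then obtain i where "i < n - k" "c = P ! (k + i)"
    using k_less by (auto simp: in_set_conv_nth)
  then show "c \<in> (\<lambda>i. P ! i) ` {k..<n}" by (intro image_eqI[of _ _ "k + i"]) auto
next
  fix c assume "c \<in> (\<lambda>i. P ! i) ` {k..<n}"
  then obtain i where "k \<le> i" "i < n" "c = P ! i" by auto
  then show "c \<in> set (drop k P)"
    unfolding in_set_conv_nth by (intro exI[of _ "i - k"]) auto
qed

lemma nu_P:
  assumes "i < n"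
  shows "nu x y (P ! i) = (if i < k then x else y)" "nu x y (e (P ! i)) = (if i < k then - x else - y)"
proof -
  have 1: "P ! i \<in> set (take k P) \<longleftrightarrow> i < k"
    using assms k_less by (auto simp: set_take_k P_inj)
  have 2: "P ! i \<in> set (drop k P) \<longleftrightarrow> k \<le> i"
    using assms k_less by (auto simp: set_drop_k P_inj)
  have 3: "P ! i \<notin> e ` set (take k P)" "P ! i \<notin> e ` set (drop k P)"
    using assms k_less P_neq_opp by (auto simp: set_drop_k set_take_k)
  have neq: "e (P ! i) \<noteq> P ! j" if "j < n" for j
    using P_neq_opp[OF that assms] by (rule not_sym)
  have 4: "e (P ! i) \<notin> (\<lambda>j. P ! j) ` J" if "J \<subseteq> {..<n}" for J
    using neq that by blast
  have 4: "e (P ! i) \<notin> set (take k P)" "e (P ! i) \<notin> set (drop k P)"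
    unfolding set_take_k set_drop_k using k_less by (intro 4; force)+
  have 5: "e (P ! i) \<in> e ` set (take k P) \<longleftrightarrow> i < k"
    using assms k_less by (auto simp: set_take_k oppP_inj)
  have 6: "e (P ! i) \<in> e ` set (drop k P) \<longleftrightarrow> k \<le> i"
    using assms k_less by (auto simp: set_drop_k oppP_inj)
  show "nu x y (P ! i) = (if i < k then x else y)" "nu x y (e (P ! i)) = (if i < k then - x else - y)"
    using 1 2 3 4 5 6 by (simp_all add: nu_def)
qed

lemma nu_off: "c \<notin> S \<Longrightarrow> nu x y c = 0"
proof -
  assume c: "c \<notin> S"
  have "set P \<subseteq> S" "e ` set P \<subseteq> S" by (auto simp: S_def both_dirs_def)
  then have "c \<notin> set P" "c \<notin> e ` set P" using c by blast+
  then show ?thesis using set_take_subset[of k P] set_drop_subset[of k P] by (auto simp: nu_def)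
qed

lemma cochain_nu: "cochain (nu x y)"
  unfolding cochain_def
proof
  fix c assume c: "c \<in> A"
  show "nu x y (e c) = - nu x y c"
  proof (cases "c \<in> S")
    case True
    then show ?thesis by (cases rule: S_cases) (simp_all add: nu_P)
  next
    case False
    then show ?thesis using arc_sym_opp_iff[OF arc_sym_S c] by (simp add: nu_off)
  qed
qed

lemma hol_start:
  assumes "\<And>c. c \<in> A - S \<Longrightarrow> \<nu> c = 0"
  shows "hol \<nu> (P ! 0) = \<nu> (P ! 0)"
proof (rule hol_single)
  fix d assume "d \<in> A" "ta d = ta (P ! 0)" "d \<noteq> P ! 0"
  then show "\<nu> d = 0" using S_at[of d 0] assms[of d] P_nonempty by auto
qed (use P_nonempty in simp)

lemma hol_end:
  assumes "\<And>c. c \<in> A - S \<Longrightarrow> \<nu> c = 0"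
  shows "hol \<nu> (e (P ! (n - 1))) = \<nu> (e (P ! (n - 1)))"
proof (rule hol_single)
  fix d assume "d \<in> A" "ta d = ta (e (P ! (n - 1)))" "d \<noteq> e (P ! (n - 1))"
  then show "\<nu> d = 0" using S_at[of d n] assms[of d] P_nonempty by auto
qed (use P_nonempty in simp)

text \<open>Two path arcs start at such a vertex, one along the path and one against it, so the
  holonomy measures the jump of the label there.\<close>

lemma hol_mid:
  assumes "\<And>c. c \<in> A - S \<Longrightarrow> \<nu> c = 0" "cochain \<nu>" and i: "Suc i < n"
  shows "hol \<nu> (e (P ! i)) = \<nu> (P ! Suc i) - \<nu> (P ! i)"
proof -
  have "hol \<nu> (e (P ! i)) = \<nu> (P ! Suc i) + \<nu> (e (P ! i))"
  proof (rule hol_two)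
    fix d assume "d \<in> A" "ta d = ta (e (P ! i))" "d \<noteq> e (P ! i)" "d \<noteq> P ! Suc i"
    then show "\<nu> d = 0" using S_at[of d "Suc i"] assms(1)[of d] i by auto
  qed (use i P_neq_opp in auto)
  then show ?thesis using assms(2) i by (simp add: cochain_def)
qed

lemma flat_nu: "v \<notin> {v0, v1, v2} \<Longrightarrow> flat_at (nu x y) v"
  unfolding flat_at_def
proof (intro ballI impI)
  fix c assume v: "v \<notin> {v0, v1, v2}" and c: "c \<in> A" "ta c = v"
  show "hol (nu x y) c = 0"
  proof (cases "v \<in> ta ` S")
    case True
    then obtain i where i: "i \<le> n" "v = w i" unfolding tail_S by blast
    with v have "i \<noteq> 0" "i \<noteq> n" "i \<noteq> k"
      using w_eq_v0[of i] w_eq_v1[of i] w_eq_v2[of i] by auto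
    then obtain j where j: "i = Suc j" "Suc j < n" "Suc j \<noteq> k" using i by (cases i) auto
    have "hol (nu x y) (e (P ! j)) = 0"
      using j by (subst hol_mid) (auto simp: nu_off cochain_nu nu_P)
    moreover have "conjugate (hol (nu x y) (e (P ! j))) (hol (nu x y) c)"
      using j c i by (intro hol_conjugate) auto
    ultimately show ?thesis by (simp add: conjugate_0_iff)
  next
    case False
    show ?thesis
    proof (rule hol_zero[OF c(1)])
      fix d assume "ta d = ta c"
      then have "d \<notin> S" using False c(2) by (metis imageI)
      then show "nu x y d = 0" by (rule nu_off)
    qed
  qed
qed

lemma special_in_tail_S: "v0 \<in> ta ` S" "v1 \<in> ta ` S" "v2 \<in> ta ` S"
  unfolding tail_S using w_0 w_n w_k k_less by (metis atMost_iff imageI le0 le_refl less_imp_le_nat)+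

text \<open>Flatness forbids jumps at inner vertices of the two parts (\<open>hol_mid\<close>); only
  at \<open>v0\<close> may the label change.\<close>

lemma flat_supported_eq_nu:
  assumes supp: "\<And>c. c \<in> A - S \<Longrightarrow> \<nu> c = 0" and \<nu>: "cochain \<nu>"
    and flat: "\<And>v. v \<in> V \<Longrightarrow> v \<notin> {v0, v1, v2} \<Longrightarrow> flat_at \<nu> v"
    and c: "c \<in> A"
  shows "\<nu> c = nu (\<nu> (P ! 0)) (\<nu> (P ! k)) c"
proof -
  have step: "\<nu> (P ! Suc i) = \<nu> (P ! i)" if "Suc i < n" "Suc i \<noteq> k" for i
  proof -
    have "w (Suc i) \<notin> {v0, v1, v2}"
      using that w_eq_v0[of "Suc i"] w_eq_v1[of "Suc i"] w_eq_v2[of "Suc i"] by simp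
    moreover have "w (Suc i) \<in> V" using that head_P[of i] P_in[of i] by (metis Suc_lessD head_in_verts)
    ultimately have "hol \<nu> (e (P ! i)) = 0"
      using flat that by (simp add: flat_at_def)
    then show ?thesis using hol_mid[OF supp \<nu> that(1)] by simp
  qed
  have lo: "i < k \<Longrightarrow> \<nu> (P ! i) = \<nu> (P ! 0)" for i
    by (induction i) (use step k_less in auto)
  have hi: "k + i < n \<Longrightarrow> \<nu> (P ! (k + i)) = \<nu> (P ! k)" for i
    by (induction i) (use step in auto)
  have hi': "\<nu> (P ! i) = \<nu> (P ! k)" if "\<not> i < k" "i < n" for i
    using hi[of "i - k"] that by simp
  show ?thesis
  proof (cases "c \<in> S")
    case True
    then show ?thesis
    proof (cases rule: S_cases)
      case (1 i)
      then show ?thesis using lo[of i] hi'[of i] by (simp add: nu_P)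
    next
      case (2 i)
      then have "\<nu> c = - \<nu> (P ! i)" using \<nu> by (simp add: cochain_def)
      then show ?thesis using 2 lo[of i] hi'[of i] by (simp add: nu_P)
    qed
  qed (use supp c in \<open>auto simp: nu_off\<close>)
qed

end

section \<open>Gauge equivalence of the cochains of two cut-paths\<close>

theorem cut_paths_gauge_equivalent:
  fixes Op :: "('w, 'c, 'z) lopsp_scheme"
  assumes "plane_map Op" and P: "cut_map Op P" and Q: "cut_map Op Q" and "a \<noteq> b"
  obtains s where "emb_map.face_inv Op s"
    "\<And>c. c \<in> arcs (gr Op) \<Longrightarrow>
       cut_map.nu Op P (gen a) (gen b) c = emb_map.gauge Op s (cut_map.nu Op Q (gen a) (gen b)) c"
proof -
  interpret plane_map Op by fact
  interpret P: cut_map Op P by fact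
  interpret Q: cut_map Op Q by fact
  define \<nu> where "\<nu> = Q.nu (gen a) (gen b)"
  have coch: "cochain \<nu>" by (simp add: \<nu>_def Q.cochain_nu)
  have flat: "flat_at \<nu> v" if "v \<notin> {P.v0, P.v1, P.v2}" for v
    unfolding \<nu>_def using that by (rule Q.flat_nu)
  have flatS: "flat_at \<nu> v" if "v \<notin> ta ` P.S" for v
    using flat[of v] that P.special_in_tail_S by blast
  obtain s where s: "face_inv s" "\<And>c. c \<in> A - P.S \<Longrightarrow> gauge s \<nu> c = 0"
    using ex_gauge_supported[OF coch P.arc_sym_S P.connected_S flatS] by blast
  define \<mu> where "\<mu> = gauge s \<nu>"
  have coch': "cochain \<mu>" by (simp add: \<mu>_def cochain_gauge coch)
  have supp: "\<And>c. c \<in> A - P.S \<Longrightarrow> \<mu> c = 0" using s by (simp add: \<mu>_def)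
  have supp\<nu>: "\<And>c. c \<in> A - Q.S \<Longrightarrow> \<nu> c = 0" by (simp add: \<nu>_def Q.nu_off)
  have flat\<mu>: "flat_at \<mu> v" if "v \<in> V" "v \<notin> {P.v0, P.v1, P.v2}" for v
    unfolding \<mu>_def using that(2) by (intro flat_at_gauge[OF s(1)] flat)
  have \<mu>: "\<mu> c = P.nu (\<mu> (P ! 0)) (\<mu> (P ! P.k)) c" if "c \<in> A" for c
    by (rule P.flat_supported_eq_nu[OF supp coch' flat\<mu> that])
  have conj: "conjugate (hol \<nu> d) (hol \<mu> c)" if "c \<in> A" "d \<in> A" "ta c = ta d" for c d
  proof -
    have "conjugate (hol \<nu> c) (hol \<mu> c)"
      unfolding \<mu>_def hol_gauge[OF s(1) that(1)] by (rule conjugateI) simp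
    moreover have "conjugate (hol \<nu> d) (hol \<nu> c)"
      using that by (intro hol_conjugate) simp_all
    ultimately show ?thesis by (metis conjugate_trans)
  qed
  let ?a = "\<mu> (P ! 0)" and ?b = "\<mu> (P ! P.k)"
  \<comment> \<open>Both paths contain \<open>v1\<close>, \<open>v2\<close> and \<open>v0\<close>.
    At each of these, \<open>hol \<nu>\<close> is read off along \<open>Q\<close> and
    \<open>hol \<mu>\<close> along \<open>P\<close>; at \<open>v1\<close> a single path arc
    contributes.\<close>
  have 1: "conjugate (gen a) ?a"
  proof -
    have "conjugate (hol \<nu> (Q ! 0)) (hol \<mu> (P ! 0))"
      using P.P_nonempty Q.P_nonempty by (intro conj) (simp_all add: P.w_0 Q.w_0)
    then show ?thesis
      using P.hol_start[OF supp] Q.hol_start[OF supp\<nu>] Q.k_pos Q.P_nonempty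
      by (simp add: \<nu>_def Q.nu_P)
  qed
  \<comment> \<open>The only path arc that starts at \<open>v2\<close> runs against the path, so the
    holonomies here are the inverses.\<close>
  have 2: "conjugate (gen b) ?b"
  proof -
    have "conjugate (hol \<nu> (e (Q ! (Q.n - 1)))) (hol \<mu> (e (P ! (P.n - 1))))"
      using P.P_nonempty Q.P_nonempty by (intro conj) (simp_all add: P.w_n Q.w_n)
    moreover have "\<mu> (e (P ! (P.n - 1))) = - ?b"
      using P.k_less by (subst \<mu>) (auto simp: P.nu_P)
    moreover have "\<nu> (e (Q ! (Q.n - 1))) = - gen b"
      using Q.k_less by (auto simp: \<nu>_def Q.nu_P)
    ultimately have "conjugate (- gen b) (- ?b)"
      using P.hol_end[OF supp] Q.hol_end[OF supp\<nu>] by simp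
    then show ?thesis by (rule conjugate_uminus)
  qed
  \<comment> \<open>At \<open>v0\<close> the holonomy is the jump from the label of the first part
    to that of the second.\<close>
  have 3: "conjugate (gen b - gen a) (?b - ?a)"
  proof -
    obtain i where i: "P.k = Suc i" "Suc i < P.n" using P.k_less P.k_pos by (cases P.k) auto
    obtain j where j: "Q.k = Suc j" "Suc j < Q.n" using Q.k_less Q.k_pos by (cases Q.k) auto
    have "conjugate (hol \<nu> (e (Q ! j))) (hol \<mu> (e (P ! i)))"
      using i j P.w_k Q.w_k by (intro conj) auto
    moreover have "\<mu> (P ! i) = ?a"
      using i by (subst \<mu>) (auto simp: P.nu_P)
    moreover have "\<nu> (Q ! j) = gen a" "\<nu> (Q ! Suc j) = gen b"
      using j by (auto simp: \<nu>_def Q.nu_P)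
    ultimately show ?thesis
      using P.hol_mid[OF supp coch' i(2)] Q.hol_mid[OF supp\<nu> coch j(2)] i j by simp
  qed
  obtain p where p: "?a = p + gen a - p" using 1 unfolding conjugate_def by blast
  obtain q where q: "?b = q + gen b - q" using 2 unfolding conjugate_def by blast
  obtain t where t: "?b - ?a = t + (gen b - gen a) - t" using 3 unfolding conjugate_def by blast
  obtain h where h: "?a = h + gen a - h" "?b = h + gen b - h"
    using free_group_simultaneous_conj[OF \<open>a \<noteq> b\<close> p q t] by blast
  have "\<mu> c = h + P.nu (gen a) (gen b) c - h" if "c \<in> A" for c
    using \<mu>[OF that] unfolding h P.nu_conj .
  then have eq: "P.nu (gen a) (gen b) c = - h + \<mu> c + h" if "c \<in> A" for c
    using that by (simp add: diff_conv_add_uminus add.assoc del: add_uminus_conv_diff)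
  \<comment> \<open>Conjugation by a fixed element is a constant gauge transformation and can be
    merged into \<open>s\<close>.\<close>
  have "face_inv (\<lambda>c. - h + s c)" using s(1) by (simp add: face_inv_def)
  moreover have "P.nu (gen a) (gen b) c = gauge (\<lambda>c. - h + s c) \<nu> c" if "c \<in> A" for c
    unfolding eq[OF that] \<mu>_def
    by (simp add: gauge_def diff_conv_add_uminus add.assoc minus_add del: add_uminus_conv_diff)
  ultimately show thesis using that unfolding \<nu>_def by blast
qed

section \<open>Double chambers\<close>

lemma next_in_eq:
  assumes "0 < m" "(f ^^ m) a \<in> S" "\<And>j. 0 < j \<Longrightarrow> j < m \<Longrightarrow> (f ^^ j) a \<notin> S"
  shows "next_in f S a = (f ^^ m) a"
proof -
  have "(LEAST n. 0 < n \<and> (f ^^ n) a \<in> S) = m"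
    using assms by (intro Least_equality) (auto simp: not_less[symmetric])
  then show ?thesis by (simp add: next_in_def)
qed

lemma next_in_step: "f a \<in> S \<Longrightarrow> next_in f S a = f a"
  using next_in_eq[of 1 f a S] by simp

lemma next_inE:
  assumes "0 < m" "(f ^^ m) a \<in> S"
  obtains l where "0 < l" "l \<le> m" "next_in f S a = (f ^^ l) a" "(f ^^ l) a \<in> S"
    "\<And>j. 0 < j \<Longrightarrow> j < l \<Longrightarrow> (f ^^ j) a \<notin> S"
proof -
  define l where "l = (LEAST n. 0 < n \<and> (f ^^ n) a \<in> S)"
  have l: "0 < l \<and> (f ^^ l) a \<in> S" unfolding l_def by (rule LeastI[of _ m]) (use assms in simp)
  have le: "l \<le> j" if "0 < j" "(f ^^ j) a \<in> S" for j
    unfolding l_def by (rule Least_le) (use that in simp)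
  show thesis
  proof (rule that)
    show "next_in f S a = (f ^^ l) a" by (simp add: next_in_def l_def)
    show "(f ^^ j) a \<notin> S" if "0 < j" "j < l" for j using le[of j] that by linarith
    show "0 < l" "(f ^^ l) a \<in> S" using l by simp_all
    show "l \<le> m" using le assms by simp
  qed
qed

lemma next_in_rot:
  assumes "f a \<notin> S" "0 < m" "(f ^^ m) a \<in> S"
  shows "next_in f S (f a) = next_in f S a"
proof -
  obtain l where l: "0 < l" "next_in f S a = (f ^^ l) a" "(f ^^ l) a \<in> S"
    "\<And>j. 0 < j \<Longrightarrow> j < l \<Longrightarrow> (f ^^ j) a \<notin> S"
    using next_inE[OF assms(2,3)] by metis
  then obtain l' where l': "l = Suc l'" "0 < l'" using assms(1) by (cases l; cases "l - 1") auto
  have eq: "(f ^^ j) (f a) = (f ^^ Suc j) a" for j by (simp only: funpow_Suc_right o_apply)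
  have "next_in f S (f a) = (f ^^ l') (f a)"
  proof (rule next_in_eq)
    show "(f ^^ l') (f a) \<in> S" using l(3) unfolding l' eq .
    show "(f ^^ j) (f a) \<notin> S" if "0 < j" "j < l'" for j
      using l(4)[of "Suc j"] that unfolding l' eq by simp
  qed (rule l')
  then show ?thesis unfolding l(2) l'(1) eq .
qed

context emb_map
begin

abbreviation "ri \<equiv> inv_into A r"

lemma rot_image: "r ` A = A"
proof -
  have "r ` A \<subseteq> A" by auto
  then show ?thesis by (rule endo_inj_surj[OF finite_arcs _ inj_on_rot])
qed

lemma ri_in [simp]: "c \<in> A \<Longrightarrow> ri c \<in> A"
  using inv_into_into[of c r A] rot_image by simp

lemma rot_ri [simp]: "c \<in> A \<Longrightarrow> r (ri c) = c"
  using f_inv_into_f[of c r A] rot_image by simp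

lemma ri_rot [simp]: "c \<in> A \<Longrightarrow> ri (r c) = c"
  using inv_into_f_f[OF inj_on_rot] .

abbreviation "DC \<equiv> double_chamber_system G"

definition dc_arcs :: "'d bdart set" where
  "dc_arcs = (\<Union>a\<in>A. {VE a, EV a, VF a, FV a})"

lemma dc_arcs_eq:
  "{x \<in> arcs (gr (bary G)). has_edge_type (bary G) 1 x \<or> has_edge_type (bary G) 2 x} = dc_arcs"
  by (auto simp: bary_def has_edge_type_def dc_arcs_def)

lemma DC_simps [simp]:
  "arcs (gr DC) = dc_arcs" "verts (gr DC) = BV ` V \<union> BE ` edges G \<union> BF ` faces G"
  "tail (gr DC) = bary_tail G" "head (gr DC) = (\<lambda>x. bary_tail G (bary_opp x))"
  "opp DC = bary_opp" "vtype DC = bary_typ" "rot DC = next_in (bary_rot G) dc_arcs"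
  unfolding double_chamber_system_def sub_emb_def dc_arcs_eq by (simp_all add: bary_def)

text \<open>At 1-vertices and 2-vertices every second arc has type 0 and is deleted, so one step
  there is two steps of \<open>bary_rot\<close>.\<close>

lemma rot_DC:
  assumes "a \<in> A"
  shows "next_in (bary_rot G) dc_arcs (VE a) = VF a"
    and "next_in (bary_rot G) dc_arcs (VF a) = VE (r a)"
    and "next_in (bary_rot G) dc_arcs (EV a) = EV (e a)"
    and "next_in (bary_rot G) dc_arcs (FV a) = FV (ri (e a))"
proof -
  show "next_in (bary_rot G) dc_arcs (VE a) = VF a"
    using assms by (subst next_in_step) (auto simp: dc_arcs_def)
  show "next_in (bary_rot G) dc_arcs (VF a) = VE (r a)"
    using assms by (subst next_in_step) (auto simp: dc_arcs_def)
  have 1: "j = 1" if "0 < j" "j < 2" for j :: nat using that by simp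
  have "next_in (bary_rot G) dc_arcs (EV a) = (bary_rot G ^^ 2) (EV a)"
    using assms by (intro next_in_eq) (auto simp: dc_arcs_def numeral_2_eq_2 dest!: 1)
  then show "next_in (bary_rot G) dc_arcs (EV a) = EV (e a)" by (simp add: numeral_2_eq_2)
  have "next_in (bary_rot G) dc_arcs (FV a) = (bary_rot G ^^ 2) (FV a)"
    using assms by (intro next_in_eq) (auto simp: dc_arcs_def numeral_2_eq_2 dest!: 1)
  then show "next_in (bary_rot G) dc_arcs (FV a) = FV (ri (e a))" by (simp add: numeral_2_eq_2)
qed

lemma DC_edge_type [simp]:
  "has_edge_type DC 2 (VE a)" "\<not> has_edge_type DC 2 (VF a)"
  by (simp_all add: has_edge_type_def)

lemma DC_starts: "{h \<in> dc_arcs. bary_typ (bary_tail G h) = 0} = VE ` A \<union> VF ` A"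
  by (auto simp: dc_arcs_def)

lemma face_of_phi: "c \<in> A \<Longrightarrow> face_of G (phi c) = face_of G c"
proof -
  assume c: "c \<in> A"
  then have "(phi c, c) \<in> cc (frel A)" by (intro cc_base') (simp add: frel_def)
  then have "cc (frel A) `` {phi c} = cc (frel A) `` {c}" by (simp only: cc_class_eq_iff)
  then show ?thesis using c by (simp only: face_of_eq cc_frel_arcs_class phi_in)
qed

lemma face_of_eq_iff:
  assumes "c \<in> A" "d \<in> A"
  shows "face_of G c = face_of G d \<longleftrightarrow> d \<in> orbit phi c"
proof -
  have "face_of G c = face_of G d \<longleftrightarrow> (c, d) \<in> cc (frel A)"
    using assms by (simp only: face_of_eq cc_frel_arcs_class[symmetric] cc_class_eq_iff)
  also have "\<dots> \<longleftrightarrow> d \<in> cc (frel A) `` {c}" by simp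
  finally show ?thesis using assms(1) by (simp only: cc_frel_arcs_class)
qed

end

section \<open>The path as an embedded subgraph with a single face\<close>

context cut_map
begin

abbreviation "nx \<equiv> next_in r S"

lemma ex_rot_S:
  assumes "c \<in> A" "ta c \<in> ta ` S"
  obtains m where "0 < m" "(r ^^ m) c \<in> S"
proof -
  obtain d where d: "d \<in> S" "ta d = ta c" using assms(2) by (metis imageE)
  then obtain m where m: "m < card (orbit r c)" "d = (r ^^ m) c"
    using ex_rot_funpow[OF assms(1)] arc_symD(1)[OF arc_sym_S] by metis
  \<comment> \<open>The additional full turn makes the number of steps positive also when
    \<open>d = c\<close>.\<close>
  have "(r ^^ (m + card (orbit r c))) c = d"
    by (simp only: m(2) funpow_add o_apply rot_period[OF assms(1)])
  then show thesis using that[of "m + card (orbit r c)"] d card_orbit_pos[OF assms(1)] by simp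
qed

lemma nx_in_S: "c \<in> A \<Longrightarrow> ta c \<in> ta ` S \<Longrightarrow> nx c \<in> S"
  and tail_nx: "c \<in> A \<Longrightarrow> ta c \<in> ta ` S \<Longrightarrow> ta (nx c) = ta c"
  by (metis ex_rot_S next_inE) (metis ex_rot_S next_inE tail_rot_funpow)

lemma nx_rot: "c \<in> A \<Longrightarrow> ta c \<in> ta ` S \<Longrightarrow> r c \<notin> S \<Longrightarrow> nx (r c) = nx c"
  by (metis ex_rot_S next_in_rot)

lemma S_in_A: "c \<in> S \<Longrightarrow> c \<in> A"
  using arc_symD(1)[OF arc_sym_S] .

lemma nx_neq:
  assumes "c \<in> S" "d \<in> S" "ta c = ta d" "c \<noteq> d"
  shows "nx c \<noteq> c"
proof -
  have A: "c \<in> A" "d \<in> A" using assms S_in_A by auto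
  obtain m where m: "m < card (orbit r c)" "d = (r ^^ m) c"
    using ex_rot_funpow[OF A] assms(3) by metis
  then have "0 < m" using assms(4) by (cases m) auto
  then obtain l where "0 < l" "l \<le> m" "nx c = (r ^^ l) c"
    using next_inE[of m r c S] m assms(2) by metis
  then show ?thesis using rot_inj[OF A(1), of l 0] m card_orbit_pos[OF A(1)] by auto
qed

lemma nx_at:
  assumes "c \<in> S" "ta c = w i" "i \<le> n"
  shows "(i < n \<and> nx c = P ! i) \<or> (0 < i \<and> nx c = e (P ! (i - 1)))"
proof (rule S_at[OF _ _ assms(3)])
  have t: "ta c \<in> ta ` S" using assms(1) by (rule imageI)
  show "nx c \<in> S" by (rule nx_in_S[OF S_in_A[OF assms(1)] t])
  show "ta (nx c) = w i" using tail_nx[OF S_in_A[OF assms(1)] t] assms(2) by simp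
qed

lemma nx_first: "nx (P ! 0) = P ! 0"
  using nx_at[of "P ! 0" 0] P_nonempty by simp

lemma nx_last: "nx (e (P ! (n - 1))) = e (P ! (n - 1))"
  using nx_at[of "e (P ! (n - 1))" n] P_nonempty by simp

lemma
  assumes "Suc i < n"
  shows nx_opp: "nx (e (P ! i)) = P ! Suc i" and nx_Suc: "nx (P ! Suc i) = e (P ! i)"
proof -
  have ne: "P ! Suc i \<noteq> e (P ! i)" using P_neq_opp[of "Suc i" i] assms by simp
  have S: "P ! Suc i \<in> S" "e (P ! i) \<in> S" "ta (P ! Suc i) = ta (e (P ! i))"
    using assms by simp_all
  show "nx (e (P ! i)) = P ! Suc i"
    using nx_at[of "e (P ! i)" "Suc i"] nx_neq[OF S(2,1) S(3)[symmetric] ne[symmetric]] assms by simp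
  show "nx (P ! Suc i) = e (P ! i)"
    using nx_at[of "P ! Suc i" "Suc i"] nx_neq[OF S ne] assms by simp
qed

text \<open>The facial walk of the path: along \<open>P\<close> from \<open>v1\<close> to
  \<open>v2\<close>, then back to \<open>v1\<close> along the reversed arcs.\<close>

definition boundary :: "nat \<Rightarrow> 'c" where
  "boundary t = (if t < n then P ! t else e (P ! (2 * n - 1 - t)))"

lemma boundary_image: "boundary ` {..<2 * n} = S"
proof (intro equalityI subsetI)
  fix c assume "c \<in> S"
  then show "c \<in> boundary ` {..<2 * n}"
  proof (cases rule: S_cases)
    case (1 i)
    then show ?thesis by (intro image_eqI[of _ _ i]) (auto simp: boundary_def)
  next
    case (2 i)
    then show ?thesis by (intro image_eqI[of _ _ "2 * n - 1 - i"]) (auto simp: boundary_def)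
  qed
next
  fix c assume "c \<in> boundary ` {..<2 * n}"
  then obtain t where t: "t < 2 * n" "c = boundary t" by blast
  show "c \<in> S"
  proof (cases "t < n")
    case True
    then show ?thesis by (simp add: t boundary_def)
  next
    case False
    then have "2 * n - 1 - t < n" using t by simp
    then show ?thesis using False P_in_S(2)[of "2 * n - 1 - t"] by (simp only: t boundary_def if_False)
  qed
qed

lemma nx_opp_boundary:
  assumes "t < 2 * n"
  shows "nx (e (boundary t)) = boundary (Suc t mod (2 * n))"
proof -
  consider "Suc t < n" | "Suc t = n" | "n \<le> t" "Suc t < 2 * n" | "Suc t = 2 * n"
    using assms by linarith
  then show ?thesis
  proof cases
    case 1
    then show ?thesis by (simp add: boundary_def nx_opp)
  next
    case 2
    then have "t = n - 1" by simp
    moreover have "boundary n = e (P ! (n - 1))" by (simp add: boundary_def)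
    ultimately show ?thesis using 2 nx_last by (simp add: boundary_def)
  next
    case 3
    define i where "i = 2 * n - 1 - Suc t"
    have i: "2 * n - 1 - t = Suc i" "Suc i < n" "2 * n - Suc (Suc t) = i"
      using 3 by (auto simp: i_def)
    have "boundary t = e (P ! Suc i)" "boundary (Suc t) = e (P ! i)"
      using 3 i by (simp_all add: boundary_def i_def[symmetric])
    then show ?thesis using 3 i nx_Suc by simp
  next
    case 4
    then have "\<not> t < n" "2 * n - 1 - t = 0" using P_nonempty(2) by linarith+
    then have "boundary t = e (P ! 0)" by (simp only: boundary_def if_False)
    then show ?thesis using 4 P_nonempty nx_first by (simp add: boundary_def)
  qed
qed

text \<open>The walk \<open>boundary\<close> is closed of length \<open>2 * n\<close> and meets
  every arc of \<open>S\<close>, so it is the only face. This is the reason why a face of the path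
  system has a copy of every arc of \<open>S\<close> (\<open>face_K\<close>).\<close>

lemma orbit_boundary:
  assumes "c \<in> S"
  shows "orbit (\<lambda>b. nx (e b)) c = S"
proof -
  obtain t where t: "t < 2 * n" "c = boundary t"
    using assms unfolding boundary_image[symmetric] by blast
  have pow: "((\<lambda>b. nx (e b)) ^^ m) c = boundary ((t + m) mod (2 * n))" for m
  proof (induction m)
    case (Suc m)
    have "(t + m) mod (2 * n) < 2 * n" using P_nonempty by simp
    then have "nx (e (boundary ((t + m) mod (2 * n)))) = boundary (Suc ((t + m) mod (2 * n)) mod (2 * n))"
      by (rule nx_opp_boundary)
    then show ?case by (simp only: funpow.simps o_apply Suc mod_Suc_eq add_Suc_right)
  qed (use t in simp)
  show ?thesis
  proof (intro equalityI subsetI)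
    fix b assume "b \<in> orbit (\<lambda>b. nx (e b)) c"
    then obtain m where m: "b = boundary ((t + m) mod (2 * n))"
      unfolding orbit_altdef pow by blast
    have "boundary ((t + m) mod (2 * n)) \<in> boundary ` {..<2 * n}"
      using P_nonempty by (intro imageI) simp
    then show "b \<in> S" by (simp only: m boundary_image)
  next
    fix b assume "b \<in> S"
    then obtain u where u: "u < 2 * n" "b = boundary u"
      unfolding boundary_image[symmetric] by blast
    \<comment> \<open>The extra round keeps the subtraction of naturals exact and the number of
      steps positive.\<close>
    have "(t + (2 * n + u - t)) mod (2 * n) = u" using t u by simp
    then have "((\<lambda>b. nx (e b)) ^^ (2 * n + u - t)) c = b" by (simp only: pow u)
    moreover have "0 < 2 * n + u - t" using t by simp
    ultimately show "b \<in> orbit (\<lambda>b. nx (e b)) c"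
      unfolding orbit_altdef by blast
  qed
qed

lemma path01_eq: "path01 Op P = (\<lambda>i. P ! i) ` {..<k} \<union> (\<lambda>i. e (P ! i)) ` {..<k}"
proof -
  have "takeWhile (\<lambda>a. ta a \<noteq> v0) P = take k P"
    unfolding k_def by (rule takeWhile_eq_take)
  then show ?thesis
    unfolding path01_def both_dirs_def by (simp only: set_take_k image_image)
qed

lemma path02_eq: "path02 Op P = (\<lambda>i. P ! i) ` {k..<n} \<union> (\<lambda>i. e (P ! i)) ` {k..<n}"
proof -
  have "dropWhile (\<lambda>a. ta a \<noteq> v0) P = drop k P"
    unfolding k_def by (rule dropWhile_eq_drop)
  then show ?thesis
    unfolding path02_def both_dirs_def by (simp only: set_drop_k image_image)
qed

end

context cut_map
begin

lemma path01_at: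
  assumes "q \<in> path01 Op P" "ta q = w i" "i \<le> n"
  shows "(i < k \<and> q = P ! i) \<or> (0 < i \<and> i \<le> k \<and> q = e (P ! (i - 1)))"
proof -
  consider j where "j < k" "q = P ! j" | j where "j < k" "q = e (P ! j)"
    using assms(1) unfolding path01_eq by blast
  then show ?thesis
  proof cases
    case (1 j)
    then have "j = i" using assms(2,3) k_less w_inj[of j i] by simp
    then show ?thesis using 1 by simp
  next
    case (2 j)
    then have "Suc j = i" using assms(2,3) k_less w_inj[of "Suc j" i] by simp
    then show ?thesis using 2 by auto
  qed
qed

lemma path02_at:
  assumes "q \<in> path02 Op P" "ta q = w i" "i \<le> n"
  shows "(k \<le> i \<and> i < n \<and> q = P ! i) \<or> (k < i \<and> q = e (P ! (i - 1)))"
proof -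
  consider j where "k \<le> j" "j < n" "q = P ! j" | j where "k \<le> j" "j < n" "q = e (P ! j)"
    using assms(1) unfolding path02_eq by (auto simp: image_iff)
  then show ?thesis
  proof cases
    case (1 j)
    then have "j = i" using assms(2,3) w_inj[of j i] by simp
    then show ?thesis using 1 by simp
  next
    case (2 j)
    then have "Suc j = i" using assms(2,3) w_inj[of "Suc j" i] by simp
    then show ?thesis using 2 by auto
  qed
qed

lemma path01_in: "i < k \<Longrightarrow> P ! i \<in> path01 Op P" "i < k \<Longrightarrow> e (P ! i) \<in> path01 Op P"
  unfolding path01_eq by blast+

lemma path02_in: "k \<le> i \<Longrightarrow> i < n \<Longrightarrow> P ! i \<in> path02 Op P" "k \<le> i \<Longrightarrow> i < n \<Longrightarrow> e (P ! i) \<in> path02 Op P"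
  unfolding path02_eq by auto

lemma k_minus_1: "Suc (k - 1) = k" "k - 1 < k" "k - 1 < n"
  using k_pos k_less by simp_all

text \<open>These evaluate the definite descriptions of \<open>path_rot\<close> at special vertices,
  which are ends of segments.\<close>

lemma the_path:
  "(THE q. q \<in> path01 Op P \<and> ta q = w 0) = P ! 0"
  "(THE q. q \<in> path01 Op P \<and> ta q = w k) = e (P ! (k - 1))"
  "(THE q. q \<in> path02 Op P \<and> ta q = w k) = P ! k"
  "(THE q. q \<in> path02 Op P \<and> ta q = w n) = e (P ! (n - 1))"
proof -
  show "(THE q. q \<in> path01 Op P \<and> ta q = w 0) = P ! 0"
  proof (rule the_equality)
    show "P ! 0 \<in> path01 Op P \<and> ta (P ! 0) = w 0"
      using path01_in(1)[of 0] k_pos P_nonempty(2) by simp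
    show "q = P ! 0" if "q \<in> path01 Op P \<and> ta q = w 0" for q
      using path01_at[of q 0] that by simp
  qed
  show "(THE q. q \<in> path01 Op P \<and> ta q = w k) = e (P ! (k - 1))"
  proof (rule the_equality)
    show "e (P ! (k - 1)) \<in> path01 Op P \<and> ta (e (P ! (k - 1))) = w k"
      using path01_in(2)[of "k - 1"] k_minus_1 by simp
    show "q = e (P ! (k - 1))" if "q \<in> path01 Op P \<and> ta q = w k" for q
      using path01_at[of q k] that k_less by simp
  qed
  show "(THE q. q \<in> path02 Op P \<and> ta q = w k) = P ! k"
  proof (rule the_equality)
    show "P ! k \<in> path02 Op P \<and> ta (P ! k) = w k"
      using path02_in(1)[of k] k_less by simp
    show "q = P ! k" if "q \<in> path02 Op P \<and> ta q = w k" for q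
      using path02_at[of q k] that k_less by simp
  qed
  show "(THE q. q \<in> path02 Op P \<and> ta q = w n) = e (P ! (n - 1))"
  proof (rule the_equality)
    show "e (P ! (n - 1)) \<in> path02 Op P \<and> ta (e (P ! (n - 1))) = w n"
      using path02_in(2)[of "n - 1"] k_less P_nonempty(2) by simp
    show "q = e (P ! (n - 1))" if "q \<in> path02 Op P \<and> ta q = w n" for q
      using path02_at[of q n] that by simp
  qed
qed

text \<open>The counterpart inside a segment, where exactly two of its arcs start and
  \<open>path_rot\<close> exchanges them.\<close>

lemma the_path_other:
  assumes i: "Suc i < n" and seg: "seg = path01 Op P \<and> Suc i < k \<or> seg = path02 Op P \<and> k < Suc i"
  shows "(THE q. q \<in> seg \<and> ta q = w (Suc i) \<and> q \<noteq> P ! Suc i) = e (P ! i)"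
    and "(THE q. q \<in> seg \<and> ta q = w (Suc i) \<and> q \<noteq> e (P ! i)) = P ! Suc i"
proof -
  have ne: "P ! Suc i \<noteq> e (P ! i)" using P_neq_opp[of "Suc i" i] i by simp
  have mem: "P ! Suc i \<in> seg" "e (P ! i) \<in> seg"
    using seg i path01_in[of i] path01_in[of "Suc i"] path02_in[of i] path02_in[of "Suc i"] by auto
  have at: "q = P ! Suc i \<or> q = e (P ! i)" if "q \<in> seg" "ta q = w (Suc i)" for q
    using seg path01_at[of q "Suc i"] path02_at[of q "Suc i"] that i by auto
  show "(THE q. q \<in> seg \<and> ta q = w (Suc i) \<and> q \<noteq> P ! Suc i) = e (P ! i)"
    using mem at i ne by (intro the_equality) (simp, blast)
  show "(THE q. q \<in> seg \<and> ta q = w (Suc i) \<and> q \<noteq> e (P ! i)) = P ! Suc i"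
    using mem at i ne by (intro the_equality) (simp, blast)
qed

lemma w_special: "i \<le> n \<Longrightarrow> w i \<in> special Op ` {0, 1, 2} \<longleftrightarrow> i = 0 \<or> i = k \<or> i = n"
  using w_eq_v0[of i] w_eq_v1[of i] w_eq_v2[of i] by auto

lemma w_special': "i \<le> n \<Longrightarrow> w i \<in> special Op ` {1, 2} \<longleftrightarrow> i = 0 \<or> i = n"
  using w_eq_v1[of i] w_eq_v2[of i] by auto

end

lemma orbit_image:
  assumes "x \<in> S" "\<And>y. y \<in> S \<Longrightarrow> f' y \<in> S" "\<And>y. y \<in> S \<Longrightarrow> f (g y) = g (f' y)"
  shows "orbit f (g x) = g ` orbit f' x"
proof -
  have pow: "(f' ^^ m) x \<in> S \<and> (f ^^ m) (g x) = g ((f' ^^ m) x)" for m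
    by (induction m) (use assms in auto)
  then show ?thesis unfolding orbit_altdef by auto
qed

context emb_map
begin

text \<open>A copy of the first part of the path, in \<open>VE d\<close>, separates the double
  chambers \<open>d\<close> and \<open>e d\<close>; one of the second part, in \<open>VF d\<close>,
  separates \<open>d\<close> and \<open>e (r d)\<close>. The first generator is \<open>True\<close>;
  as \<open>e\<close> is an involution, it serves for both signs.\<close>

definition dart_letter :: "bool \<times> bool \<Rightarrow> 'd \<Rightarrow> 'd" where
  "dart_letter x d = (if fst x then e d else if snd x then e (r d) else ri (e d))"

sublocale letter_action dart_letter A
  by standard (auto simp: dart_letter_def linv_def)

end

section \<open>The path system as double chambers paired with path arcs\<close>

locale apply_map = M: cut_map Op P + G: emb_map G
  for Op :: "('w, 'c) lopsp" and P :: "'c list" and G :: "('v, 'd) emb"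
begin

abbreviation "K \<equiv> path_system Op P G"
abbreviation "S \<equiv> M.S"
abbreviation "k \<equiv> M.k"
abbreviation "n \<equiv> length P"
abbreviation "nx \<equiv> M.nx"

text \<open>Going through the free group is what lets a gauge transformation found there act on
  double chambers; \<open>across_P\<close>, \<open>across_opp\<close> and \<open>across_off\<close>
  give the concrete permutations.\<close>

definition across :: "'c \<Rightarrow> 'd \<Rightarrow> 'd" where
  "across c = act G.dart_letter (M.nu (gen True) (gen False) c)"

lemma across_P: "i < n \<Longrightarrow> across (P ! i) d = (if i < k then G.e d else G.e (G.r d))"
  by (simp add: across_def M.nu_P G.act_gen G.dart_letter_def)

lemma across_opp: "i < n \<Longrightarrow> across (M.e (P ! i)) d = (if i < k then G.e d else G.ri (G.e d))"
  by (simp add: across_def M.nu_P G.act_uminus_gen G.dart_letter_def)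

lemma across_off: "c \<notin> S \<Longrightarrow> across c d = d"
  by (simp add: across_def M.nu_off)

lemma across_in [simp]: "d \<in> G.A \<Longrightarrow> across c d \<in> G.A"
  by (simp add: across_def G.act_closed)

lemma across_cancel: "c \<in> M.A \<Longrightarrow> d \<in> G.A \<Longrightarrow> across (M.e c) (across c d) = d"
proof -
  assume *: "c \<in> M.A" "d \<in> G.A"
  then have "M.nu (gen True) (gen False) (M.e c) = - M.nu (gen True) (gen False) c"
    using M.cochain_nu unfolding M.cochain_def by blast
  then show ?thesis unfolding across_def using *(2) by (simp add: G.act_uminus)
qed

text \<open>
  The boundary of the double chamber \<open>d\<close> of \<open>G\<close> consists, in this order, of copies of
  $P_{v_1,v_0}$ in \<open>VE d\<close>, of $P_{v_0,v_2}$ in \<open>VF d\<close>, of $P_{v_2,v_0}$ in \<open>VF (ri (opp G d))\<close>, and of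
  $P_{v_0,v_1}$ in \<open>VE (opp G d)\<close>; \<open>bcopy d c\<close> is the copy of \<open>c\<close> among them.
\<close>

definition bcopy :: "'d \<Rightarrow> 'c \<Rightarrow> 'd bdart \<times> 'c" where
  "bcopy d c =
     (if c \<in> (\<lambda>i. P ! i) ` {..<k} then VE d
      else if c \<in> (\<lambda>i. M.e (P ! i)) ` {..<k} then VE (G.e d)
      else if c \<in> (\<lambda>i. P ! i) ` {k..<n} then VF d
      else VF (G.ri (G.e d)), c)"

lemma snd_bd [simp]: "snd (bcopy d c) = c"
  by (simp add: bcopy_def)

lemma bcopy_P: "i < n \<Longrightarrow> bcopy d (P ! i) = (if i < k then VE d else VF d, P ! i)"
proof -
  assume i: "i < n"
  have 1: "P ! i \<in> (\<lambda>i. P ! i) ` {..<k} \<longleftrightarrow> i < k" "P ! i \<in> (\<lambda>i. P ! i) ` {k..<n} \<longleftrightarrow> k \<le> i"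
    using i M.k_less by (auto simp: M.P_inj)
  have 2: "P ! i \<notin> (\<lambda>i. M.e (P ! i)) ` {..<k}"
    using i M.k_less M.P_neq_opp by auto
  show ?thesis using 1 2 unfolding bcopy_def by (simp only: if_False) auto
qed

lemma bcopy_opp: "i < n \<Longrightarrow> bcopy d (M.e (P ! i)) = (if i < k then VE (G.e d) else VF (G.ri (G.e d)), M.e (P ! i))"
proof -
  assume i: "i < n"
  have neq: "M.e (P ! i) \<noteq> P ! j" if "j < n" for j
    using M.P_neq_opp[OF that i] by (rule not_sym)
  have 1: "M.e (P ! i) \<in> (\<lambda>i. M.e (P ! i)) ` {..<k} \<longleftrightarrow> i < k"
    using i M.k_less by (auto simp: M.oppP_inj)
  have 2: "M.e (P ! i) \<notin> (\<lambda>i. P ! i) ` J" if "J \<subseteq> {..<n}" for J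
    using neq that by blast
  have 3: "M.e (P ! i) \<notin> (\<lambda>i. P ! i) ` {..<k}" "M.e (P ! i) \<notin> (\<lambda>i. P ! i) ` {k..<n}"
    using M.k_less by (intro 2; force)+
  show ?thesis unfolding bcopy_def if_not_P[OF 3(1)] if_not_P[OF 3(2)] 1 by simp
qed

lemma segment_eq: "segment Op P G.DC (VE a) = path01 Op P" "segment Op P G.DC (VF a) = path02 Op P"
  by (simp_all add: segment_def)

lemma K_simps:
  "arcs (gr K) = (SIGMA h:VE ` G.A \<union> VF ` G.A. segment Op P G.DC h)"
  "tail (gr K) = (\<lambda>(h, p). path_pos Op G.DC h (M.ta p))"
  "opp K = (\<lambda>(h, p). (h, M.e p))"
  "rot K = path_rot Op P G.DC"
  "vtype K = path_typ Op G.DC"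
  unfolding path_system_def Let_def by (simp_all add: G.DC_starts)

lemma bcopy_cases:
  assumes "c \<in> S"
  obtains i where "i < k" "c = P ! i" "bcopy d c = (VE d, c)" "across c d = G.e d"
  | i where "k \<le> i" "i < n" "c = P ! i" "bcopy d c = (VF d, c)" "across c d = G.e (G.r d)"
  | i where "i < k" "c = M.e (P ! i)" "bcopy d c = (VE (G.e d), c)" "across c d = G.e d"
  | i where "k \<le> i" "i < n" "c = M.e (P ! i)" "bcopy d c = (VF (G.ri (G.e d)), c)" "across c d = G.ri (G.e d)"
  using assms
proof (cases rule: M.S_cases)
  case (1 i)
  then show thesis
    using that(1)[of i] that(2)[of i] bcopy_P[of i d] across_P[of i d] by (cases "i < k") auto
next
  case (2 i)
  then show thesis
    using that(3)[of i] that(4)[of i] bcopy_opp[of i d] across_opp[of i d] by (cases "i < k") auto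
qed

lemma bcopy_in_K:
  assumes "d \<in> G.A" "c \<in> S"
  shows "bcopy d c \<in> arcs (gr K)"
  using assms(2)
  by (cases rule: bcopy_cases[of c d])
     (use assms(1) M.path01_in M.path02_in in \<open>simp_all add: K_simps segment_eq\<close>)

lemma arcs_K: "arcs (gr K) = (\<lambda>(d, c). bcopy d c) ` (G.A \<times> S)"
proof (intro equalityI subsetI)
  fix x assume "x \<in> arcs (gr K)"
  then consider a p where "a \<in> G.A" "p \<in> path01 Op P" "x = (VE a, p)"
    | a p where "a \<in> G.A" "p \<in> path02 Op P" "x = (VF a, p)"
    by (auto simp: K_simps segment_eq)
  then obtain d c where "d \<in> G.A" "c \<in> S" "x = bcopy d c"
  proof cases
    case (1 a p)
    then consider i where "i < k" "p = P ! i" | i where "i < k" "p = M.e (P ! i)"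
      unfolding M.path01_eq by blast
    then show thesis
    proof cases
      case (1 i)
      then show thesis using that[of a p] \<open>a \<in> G.A\<close> \<open>x = (VE a, p)\<close> M.k_less by (simp add: bcopy_P)
    next
      case (2 i)
      then show thesis using that[of "G.e a" p] \<open>a \<in> G.A\<close> \<open>x = (VE a, p)\<close> M.k_less by (simp add: bcopy_opp)
    qed
  next
    case (2 a p)
    then consider i where "k \<le> i" "i < n" "p = P ! i" | i where "k \<le> i" "i < n" "p = M.e (P ! i)"
      unfolding M.path02_eq by (auto simp: image_iff)
    then show thesis
    proof cases
      case (1 i)
      then show thesis using that[of a p] \<open>a \<in> G.A\<close> \<open>x = (VF a, p)\<close> by (simp add: bcopy_P)
    next
      case (2 i)
      \<comment> \<open>The double chamber on the other side of \<open>VF a\<close>: applying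
        \<open>ri \<circ> e\<close> to \<open>e (r a)\<close> gives back \<open>a\<close>.\<close>
      then show thesis
        using that[of "G.e (G.r a)" p] \<open>a \<in> G.A\<close> \<open>x = (VF a, p)\<close> by (simp add: bcopy_opp)
    qed
  qed
  then show "x \<in> (\<lambda>(d, c). bcopy d c) ` (G.A \<times> S)" by (intro image_eqI[of _ _ "(d, c)"]) simp_all
qed (use bcopy_in_K in auto)

lemma bcopy_eq_iff:
  assumes "d \<in> G.A" "d' \<in> G.A" "c \<in> S"
  shows "bcopy d c = bcopy d' c' \<longleftrightarrow> d = d' \<and> c = c'"
proof
  assume eq: "bcopy d c = bcopy d' c'"
  then have c: "c' = c" by (metis snd_bd)
  have 1: "d = d'" if "G.e d = G.e d'" using that assms G.opp_eq_iff by blast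
  have 2: "G.e d = G.e d'" if "G.ri (G.e d) = G.ri (G.e d')"
    using that assms G.rot_ri G.opp_in by metis
  show "d = d' \<and> c = c'"
    using assms(3)
  proof (cases rule: M.S_cases)
    case (1 i)
    then show ?thesis using eq c by (auto simp: bcopy_P split: if_splits)
  next
    case (2 i)
    then have "G.e d = G.e d' \<or> G.ri (G.e d) = G.ri (G.e d')"
      using eq c by (auto simp: bcopy_opp split: if_splits)
    then show ?thesis using \<open>G.e d = G.e d' \<Longrightarrow> d = d'\<close> \<open>G.ri (G.e d) = G.ri (G.e d') \<Longrightarrow> G.e d = G.e d'\<close> c by blast
  qed
qed simp

text \<open>This ties the algebraic \<open>across\<close> to the geometry: both sides of a boundary
  edge carry the same piece of path, in opposite directions.\<close>

lemma opp_K: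
  assumes "d \<in> G.A" "c \<in> S"
  shows "opp K (bcopy d c) = bcopy (across c d) (M.e c)"
  using assms(2)
proof (cases rule: M.S_cases)
  case (1 i)
  then show ?thesis using assms(1) by (simp add: bcopy_P bcopy_opp across_P K_simps)
next
  case (2 i)
  then show ?thesis using assms(1) by (simp add: bcopy_P bcopy_opp across_opp K_simps)
qed

lemma path_rot_special:
  assumes "M.ta p = M.w i" "i = 0 \<or> i = k \<or> i = n"
  shows "path_rot Op P G.DC (h, p) =
    (let h' = (if i = k then next_in (bary_rot G) G.dc_arcs h
        else bary_opp (next_in (bary_rot G) G.dc_arcs (bary_opp h)))
     in (h', THE q. q \<in> segment Op P G.DC h' \<and> M.ta q = M.w i))"
proof -
  have i: "i \<le> n" using assms(2) M.k_less by auto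
  then have "M.w i \<in> special Op ` {0, 1, 2}" using assms(2) M.w_special by blast
  then show ?thesis
    unfolding path_rot_def split assms(1) G.DC_simps M.w_eq_v0[OF i] by (simp only: if_True)
qed

lemma path_rot_inner:
  assumes "M.ta p = M.w i" "i < n" "i \<noteq> 0" "i \<noteq> k"
  shows "path_rot Op P G.DC (h, p) =
    (h, THE q. q \<in> segment Op P G.DC h \<and> M.ta q = M.w i \<and> q \<noteq> p)"
proof -
  have "M.w i \<notin> special Op ` {0, 1, 2}" using assms M.w_special[of i] by simp
  then show ?thesis
    unfolding path_rot_def split assms(1) by (simp only: if_False)
qed

text \<open>Between an arc and its clockwise successor lies the double chamber on the right of the
  arc. The cases are the ends \<open>v1\<close> and \<open>v2\<close>, the vertex \<open>v0\<close>,
  and inner vertices of either segment, as in \<open>path_rot\<close>.\<close>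

lemma rot_K:
  assumes "d \<in> G.A" "c \<in> S"
  shows "rot K (bcopy d c) = bcopy (across c d) (nx c)"
  using assms(2)
proof (cases rule: M.S_cases)
  case (1 i)
  consider "i = 0" | j where "i = Suc j" "i < k" | j where "i = Suc j" "i = k"
    | j where "i = Suc j" "k < i" "k \<le> j"
    by (cases i; cases "i < k"; cases "i = k") auto
  then show ?thesis
  proof cases
    case 1
    have "path_rot Op P G.DC (VE d, P ! 0) = (VE (G.e d), P ! 0)"
      using M.P_nonempty M.k_pos assms(1) M.the_path(1)
      by (simp add: path_rot_special[of _ 0] G.rot_DC segment_eq Let_def)
    then show ?thesis
      using 1 \<open>c = P ! i\<close> M.P_nonempty M.k_pos M.nx_first by (simp add: bcopy_P across_P K_simps)
  next
    case (2 j)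
    have "path_rot Op P G.DC (VE d, P ! Suc j) = (VE d, M.e (P ! j))"
      using 2 \<open>i < n\<close> M.the_path_other(1)[of j "path01 Op P"]
      by (simp add: path_rot_inner[of _ "Suc j"] segment_eq)
    then show ?thesis
      using 2 \<open>c = P ! i\<close> \<open>i < n\<close> assms(1) by (simp add: bcopy_P bcopy_opp across_P K_simps M.nx_Suc)
  next
    case (3 j)
    have "path_rot Op P G.DC (VF d, P ! k) = (VE (G.r d), M.e (P ! (k - 1)))"
      using M.k_less assms(1) M.the_path(2)
      by (simp add: path_rot_special[of _ k] G.rot_DC segment_eq Let_def)
    then show ?thesis
      using 3 \<open>c = P ! i\<close> \<open>i < n\<close> assms(1) M.nx_Suc[of j] by (simp add: bcopy_P bcopy_opp across_P K_simps)
  next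
    case (4 j)
    have "path_rot Op P G.DC (VF d, P ! Suc j) = (VF d, M.e (P ! j))"
      using 4 \<open>i < n\<close> M.the_path_other(1)[of j "path02 Op P"]
      by (simp add: path_rot_inner[of _ "Suc j"] segment_eq)
    then show ?thesis
      using 4 \<open>c = P ! i\<close> \<open>i < n\<close> assms(1) by (simp add: bcopy_P bcopy_opp across_P K_simps M.nx_Suc)
  qed
next
  case (2 i)
  consider "Suc i < k" | "Suc i = k" | "k \<le> i" "Suc i < n" | "Suc i = n"
    using 2(1) by linarith
  then show ?thesis
  proof cases
    case 1
    then have *: "Suc i < n" using M.k_less by simp
    have "path_rot Op P G.DC (VE (G.e d), M.e (P ! i)) = (VE (G.e d), P ! Suc i)"
      using 1 * M.the_path_other(2)[of i "path01 Op P"]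
      by (simp add: path_rot_inner[of _ "Suc i"] segment_eq)
    then show ?thesis
      using 1 * 2 by (simp add: bcopy_P bcopy_opp across_opp K_simps M.nx_opp)
  next
    case c2: 2
    then have *: "Suc i < n" using M.k_less by simp
    have "path_rot Op P G.DC (VE (G.e d), M.e (P ! i)) = (VF (G.e d), P ! k)"
      using c2 * assms(1) M.the_path(3)
      by (simp add: path_rot_special[of _ k] G.rot_DC segment_eq Let_def)
    then show ?thesis
      using c2 * 2 by (simp add: bcopy_P bcopy_opp across_opp K_simps M.nx_opp)
  next
    case 3
    have "path_rot Op P G.DC (VF (G.ri (G.e d)), M.e (P ! i)) = (VF (G.ri (G.e d)), P ! Suc i)"
      using 3 M.the_path_other(2)[of i "path02 Op P"]
      by (simp add: path_rot_inner[of _ "Suc i"] segment_eq)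
    then show ?thesis
      using 3 2 by (simp add: bcopy_P bcopy_opp across_opp K_simps M.nx_opp)
  next
    case 4
    then have i: "i = n - 1" by simp
    have "\<not> i < k" "n \<noteq> k" using 4 M.k_less by simp_all
    have "path_rot Op P G.DC (VF a, M.e (P ! (n - 1))) = (VF (G.ri (G.e a)), M.e (P ! (n - 1)))"
      if "a \<in> G.A" for a
      using \<open>n \<noteq> k\<close> M.P_nonempty that M.the_path(4)
      by (simp add: path_rot_special[of _ n] G.rot_DC segment_eq Let_def)
    then show ?thesis
      using \<open>\<not> i < k\<close> 2 assms(1) M.nx_last unfolding i by (simp add: bcopy_opp across_opp K_simps)
  qed
qed

text \<open>Reversal leaves the double chamber and rotation re-enters it
  (\<open>across_cancel\<close>), so the facial walk stays in \<open>d\<close> and runs through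
  \<open>S\<close> as the single face of the path does.\<close>

lemma face_K:
  assumes "d \<in> G.A" "c \<in> S"
  shows "face_of K (bcopy d c) = bcopy d ` S"
proof -
  have "rot K (opp K (bcopy d b)) = bcopy d (nx (M.e b))" if "b \<in> S" for b
    using that assms(1) M.arc_symD(2)[OF M.arc_sym_S that] M.S_in_A[OF that]
    by (simp add: opp_K rot_K across_cancel)
  moreover have "nx (M.e b) \<in> S" if "b \<in> S" for b
    using M.orbit_boundary[OF that] orbit.base[of "\<lambda>b. nx (M.e b)" b] by simp
  ultimately show ?thesis
    unfolding face_of_def using orbit_image[of c S "\<lambda>b. nx (M.e b)" _ "bcopy d"] assms(2)
    by (simp add: M.orbit_boundary)
qed

lemma tail_K_P:
  assumes "i < n" "d \<in> G.A"
  shows "tail (gr K) (bcopy d (P ! i)) =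
    (if i = 0 then Old (BE {d, G.e d}) else if i < k then Mid (VE d) (M.w i)
     else if i = k then Old (BV (G.ta d)) else Mid (VF d) (M.w i))"
  using assms M.k_pos M.w_eq_v0[of i] M.w_special'[of i] M.w_special'[of 0] M.tail_P[of 0] M.P_nonempty(2)
  by (simp add: bcopy_P K_simps path_pos_def del: image_insert)

lemma tail_K_opp:
  assumes "i < n" "d \<in> G.A"
  shows "tail (gr K) (bcopy d (M.e (P ! i))) =
    (if Suc i < k then Mid (VE (G.e d)) (M.w (Suc i)) else if Suc i = k then Old (BV (G.ta (G.e d)))
     else if Suc i < n then Mid (VF (G.ri (G.e d))) (M.w (Suc i)) else Old (BF (face_of G (G.e d))))"
  using assms M.k_less M.w_eq_v0[of "Suc i"] M.w_special'[of "Suc i"]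
  by (simp add: bcopy_opp K_simps path_pos_def del: image_insert)

end

section \<open>The glued graph: arcs as pairs, vertices as classes under rotation\<close>

context apply_map
begin

definition chamber :: "'d \<Rightarrow> ('d bdart \<times> 'c) set" where
  "chamber d = bcopy d ` S"

lemma faces_K: "faces K = chamber ` G.A"
proof -
  have P0: "P ! 0 \<in> S" using M.P_nonempty by simp
  show ?thesis
  proof (intro equalityI subsetI)
    fix f assume "f \<in> faces K"
    then obtain d c where "d \<in> G.A" "c \<in> S" "f = face_of K (bcopy d c)"
      unfolding faces_def arcs_K by auto
    then show "f \<in> chamber ` G.A" by (simp add: face_K chamber_def)
  next
    fix f assume "f \<in> chamber ` G.A"
    then obtain d where d: "d \<in> G.A" "f = chamber d" by blast
    then have "f = face_of K (bcopy d (P ! 0))" using P0 by (simp add: face_K chamber_def)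
    then show "f \<in> faces K" unfolding faces_def using bcopy_in_K[OF d(1) P0] by simp
  qed
qed

lemma chamber_inj: "d \<in> G.A \<Longrightarrow> d' \<in> G.A \<Longrightarrow> chamber d = chamber d' \<longleftrightarrow> d = d'"
proof
  assume d: "d \<in> G.A" "d' \<in> G.A" "chamber d = chamber d'"
  have P0: "P ! 0 \<in> S" using M.P_nonempty by simp
  then have "bcopy d (P ! 0) \<in> chamber d" unfolding chamber_def by (rule imageI)
  then have "bcopy d (P ! 0) \<in> chamber d'" by (simp only: d(3))
  then obtain c where "bcopy d (P ! 0) = bcopy d' c" unfolding chamber_def by blast
  then show "d = d'" using bcopy_eq_iff[OF d(1,2) P0] by simp
qed simp

lemma boundary_dart_chamber: "c \<in> S \<Longrightarrow> boundary_dart (chamber d) c = bcopy d c"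
  unfolding boundary_dart_def chamber_def by (rule the_equality) auto

text \<open>The index \<open>d\<close> is always the double chamber on the left, which singles out
  one of the two patches that share a boundary arc.\<close>

definition copy :: "'d \<Rightarrow> 'c \<Rightarrow> ('d bdart \<times> 'c, ('d bdart \<times> 'c) set, 'c) glue_dart" where
  "copy d c = (if c \<in> S then BoundaryDart (bcopy d c) else FaceDart (chamber d) c)"

abbreviation "GL \<equiv> apply_lopsp Op P G"

lemma patch_simps:
  "arcs (gr (patch Op P)) = Uncut ` (M.A - S) \<union> Inner ` S \<union> Outer ` S"
  "verts (gr (patch Op P)) = Interior ` (M.V - M.ta ` S) \<union> Corner ` S"
  "tail (gr (patch Op P)) = patch_tail Op S"
  "rot (patch Op P) = patch_rot Op S"
  "vtype (patch Op P) = patch_typ Op"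
  by (simp_all add: patch_def M.S_def Let_def)

lemma GL_simps:
  "arcs (gr GL) = (\<Union>f\<in>faces K. put_dart Op K f ` arcs (gr (patch Op P)))"
  "verts (gr GL) = (\<Union>f\<in>faces K. put_vert K f ` verts (gr (patch Op P)))"
  "tail (gr GL) = glue_tail Op P K"
  "head (gr GL) = (\<lambda>x. glue_tail Op P K (glue_opp Op K x))"
  "opp GL = glue_opp Op K"
  "rot GL = glue_rot Op P K"
  "vtype GL = glue_typ Op P K"
  by (simp_all add: apply_lopsp_def Let_def)

lemma copy_Uncut: "c \<notin> S \<Longrightarrow> put_dart Op K (chamber d) (Uncut c) = copy d c"
  by (simp add: copy_def)

lemma copy_Inner: "c \<in> S \<Longrightarrow> put_dart Op K (chamber d) (Inner c) = copy d c"
  by (simp add: copy_def boundary_dart_chamber)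

text \<open>An outer copy has the patch on its right, so the double chamber on its left is the
  neighbour across the edge.\<close>

lemma copy_Outer:
  assumes "d \<in> G.A" "c \<in> S"
  shows "put_dart Op K (chamber d) (Outer c) = copy (across (M.e c) d) c"
  using assms M.arc_symD(2)[OF M.arc_sym_S assms(2)] M.S_in_A[OF assms(2)]
  by (simp add: copy_def boundary_dart_chamber opp_K)

lemma copy_in: "d \<in> G.A \<Longrightarrow> c \<in> M.A \<Longrightarrow> copy d c \<in> arcs (gr GL)"
proof -
  assume d: "d \<in> G.A" and c: "c \<in> M.A"
  have "copy d c \<in> put_dart Op K (chamber d) ` arcs (gr (patch Op P))"
  proof (cases "c \<in> S")
    case True
    then show ?thesis unfolding copy_Inner[OF True, symmetric] by (intro imageI) (simp add: patch_simps)
  next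
    case False
    then show ?thesis unfolding copy_Uncut[OF False, symmetric] using c by (intro imageI) (simp add: patch_simps)
  qed
  then show ?thesis unfolding GL_simps faces_K using d by blast
qed

lemma arcs_GL: "arcs (gr GL) = (\<lambda>(d, c). copy d c) ` (G.A \<times> M.A)"
proof (intro equalityI subsetI)
  fix x assume "x \<in> arcs (gr GL)"
  then obtain d y where d: "d \<in> G.A" and y: "y \<in> arcs (gr (patch Op P))" "x = put_dart Op K (chamber d) y"
    unfolding GL_simps faces_K by blast
  have "\<exists>d'\<in>G.A. \<exists>c\<in>M.A. x = copy d' c"
  proof -
    consider c where "c \<in> M.A - S" "y = Uncut c" | c where "c \<in> S" "y = Inner c"
      | c where "c \<in> S" "y = Outer c"
      using y(1) unfolding patch_simps by blast
    then show ?thesis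
    proof cases
      case (1 c)
      then show ?thesis using copy_Uncut[of c d] y(2) d by blast
    next
      case (2 c)
      then show ?thesis using copy_Inner[of c d] y(2) d M.S_in_A by blast
    next
      case (3 c)
      then show ?thesis using copy_Outer[OF d, of c] y(2) across_in[OF d, of "M.e c"] M.S_in_A by blast
    qed
  qed
  then show "x \<in> (\<lambda>(d, c). copy d c) ` (G.A \<times> M.A)" by fast
qed (use copy_in in auto)

lemma copy_eq_iff:
  assumes "d \<in> G.A" "d' \<in> G.A"
  shows "copy d c = copy d' c' \<longleftrightarrow> d = d' \<and> c = c'"
  using bcopy_eq_iff[OF assms, of c c'] chamber_inj[OF assms] snd_bd[of d c] snd_bd[of d' c']
  by (auto simp: copy_def)

lemma bij_betw_copy: "bij_betw (\<lambda>(d, c). copy d c) (G.A \<times> M.A) (arcs (gr GL))"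
  unfolding arcs_GL by (intro inj_on_imp_bij_betw inj_onI) (auto simp: copy_eq_iff)

text \<open>Together with \<open>rot_GL\<close> this expresses the arc structure of the glued graph
  by the operation and \<open>across\<close>, hence by the cochain.\<close>

lemma opp_GL:
  assumes "d \<in> G.A" "c \<in> M.A"
  shows "opp GL (copy d c) = copy (across c d) (M.e c)"
  using assms M.arc_sym_opp_iff[OF M.arc_sym_S assms(2)]
  by (simp add: GL_simps copy_def opp_K across_off)

lemma put_rot:
  assumes "d \<in> G.A"
  shows "put_dart Op K (chamber d) (if M.r c \<in> S then Inner (M.r c) else Uncut (M.r c)) = copy d (M.r c)"
  using copy_Inner copy_Uncut by simp

text \<open>Turning clockwise passes to the right side of \<open>c\<close>, which then is the left
  side of the next arc; so the double chamber shifts exactly as for reversal.\<close>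

lemma rot_GL:
  assumes "d \<in> G.A" "c \<in> M.A"
  shows "rot GL (copy d c) = copy (across c d) (M.r c)"
proof (cases "c \<in> S")
  case True
  have "face_of K (opp K (bcopy d c)) = chamber (across c d)"
    using assms True M.arc_symD(2)[OF M.arc_sym_S True] by (simp add: opp_K face_K chamber_def)
  then have "rot GL (copy d c) = put_dart Op K (chamber (across c d)) (patch_rot Op S (Outer c))"
    using True by (simp add: GL_simps copy_def patch_simps)
  then show ?thesis
    unfolding patch_rot.simps put_rot[OF across_in[OF assms(1)]] .
next
  case False
  then have "rot GL (copy d c) = put_dart Op K (chamber d) (patch_rot Op S (Uncut c))"
    by (simp add: GL_simps copy_def patch_simps)
  then show ?thesis
    unfolding patch_rot.simps put_rot[OF assms(1)] across_off[OF False] .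
qed

lemma head_GL: "head (gr GL) x = tail (gr GL) (opp GL x)"
  by (simp add: GL_simps)

definition copy_tail :: "'d \<Rightarrow> 'c \<Rightarrow> ((('v, 'd) bvert, 'd bdart, 'w) path_vert, ('d bdart \<times> 'c) set, 'w) glue_vert" where
  "copy_tail d c = tail (gr GL) (copy d c)"

lemma copy_tail_S: "c \<in> S \<Longrightarrow> copy_tail d c = OnBoundary (tail (gr K) (bcopy d c))"
  by (simp add: copy_tail_def GL_simps copy_def)

lemma copy_tail_on:
  assumes "c \<in> M.A" "M.ta c \<in> M.ta ` S" "c \<notin> S"
  shows "copy_tail d c = OnBoundary (tail (gr K) (bcopy d (nx c)))"
  using assms M.nx_in_S[OF assms(1,2)]
  by (simp add: copy_tail_def GL_simps copy_def patch_simps boundary_dart_chamber)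

lemma copy_tail_off:
  assumes "M.ta c \<notin> M.ta ` S"
  shows "copy_tail d c = InFace (chamber d) (M.ta c)"
proof -
  have "c \<notin> S" using assms by blast
  then show ?thesis using assms by (simp add: copy_tail_def GL_simps copy_def patch_simps)
qed

lemma verts_GL: "verts (gr GL) = (\<lambda>(d, c). copy_tail d c) ` (G.A \<times> M.A)"
proof (intro equalityI subsetI)
  fix v assume "v \<in> verts (gr GL)"
  then obtain d y where d: "d \<in> G.A" and y: "y \<in> verts (gr (patch Op P))" "v = put_vert K (chamber d) y"
    unfolding GL_simps faces_K by blast
  have "\<exists>c\<in>M.A. v = copy_tail d c"
  proof -
    consider w where "w \<in> M.V" "w \<notin> M.ta ` S" "y = Interior w" | c where "c \<in> S" "y = Corner c"
      using y(1) unfolding patch_simps by blast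
    then show ?thesis
    proof cases
      case (1 w)
      then obtain c where "c \<in> M.A" "M.ta c = w" using M.ex_out_arc by blast
      then show ?thesis using 1 y(2) copy_tail_off[of c d] by (intro bexI[of _ c]) simp_all
    next
      case (2 c)
      then show ?thesis
        using y(2) M.S_in_A by (intro bexI[of _ c]) (simp_all add: copy_tail_S boundary_dart_chamber)
    qed
  qed
  then show "v \<in> (\<lambda>(d, c). copy_tail d c) ` (G.A \<times> M.A)" using d by fast
next
  fix v assume "v \<in> (\<lambda>(d, c). copy_tail d c) ` (G.A \<times> M.A)"
  then obtain d c where d: "d \<in> G.A" and c: "c \<in> M.A" and v: "v = copy_tail d c" by auto
  have "v \<in> put_vert K (chamber d) ` verts (gr (patch Op P))"
  proof (cases "M.ta c \<in> M.ta ` S")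
    case False
    have v': "v = put_vert K (chamber d) (Interior (M.ta c))" using v copy_tail_off[OF False] by simp
    show ?thesis unfolding v' patch_simps using False c by (intro imageI) simp
  next
    case True
    define b where "b = (if c \<in> S then c else nx c)"
    have b: "b \<in> S" using M.nx_in_S[OF c True] by (simp add: b_def)
    then have v': "v = put_vert K (chamber d) (Corner b)"
      using v copy_tail_S[of c d] copy_tail_on[OF c True] by (simp add: b_def boundary_dart_chamber split: if_splits)
    show ?thesis unfolding v' patch_simps using b by (intro imageI) simp
  qed
  then show "v \<in> verts (gr GL)" unfolding GL_simps faces_K using d by blast
qed

lemma path_typ_tail_K:
  assumes "c \<in> S" "d \<in> G.A"
  shows "path_typ Op G.DC (tail (gr K) (bcopy d c)) = vtype Op (M.ta c)"
  using assms(1)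
proof (cases rule: M.S_cases)
  case (1 i)
  then show ?thesis using assms(2) M.w_0 M.w_k by (simp add: tail_K_P)
next
  case (2 i)
  then have "Suc i < n \<or> Suc i = n" by linarith
  then show ?thesis using 2 assms(2) M.w_n M.w_k M.k_less by (auto simp: tail_K_opp)
qed

lemma vtype_GL:
  assumes "d \<in> G.A" "c \<in> M.A"
  shows "vtype GL (copy_tail d c) = vtype Op (M.ta c)"
proof (cases "M.ta c \<in> M.ta ` S")
  case False
  then show ?thesis by (simp add: copy_tail_off GL_simps patch_simps)
next
  case True
  show ?thesis
  proof (cases "c \<in> S")
    case True
    then show ?thesis using assms(1) by (simp add: copy_tail_S GL_simps path_typ_tail_K K_simps(5))
  next
    case False
    then show ?thesis
      using assms True M.nx_in_S[OF assms(2) True] M.tail_nx[OF assms(2) True]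
      by (simp add: copy_tail_on GL_simps path_typ_tail_K K_simps(5))
  qed
qed

lemma tail_K_rot:
  assumes "c \<in> S" "d \<in> G.A"
  shows "tail (gr K) (bcopy (across c d) (nx c)) = tail (gr K) (bcopy d c)"
  using assms(1)
proof (cases rule: M.S_cases)
  case (1 i)
  show ?thesis
  proof (cases i)
    case 0
    then show ?thesis
      using 1 assms(2) M.k_pos M.P_nonempty
      by (simp add: tail_K_P across_P M.nx_first insert_commute)
  next
    case (Suc j)
    then show ?thesis
      using 1 assms(2) by (simp add: tail_K_P tail_K_opp across_P M.nx_Suc)
  qed
next
  case (2 i)
  then consider "Suc i < n" | "i = n - 1" "\<not> i < k" "Suc i = n" using M.k_less by linarith
  then show ?thesis
  proof cases
    case 1
    then show ?thesis using 2 assms(2) by (auto simp: tail_K_P tail_K_opp across_opp M.nx_opp)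
  next
    case n: 2
    \<comment> \<open>Rotation around a 2-vertex goes back one step along the facial walk of
      \<open>G\<close>, hence stays in the same face.\<close>
    have "G.phi (G.e (G.ri (G.e d))) = G.e d" using assms(2) by simp
    then have "face_of G (G.e (G.ri (G.e d))) = face_of G (G.e d)"
      using G.face_of_phi[of "G.e (G.ri (G.e d))"] assms(2) by simp
    moreover have "nx c = c" using 2 n M.nx_last by simp
    ultimately show ?thesis using 2 n assms(2) by (simp add: tail_K_opp across_opp)
  qed
qed

lemma copy_tail_rot:
  assumes "d \<in> G.A" "c \<in> M.A"
  shows "copy_tail (across c d) (M.r c) = copy_tail d c"
proof (cases "M.ta c \<in> M.ta ` S")
  case False
  then have "c \<notin> S" by blast
  then show ?thesis using False assms by (simp add: copy_tail_off across_off)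
next
  case True
  have *: "copy_tail b (M.r c) = OnBoundary (tail (gr K) (bcopy b (nx c)))" for b
  proof (cases "M.r c \<in> S")
    case True
    then show ?thesis by (simp add: copy_tail_S next_in_step)
  next
    case False
    then show ?thesis
      using True assms M.nx_rot[OF assms(2) True False] by (simp add: copy_tail_on)
  qed
  show ?thesis
  proof (cases "c \<in> S")
    case True
    then show ?thesis using assms by (simp add: * tail_K_rot copy_tail_S)
  next
    case False
    then show ?thesis using assms True by (simp add: * copy_tail_on across_off)
  qed
qed

text \<open>Its classes are the vertices of the glued graph, by \<open>copy_tail_rot\<close> and
  \<open>copy_tail_related\<close>. In contrast to the names of vertices, it refers to the cut-path
  through \<open>across\<close> only.\<close>

definition rot_rel :: "(('d \<times> 'c) \<times> ('d \<times> 'c)) set" where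
  "rot_rel = {((d, c), (across c d, M.r c)) | d c. d \<in> G.A \<and> c \<in> M.A}"

lemma rot_rel_step: "d \<in> G.A \<Longrightarrow> c \<in> M.A \<Longrightarrow> ((d, c), (across c d, M.r c)) \<in> cc rot_rel"
  by (rule cc_base) (auto simp: rot_rel_def)

text \<open>Strictly between \<open>c\<close> and \<open>nx c\<close> no path arc is crossed, so the
  double chamber can change at the first step only.\<close>

lemma rot_rel_nx:
  assumes "d \<in> G.A" "c \<in> M.A" "M.ta c \<in> M.ta ` S"
  shows "((d, c), (across c d, nx c)) \<in> cc rot_rel"
proof -
  obtain m where "0 < m" "(M.r ^^ m) c \<in> S" using M.ex_rot_S[OF assms(2,3)] by blast
  then obtain l where l: "0 < l" "nx c = (M.r ^^ l) c"
    "\<And>j. 0 < j \<Longrightarrow> j < l \<Longrightarrow> (M.r ^^ j) c \<notin> S"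
    using next_inE by metis
  have "Suc j \<le> l \<Longrightarrow> ((d, c), (across c d, (M.r ^^ Suc j) c)) \<in> cc rot_rel" for j
  proof (induction j)
    case 0
    show ?case using rot_rel_step[OF assms(1,2)] by simp
  next
    case (Suc j)
    have "across ((M.r ^^ Suc j) c) (across c d) = across c d"
      using l(3)[of "Suc j"] Suc.prems by (intro across_off) simp
    then have step: "((across c d, (M.r ^^ Suc j) c), (across c d, (M.r ^^ Suc (Suc j)) c)) \<in> cc rot_rel"
      using rot_rel_step[OF across_in[OF assms(1)] M.rot_funpow_in[OF assms(2)], of c "Suc j"] by simp
    show ?case using Suc by (intro cc_trans[OF _ step]) simp
  qed
  from this[of "l - 1"] show ?thesis using l by simp
qed

lemma rot_rel_S:
  "d \<in> G.A \<Longrightarrow> c \<in> S \<Longrightarrow> ((d, c), (across c d, nx c)) \<in> cc rot_rel"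
  using M.S_in_A by (intro rot_rel_nx) auto

text \<open>At a path vertex other than \<open>v2\<close>, one turn leads from a backward arc to the
  forward one. At \<open>v2\<close> no forward arc starts, which explains the exceptional
  representative.\<close>

lemma normal_dart:
  assumes "d \<in> G.A" "c \<in> S"
  obtains d' c' where "d' \<in> G.A" "((d, c), (d', c')) \<in> cc rot_rel"
    "tail (gr K) (bcopy d c) = tail (gr K) (bcopy d' c')" "c' = M.e (P ! (n - 1)) \<or> (\<exists>i<n. c' = P ! i)"
  using assms(2)
proof (cases rule: M.S_cases)
  case (1 i)
  then show thesis using that[of d c] assms(1) by auto
next
  case (2 i)
  show thesis
  proof (cases "Suc i < n")
    case True
    then have "nx c = P ! Suc i" using 2 M.nx_opp by simp
    then show thesis
      using that[of "across c d" "nx c"] assms(1) rot_rel_S[OF assms] tail_K_rot[OF assms(2,1)] True by auto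
  next
    case False
    then have "i = n - 1" using 2 by simp
    then show thesis using that[of d c] assms(1) 2 by auto
  qed
qed

text \<open>Boundary vertices come from faces of \<open>G\<close> (at \<open>v2\<close>), edges of
  \<open>G\<close> (at \<open>v1\<close>), vertices of \<open>G\<close> (at \<open>v0\<close>), or
  lie inside a copy of a segment. The rotation there follows a facial walk, swaps the two directions
  of an edge, or follows the rotation of \<open>G\<close>; inside a segment the normal form already
  fixes the pair.\<close>

lemma normal_darts_related:
  assumes d: "d \<in> G.A" "d' \<in> G.A"
    and c: "c = M.e (P ! (n - 1)) \<or> (\<exists>i<n. c = P ! i)" and c': "c' = M.e (P ! (n - 1)) \<or> (\<exists>i<n. c' = P ! i)"
    and eq: "tail (gr K) (bcopy d c) = tail (gr K) (bcopy d' c')"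
  shows "((d, c), (d', c')) \<in> cc rot_rel"
proof -
  have n: "Suc (n - 1) = n" "n - 1 < n" "\<not> n - 1 < k" using M.k_less by simp_all
  let ?l = "M.e (P ! (n - 1))"
  have l: "tail (gr K) (bcopy b ?l) = Old (BF (face_of G (G.e b)))" if "b \<in> G.A" for b
    using tail_K_opp[OF n(2) that] n M.k_less by simp
  have lS: "?l \<in> S" using n by simp
  have PS: "P ! i \<in> S" if "i < n" for i using that by simp
  consider (ll) "c = ?l" "c' = ?l" | (pl) i where "i < n" "c = P ! i" "c' = ?l"
    | (lp) i where "i < n" "c = ?l" "c' = P ! i" | (pp) i j where "i < n" "j < n" "c = P ! i" "c' = P ! j"
    using c c' by blast
  then show ?thesis
  proof cases
    case ll
    then have "face_of G (G.e d) = face_of G (G.e d')" using eq l d by simp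
    then have "G.e d' \<in> orbit G.phi (G.e d)" using G.face_of_eq_iff d by simp
    \<comment> \<open>Each step along the facial walk is a rotation step at \<open>v2\<close> read
      backwards, which is why \<open>cc_sym\<close> is used below.\<close>
    then have "G.e d' \<in> G.A \<and> ((d, ?l), (G.e (G.e d'), ?l)) \<in> cc rot_rel"
    proof induction
      case base
      have "((G.e (G.r d), ?l), (across ?l (G.e (G.r d)), nx ?l)) \<in> cc rot_rel"
        using d(1) lS by (intro rot_rel_S) simp_all
      then have "((G.e (G.r d), ?l), (d, ?l)) \<in> cc rot_rel"
        using d(1) n M.nx_last across_opp[OF n(2), of "G.e (G.r d)"] by simp
      then show ?case using d(1) by (simp add: cc_sym)
    next
      case (step a)
      then have a: "a \<in> G.A" "((d, ?l), (G.e a, ?l)) \<in> cc rot_rel" by simp_all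
      have "((G.e (G.phi a), ?l), (across ?l (G.e (G.phi a)), nx ?l)) \<in> cc rot_rel"
        using a(1) lS by (intro rot_rel_S) simp_all
      then have "((G.e (G.phi a), ?l), (G.e a, ?l)) \<in> cc rot_rel"
        using a(1) n M.nx_last across_opp[OF n(2), of "G.e (G.phi a)"] by (simp add: G.phi_def)
      then show ?case using cc_trans[OF a(2) cc_sym] a(1) by simp
    qed
    then show ?thesis using ll d by simp
  next
    case (pl i)
    have "tail (gr K) (bcopy d (P ! i)) = Old (BF (face_of G (G.e d')))"
      using eq unfolding pl l[OF d(2)] .
    then show ?thesis using pl(1) d by (simp add: tail_K_P split: if_splits)
  next
    case (lp i)
    have "tail (gr K) (bcopy d' (P ! i)) = Old (BF (face_of G (G.e d)))"
      using eq[symmetric] unfolding lp l[OF d(1)] .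
    then show ?thesis using lp(1) d by (simp add: tail_K_P split: if_splits)
  next
    case (pp i j)
    have w: "M.w i = M.w j \<longleftrightarrow> i = j" using pp M.w_inj by simp
    consider "i = 0" "j = 0" | "i = j" "d = d'" | "i = k" "j = k" "G.ta d = G.ta d'"
      using eq d pp w by (auto simp: tail_K_P split: if_splits)
    then show ?thesis
    proof cases
      case 1
      then have "{d, G.e d} = {d', G.e d'}" using eq d pp by (simp add: tail_K_P)
      then have "d' = d \<or> d' = G.e d" by blast
      moreover have "((d, P ! 0), (G.e d, P ! 0)) \<in> cc rot_rel"
        using rot_rel_S[OF d(1) PS, of 0] pp 1 M.k_pos M.nx_first by (simp add: across_P)
      ultimately show ?thesis using 1 pp by auto
    next
      case 2
      then show ?thesis using pp by simp
    next
      case 3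
      obtain h where h: "k = Suc h" "h < n" "Suc h < n" using M.k_pos M.k_less by (cases k) auto
      \<comment> \<open>Between consecutive arcs of \<open>G\<close> at a 0-vertex the rotation
        meets two segments, one in \<open>VF\<close> and one in \<open>VE\<close>, hence two steps
        here.\<close>
      have rot: "((a, P ! k), (G.r a, P ! k)) \<in> cc rot_rel" if a: "a \<in> G.A" for a
      proof (rule cc_trans)
        show "((a, P ! k), (G.e (G.r a), M.e (P ! h))) \<in> cc rot_rel"
          using rot_rel_S[OF a PS[OF M.k_less]] M.nx_Suc[of h] h by (simp add: across_P)
        show "((G.e (G.r a), M.e (P ! h)), (G.r a, P ! k)) \<in> cc rot_rel"
          using rot_rel_S[of "G.e (G.r a)" "M.e (P ! h)"] M.nx_opp[of h] h a by (simp add: across_opp)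
      qed
      have "d' \<in> out_arcs (gr G) (G.ta d)" using 3 d(2) by simp
      then have "d' \<in> orbit G.r d" by (simp only: G.out_arcs_eq_orbit[OF d(1)])
      then have "d' \<in> G.A \<and> ((d, P ! k), (d', P ! k)) \<in> cc rot_rel"
      proof induction
        case base
        then show ?case using rot d(1) by simp
      next
        case (step a)
        then show ?case using cc_trans[OF _ rot[of a], of "(d, P ! k)"] by simp
      qed
      then show ?thesis using 3 pp by simp
    qed
  qed
qed

lemma tail_K_related:
  assumes "d \<in> G.A" "d' \<in> G.A" "c \<in> S" "c' \<in> S"
    and eq: "tail (gr K) (bcopy d c) = tail (gr K) (bcopy d' c')"
  shows "((d, c), (d', c')) \<in> cc rot_rel"
proof -
  obtain a b where ab: "a \<in> G.A" "((d, c), (a, b)) \<in> cc rot_rel"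
    "tail (gr K) (bcopy d c) = tail (gr K) (bcopy a b)" "b = M.e (P ! (n - 1)) \<or> (\<exists>i<n. b = P ! i)"
    using normal_dart[OF assms(1,3)] by blast
  obtain a' b' where ab': "a' \<in> G.A" "((d', c'), (a', b')) \<in> cc rot_rel"
    "tail (gr K) (bcopy d' c') = tail (gr K) (bcopy a' b')" "b' = M.e (P ! (n - 1)) \<or> (\<exists>i<n. b' = P ! i)"
    using normal_dart[OF assms(2,4)] by blast
  have "((a, b), (a', b')) \<in> cc rot_rel"
    using normal_darts_related[OF ab(1) ab'(1) ab(4) ab'(4)] ab(3) ab'(3) eq by simp
  then show ?thesis by (rule cc_trans[OF ab(2) cc_trans[OF _ cc_sym[OF ab'(2)]]])
qed

text \<open>At a path vertex each arc can be turned to a path arc inside its double chamber, which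
  leads to \<open>tail_K_related\<close>. Around any other vertex the rotation crosses no path arc
  and stays in one double chamber.\<close>

lemma copy_tail_related:
  assumes "d \<in> G.A" "d' \<in> G.A" "c \<in> M.A" "c' \<in> M.A" and eq: "copy_tail d c = copy_tail d' c'"
  shows "((d, c), (d', c')) \<in> cc rot_rel"
proof -
  have on: "\<exists>b\<in>S. ((a, x), (a, b)) \<in> cc rot_rel \<and> copy_tail a x = OnBoundary (tail (gr K) (bcopy a b))"
    if "a \<in> G.A" "x \<in> M.A" "M.ta x \<in> M.ta ` S" for a x
  proof (cases "x \<in> S")
    case True
    then show ?thesis by (intro bexI[of _ x]) (simp_all add: copy_tail_S)
  next
    case False
    then show ?thesis
      using rot_rel_nx[OF that] that M.nx_in_S[OF that(2,3)]
      by (intro bexI[of _ "nx x"]) (simp_all add: copy_tail_on across_off)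
  qed
  show ?thesis
  proof (cases "M.ta c \<in> M.ta ` S")
    case True
    then have True': "M.ta c' \<in> M.ta ` S"
      using eq on[OF assms(1,3) True] copy_tail_off[of c' d'] by (cases "M.ta c' \<in> M.ta ` S") auto
    obtain b where b: "b \<in> S" "((d, c), (d, b)) \<in> cc rot_rel" "copy_tail d c = OnBoundary (tail (gr K) (bcopy d b))"
      using on[OF assms(1,3) True] by blast
    obtain b' where b': "b' \<in> S" "((d', c'), (d', b')) \<in> cc rot_rel"
      "copy_tail d' c' = OnBoundary (tail (gr K) (bcopy d' b'))"
      using on[OF assms(2,4) True'] by blast
    have "((d, b), (d', b')) \<in> cc rot_rel"
      using eq b b' assms(1,2) by (intro tail_K_related) simp_all
    then show ?thesis by (rule cc_trans[OF b(2) cc_trans[OF _ cc_sym[OF b'(2)]]])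
  next
    case False
    have False': "M.ta c' \<notin> M.ta ` S"
      using eq on[OF assms(2,4)] copy_tail_off[OF False, of d] by auto
    have "chamber d = chamber d'" "M.ta c = M.ta c'"
      using eq copy_tail_off[OF False, of d] copy_tail_off[OF False', of d'] by simp_all
    then have d: "d = d'" using chamber_inj assms by blast
    obtain m where m: "c' = (M.r ^^ m) c"
      using M.ex_rot_funpow[OF assms(3,4)] \<open>M.ta c = M.ta c'\<close> by metis
    have "((d, c), (d, (M.r ^^ j) c)) \<in> cc rot_rel" for j
    proof (induction j)
      case (Suc j)
      have "M.ta ((M.r ^^ j) c) \<notin> M.ta ` S" using False assms(3) by simp
      then have "(M.r ^^ j) c \<notin> S" by blast
      then have "((d, (M.r ^^ j) c), (d, (M.r ^^ Suc j) c)) \<in> cc rot_rel"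
        using rot_rel_step[OF assms(1) M.rot_funpow_in[OF assms(3)], of j] across_off by simp
      then show ?case by (rule cc_trans[OF Suc])
    qed simp
    then show ?thesis using m d by simp
  qed
qed

end

text \<open>The renaming of \<open>(d, c)\<close> to \<open>(act (s c) d, c)\<close> intertwines the
  crossings of \<open>P\<close> and \<open>Q\<close>, hence also the rotations, as \<open>s\<close>
  agrees on \<open>opp Op c\<close> and \<open>rot Op c\<close>. The implication for vertices goes
  one way; exchanging the paths and negating \<open>s\<close> gives the converse.\<close>

lemma copy_tail_transfer:
  fixes Op :: "('w, 'c) lopsp" and G :: "('v, 'd) emb"
  assumes "apply_map Op P G" "apply_map Op Q G" "emb_map.face_inv Op s"
    and g: "\<And>c. c \<in> arcs (gr Op) \<Longrightarrow> cut_map.nu Op Q (gen True) (gen False) c + s c =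
      s (opp Op c) + cut_map.nu Op P (gen True) (gen False) c"
  shows "\<And>d c. d \<in> arcs (gr G) \<Longrightarrow> c \<in> arcs (gr Op) \<Longrightarrow>
      apply_map.across Op Q G c (act (emb_map.dart_letter G) (s c) d) =
      act (emb_map.dart_letter G) (s (opp Op c)) (apply_map.across Op P G c d)"
    and "\<And>d c d' c'. d \<in> arcs (gr G) \<Longrightarrow> d' \<in> arcs (gr G) \<Longrightarrow> c \<in> arcs (gr Op) \<Longrightarrow> c' \<in> arcs (gr Op) \<Longrightarrow>
      apply_map.copy_tail Op P G d c = apply_map.copy_tail Op P G d' c' \<Longrightarrow>
      apply_map.copy_tail Op Q G (act (emb_map.dart_letter G) (s c) d) c =
      apply_map.copy_tail Op Q G (act (emb_map.dart_letter G) (s c') d') c'"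
proof -
  interpret P: apply_map Op P G by fact
  interpret Q: apply_map Op Q G by fact
  let ?act = "act P.G.dart_letter"
  show across: "Q.across c (?act (s c) d) = ?act (s (P.M.e c)) (P.across c d)"
    if "d \<in> P.G.A" "c \<in> P.M.A" for d c
    unfolding P.across_def Q.across_def using that g[OF that(2)] by (simp add: P.G.act_plus[symmetric])
  have step: "Q.copy_tail (?act (s (P.M.r c)) (P.across c d)) (P.M.r c) = Q.copy_tail (?act (s c) d) c"
    if "d \<in> P.G.A" "c \<in> P.M.A" for d c
    using Q.copy_tail_rot[OF P.G.act_closed[OF that(1), of "s c"] that(2)] across[OF that]
      P.M.face_inv_opp[OF assms(3) that(2)] by simp
  fix d c d' c'
  assume *: "d \<in> P.G.A" "d' \<in> P.G.A" "c \<in> P.M.A" "c' \<in> P.M.A" "P.copy_tail d c = P.copy_tail d' c'"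
  define f where "f x = Q.copy_tail (?act (s (snd x)) (fst x)) (snd x)" for x
  \<comment> \<open>The \<open>Q\<close>-vertex of the renamed arc is constant along rotation steps
    of \<open>P\<close>, hence on each \<open>P\<close>-vertex.\<close>
  have f: "f x = f y" if "(x, y) \<in> P.rot_rel" for x y
    using that step unfolding P.rot_rel_def f_def by auto
  have "((d, c), (d', c')) \<in> cc P.rot_rel"
    using * by (rule P.copy_tail_related)
  then have "f (d', c') = f (d, c)"
    by (induction rule: cc_induct) (auto dest: f)
  then show "Q.copy_tail (?act (s c) d) c = Q.copy_tail (?act (s c') d') c'"
    by (simp add: f_def)
qed

text \<open>All vertices are tails of arcs, so a bijection of arcs that preserves and reflects
  equality of tails determines the map on vertices. The common index set \<open>X\<close> stands in
  for the arcs of both graphs.\<close>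

lemma lemb_isoI:
  assumes p: "bij_betw p X (arcs (gr G))" and q: "bij_betw q X (arcs (gr H))"
    and op: "\<And>x. x \<in> X \<Longrightarrow> ox x \<in> X \<and> opp G (p x) = p (ox x) \<and> opp H (q x) = q (ox x)"
    and ro: "\<And>x. x \<in> X \<Longrightarrow> rx x \<in> X \<and> rot G (p x) = p (rx x) \<and> rot H (q x) = q (rx x)"
    and verts: "verts (gr G) = tail (gr G) ` arcs (gr G)" "verts (gr H) = tail (gr H) ` arcs (gr H)"
    and head: "\<And>a. head (gr G) a = tail (gr G) (opp G a)" "\<And>a. head (gr H) a = tail (gr H) (opp H a)"
    and ta: "\<And>x y. x \<in> X \<Longrightarrow> y \<in> X \<Longrightarrow>
      tail (gr G) (p x) = tail (gr G) (p y) \<longleftrightarrow> tail (gr H) (q x) = tail (gr H) (q y)"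
    and ty: "\<And>x. x \<in> X \<Longrightarrow> vtype G (tail (gr G) (p x)) = vtype H (tail (gr H) (q x))"
  shows "lemb_iso G H"
proof -
  define g where "g = q \<circ> inv_into X p"
  have g: "g (p x) = q x" if "x \<in> X" for x
    using p that by (simp add: g_def bij_betw_inv_into_left)
  have bg: "bij_betw g (arcs (gr G)) (arcs (gr H))"
    unfolding g_def using bij_betw_inv_into[OF p] q by (rule bij_betw_trans)
  have arcE: "\<exists>x\<in>X. a = p x" if "a \<in> arcs (gr G)" for a
    using that p by (auto simp: bij_betw_def)
  define f where "f v = tail (gr H) (g (SOME a. a \<in> arcs (gr G) \<and> tail (gr G) a = v))" for v
  have pX: "p x \<in> arcs (gr G)" if "x \<in> X" for x using p that by (auto simp: bij_betw_def)
  have f: "f (tail (gr G) (p x)) = tail (gr H) (q x)" if x: "x \<in> X" for x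
  proof -
    have ex: "\<exists>a. a \<in> arcs (gr G) \<and> tail (gr G) a = tail (gr G) (p x)" using pX[OF x] by blast
    define b where "b = (SOME a. a \<in> arcs (gr G) \<and> tail (gr G) a = tail (gr G) (p x))"
    have b: "b \<in> arcs (gr G)" "tail (gr G) b = tail (gr G) (p x)"
      unfolding b_def using someI_ex[OF ex] by blast+
    obtain y where y: "y \<in> X" "b = p y" using arcE[OF b(1)] by blast
    then have "tail (gr H) (q y) = tail (gr H) (q x)" using ta[of y x] x b(2) by simp
    then show ?thesis unfolding f_def b_def[symmetric] y(2) g[OF y(1)] .
  qed
  have vG: "verts (gr G) = (\<lambda>x. tail (gr G) (p x)) ` X"
    unfolding verts(1) bij_betw_imp_surj_on[OF p, symmetric] by (simp only: image_image)
  have vH: "verts (gr H) = (\<lambda>x. tail (gr H) (q x)) ` X"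
    unfolding verts(2) bij_betw_imp_surj_on[OF q, symmetric] by (simp only: image_image)
  have bf: "bij_betw f (verts (gr G)) (verts (gr H))"
    unfolding bij_betw_def
  proof
    show "inj_on f (verts (gr G))"
      unfolding vG by (rule inj_onI) (auto simp: f ta)
    show "f ` verts (gr G) = verts (gr H)"
      unfolding vG vH image_image by (rule image_cong) (simp_all add: f)
  qed
  have "\<forall>a\<in>arcs (gr G). tail (gr H) (g a) = f (tail (gr G) a) \<and> head (gr H) (g a) = f (head (gr G) a) \<and>
      opp H (g a) = g (opp G a) \<and> rot H (g a) = g (rot G a)"
  proof
    fix a assume "a \<in> arcs (gr G)"
    then obtain x where x: "x \<in> X" "a = p x" using arcE by blast
    then show "tail (gr H) (g a) = f (tail (gr G) a) \<and> head (gr H) (g a) = f (head (gr G) a) \<and>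
      opp H (g a) = g (opp G a) \<and> rot H (g a) = g (rot G a)"
      using op[OF x(1)] ro[OF x(1)] by (simp add: f g head)
  qed
  moreover have "\<forall>v\<in>verts (gr G). vtype H (f v) = vtype G v"
    unfolding vG using ty by (simp add: f)
  ultimately show ?thesis unfolding lemb_iso_def using bf bg by blast
qed

theorem theorem10:
  fixes Op :: "('w, 'c) lopsp" and P Q :: "'c list" and G :: "('v, 'd) emb"
  assumes "lopsp_operation Op"
    and "cut_path Op P" and "cut_path Op Q"
    and "embedded_graph G"
  shows "lemb_iso (apply_lopsp Op P G) (apply_lopsp Op Q G)"
proof -
  have plane: "embedded_graph Op" "genus Op = 0" "inj_on (special Op) {0, 1, 2}"
    using assms(1) by (simp_all add: lopsp_operation_def plane_def)
  have pm: "plane_map Op" using plane by unfold_locales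
  have am: "apply_map Op R G" if "cut_path Op R" for R
    using plane that assms(4) by unfold_locales
  interpret P: apply_map Op P G by (rule am) fact
  interpret Q: apply_map Op Q G by (rule am) fact
  have cm: "cut_map Op P" "cut_map Op Q" by unfold_locales
  let ?nuP = "P.M.nu (gen True) (gen False)" and ?nuQ = "Q.M.nu (gen True) (gen False)"
  obtain s where s: "P.M.face_inv s" "\<And>c. c \<in> P.M.A \<Longrightarrow> ?nuQ c = P.M.gauge s ?nuP c"
    \<comment> \<open>The order of the paths is exchanged so that the transformation leads from the
      cochain of \<open>P\<close> to that of \<open>Q\<close>.\<close>
    using cut_paths_gauge_equivalent[OF pm cm(2,1), of True False] by auto
  have s1: "?nuQ c + s c = s (P.M.e c) + ?nuP c" if "c \<in> P.M.A" for c
    using s(2)[OF that] by (simp add: P.M.gauge_def)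
  \<comment> \<open>The inverse transformation \<open>- s\<close>, from \<open>Q\<close> back to
    \<open>P\<close>, yields the converse implication between coincidences of vertices.\<close>
  have s2: "?nuP c + - s c = - s (P.M.e c) + ?nuQ c" if "c \<in> P.M.A" for c
    using s(2)[OF that] by (simp add: P.M.gauge_def diff_conv_add_uminus add.assoc del: add_uminus_conv_diff)
  have s': "P.M.face_inv (\<lambda>c. - s c)" using s(1) by (simp add: P.M.face_inv_def)
  let ?act = "act P.G.dart_letter"
  note across = copy_tail_transfer(1)[OF P.apply_map_axioms Q.apply_map_axioms s(1) s1]
  note ta1 = copy_tail_transfer(2)[OF P.apply_map_axioms Q.apply_map_axioms s(1) s1]
  note ta2 = copy_tail_transfer(2)[OF Q.apply_map_axioms P.apply_map_axioms s' s2]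
  let ?X = "P.G.A \<times> P.M.A"
  define \<theta> where "\<theta> x = (?act (s (snd x)) (fst x), snd x)" for x
  define p where "p x = P.copy (fst x) (snd x)" for x
  define q where "q x = Q.copy (?act (s (snd x)) (fst x)) (snd x)" for x
  show ?thesis
  proof (rule lemb_isoI[where p = p and q = q and X = ?X
        and ox = "\<lambda>x. (P.across (snd x) (fst x), P.M.e (snd x))"
        and rx = "\<lambda>x. (P.across (snd x) (fst x), P.M.r (snd x))"])
    show "bij_betw p ?X (arcs (gr P.GL))"
      using P.bij_betw_copy by (simp add: p_def[abs_def] case_prod_beta')
    have "bij_betw \<theta> ?X ?X"
      by (rule bij_betw_byWitness[where f' = "\<lambda>x. (?act (- s (snd x)) (fst x), snd x)"])
         (auto simp: \<theta>_def P.G.act_uminus P.G.act_uminus' P.G.act_closed)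
    then have "bij_betw ((\<lambda>x. Q.copy (fst x) (snd x)) \<circ> \<theta>) ?X (arcs (gr Q.GL))"
      by (rule bij_betw_trans) (use Q.bij_betw_copy in \<open>simp add: case_prod_beta'\<close>)
    then show "bij_betw q ?X (arcs (gr Q.GL))"
      by (simp add: q_def[abs_def] \<theta>_def comp_def)
  next
    fix x assume x: "x \<in> ?X"
    show "(P.across (snd x) (fst x), P.M.e (snd x)) \<in> ?X \<and>
        opp P.GL (p x) = p (P.across (snd x) (fst x), P.M.e (snd x)) \<and>
        opp Q.GL (q x) = q (P.across (snd x) (fst x), P.M.e (snd x))"
      using x across by (auto simp: p_def q_def P.opp_GL Q.opp_GL P.G.act_closed)
    show "(P.across (snd x) (fst x), P.M.r (snd x)) \<in> ?X \<and>
        rot P.GL (p x) = p (P.across (snd x) (fst x), P.M.r (snd x)) \<and>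
        rot Q.GL (q x) = q (P.across (snd x) (fst x), P.M.r (snd x))"
      using x across P.M.face_inv_opp[OF s(1)]
      by (auto simp: p_def q_def P.rot_GL Q.rot_GL P.G.act_closed)
    show "vtype P.GL (tail (gr P.GL) (p x)) = vtype Q.GL (tail (gr Q.GL) (q x))"
      using x P.vtype_GL Q.vtype_GL
      by (auto simp: p_def q_def P.copy_tail_def[symmetric] Q.copy_tail_def[symmetric] P.G.act_closed)
  next
    show "verts (gr P.GL) = tail (gr P.GL) ` arcs (gr P.GL)"
      unfolding P.verts_GL P.arcs_GL image_image by (simp add: P.copy_tail_def case_prod_beta')
    show "verts (gr Q.GL) = tail (gr Q.GL) ` arcs (gr Q.GL)"
      unfolding Q.verts_GL Q.arcs_GL image_image by (simp add: Q.copy_tail_def case_prod_beta')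
  next
    fix x y assume xy: "x \<in> ?X" "y \<in> ?X"
    obtain d c d' c' where dc: "x = (d, c)" "y = (d', c')" "d \<in> P.G.A" "d' \<in> P.G.A" "c \<in> P.M.A" "c' \<in> P.M.A"
      using xy by auto
    have "P.copy_tail d c = P.copy_tail d' c' \<longleftrightarrow> Q.copy_tail (?act (s c) d) c = Q.copy_tail (?act (s c') d') c'"
    proof
      assume "P.copy_tail d c = P.copy_tail d' c'"
      then show "Q.copy_tail (?act (s c) d) c = Q.copy_tail (?act (s c') d') c'"
        using ta1[OF _ dc(3-6)] by simp
    next
      assume "Q.copy_tail (?act (s c) d) c = Q.copy_tail (?act (s c') d') c'"
      then show "P.copy_tail d c = P.copy_tail d' c'"
        using ta2[OF _ P.G.act_closed[OF dc(3), of "s c"] P.G.act_closed[OF dc(4), of "s c'"] dc(5,6)]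
          dc(3,4) by (simp add: P.G.act_uminus)
    qed
    then show "tail (gr P.GL) (p x) = tail (gr P.GL) (p y) \<longleftrightarrow> tail (gr Q.GL) (q x) = tail (gr Q.GL) (q y)"
      by (simp add: dc p_def q_def P.copy_tail_def Q.copy_tail_def)
  qed (simp_all add: P.head_GL Q.head_GL)
qed

end
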